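(* Let $\alpha\in(0,\infty)\setminus\{1\}$ and $p>0$, and let $\mathcal{M}_{\alpha,p}$ be any of $R_{\alpha,p}$, $G_{\alpha,p}$, $SG_{\alpha,p}$, $\widetilde{SG}_{\alpha,p}$ and $LE_\alpha$. (i) If $\mathrm{Tr}\,\mathcal{M}_{\alpha,p}$ is jointly concave, then $0<\alpha<1$ and $$\mathrm{Tr}\,G_{\alpha,1}(A,B)\le\mathrm{Tr}\,\mathcal{M}_{\alpha,p}(A,B)\le\mathrm{Tr}\,R_{\alpha,1/\alpha}(A,B)$$ for all $(A,B)\in\mathrm{dom}\,\mathcal{M}_{\alpha,p}$. (ii) If $\mathrm{Tr}\,\mathcal{M}_{\alpha,p}$ is jointly convex, then $\alpha>1$ and $$\mathrm{Tr}\,R_{\alpha,1/\alpha}(A,B)\le\mathrm{Tr}\,\mathcal{M}_{\alpha,p}(A,B)\le\mathrm{Tr}\,G_{\alpha,1}(A,B)$$ for all $(A,B)\in\mathrm{dom}\,\mathcal{M}_{\alpha,p}$.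
   Context: Notation: $\mathbb{M}_n$ is the set of $n\times n$ complex matrices, $\mathbb{M}_n^+$ (resp. $\mathbb{M}_n^{++}$) the positive semidefinite (resp. positive definite) ones, $\mathrm{Tr}$ the usual trace. $s(A)$ is the support projection of $A\ge0$. $A^{-1}$ denotes the generalized inverse (the inverse on the support of $A$, zero on the kernel), and $A^r:=(A^{-1})^{-r}$ for $r<0$. For $\alpha>0$ and $A,B\ge0$ with $s(A)\ge s(B)$, $A\#_\alpha B:=A^{1/2}(A^{-1/2}BA^{-1/2})^{\alpha}A^{1/2}$; for $0<\alpha<1$ and general $A,B\ge0$, $A\#_\alpha B:=\lim_{\varepsilon\searrow0}(A+\varepsilon I)\#_\alpha(B+\varepsilon I)$ (consistent with the formula when $s(A)\ge s(B)$). Write $\#:=\#_{1/2}$. Define - $G_{\alpha,p}(A,B):=(A^p\#_\alpha B^p)^{1/p}$; - $R_{\alpha,p}(A,B):=\bigl(A^{\frac{1-\alpha}{2}p}B^{\alpha p}A^{\frac{1-\alpha}{2}p}\bigr)^{1/p}$; - $SG_{\alpha,p}(A,B):=\bigl((A^{-p}\#B^p)^{\alpha}A^p(A^{-p}\#B^p)^{\alpha}\bigr)^{1/p}$; - $\widetilde{SG}_{\alpha,p}(A,B):=\bigl((A^{-p}\#_\alpha B^p)^{1/2}A^{2(1-\alpha)p}(A^{-p}\#_\alpha B^p)^{1/2}\bigr)^{1/p}$; - $LE_\alpha(A,B):=P_0\exp\{(1-\alpha)P_0(\log A)P_0+\alpha P_0(\log B)P_0\}$ with $P_0:=s(A)\wedge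 s(B)$, where $\log A$ is taken on the support of $A$ (so $LE_\alpha(A,B)=\exp((1-\alpha)\log A+\alpha\log B)$ for $A,B>0$). Domains: $\mathrm{dom}\,\mathcal{M}_{\alpha,p}$ is $\bigsqcup_{n\ge1}(\mathbb{M}_n^+\times\mathbb{M}_n^+)$ for $G_{\alpha,p},R_{\alpha,p},LE_\alpha$ with $0<\alpha<1$; it is $\bigsqcup_{n\ge1}\{(A,B)\in\mathbb{M}_n^+\times\mathbb{M}_n^+:s(A)\ge s(B)\}$ for $G_{\alpha,p},R_{\alpha,p},LE_\alpha$ with $\alpha>1$ and for $SG_{\alpha,p},\widetilde{SG}_{\alpha,p}$ with any $\alpha\in(0,\infty)\setminus\{1\}$. "$\mathrm{Tr}\,\mathcal{M}_{\alpha,p}$ is jointly concave (convex)" means that $(A,B)\mapsto\mathrm{Tr}\,\mathcal{M}_{\alpha,p}(A,B)$ is jointly concave (convex) on the $n\times n$ part of $\mathrm{dom}\,\mathcal{M}_{\alpha,p}$ for every $n\in\mathbb{N}$; equivalently, on $\mathbb{M}_n^{++}\times\mathbb{M}_n^{++}$ for every $n\in\mathbb{N}$. *)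

theory Defs
  imports Complex_Main "Jordan_Normal_Form.Schur_Decomposition"
begin

definition hermitian_mat :: "nat \<Rightarrow> complex mat \<Rightarrow> bool" where
  "hermitian_mat n A \<longleftrightarrow> A \<in> carrier_mat n n \<and> mat_adjoint A = A"

definition unitary_mat :: "nat \<Rightarrow> complex mat \<Rightarrow> bool" where
  "unitary_mat n U \<longleftrightarrow>
     U \<in> carrier_mat n n \<and> U * mat_adjoint U = 1\<^sub>m n \<and> mat_adjoint U * U = 1\<^sub>m n"

definition psd_mat :: "nat \<Rightarrow> complex mat \<Rightarrow> bool" where
  "psd_mat n A \<longleftrightarrow>
     hermitian_mat n A \<and> (\<forall>v\<in>carrier_vec n. 0 \<le> Re ((A *\<^sub>v v) \<bullet>c v))"

definition loewner_le :: "complex mat \<Rightarrow> complex mat \<Rightarrow> bool" (infix "\<preceq>\<^sub>L" 50) where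
  "A \<preceq>\<^sub>L B \<longleftrightarrow> psd_mat (dim_row B) (B - A)"

definition mat_trace :: "complex mat \<Rightarrow> complex" where
  "mat_trace A = (\<Sum>i<dim_row A. A $$ (i, i))"

text \<open>Functional calculus. For Hermitian \<open>A\<close> a diagonalisation exists and the resulting
  matrix does not depend on it; for other matrices the value is unspecified.\<close>

definition mat_fun :: "(real \<Rightarrow> real) \<Rightarrow> complex mat \<Rightarrow> complex mat" where
  "mat_fun f A = (THE B. \<exists>U d. unitary_mat (dim_row A) U \<and>
     A = U * mat_diag (dim_row A) (\<lambda>i. complex_of_real (d i)) * mat_adjoint U \<and>
     B = U * mat_diag (dim_row A) (\<lambda>i. complex_of_real (f (d i))) * mat_adjoint U)"

text \<open>Since \<open>0 powr r = 0\<close> for every \<open>r\<close>, the power below vanishes on the kernel of \<open>A\<close>; for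
  \<open>r < 0\<close> it is therefore the power \<open>-r\<close> of the generalised inverse of \<open>A\<close>.\<close>

definition mat_powr :: "complex mat \<Rightarrow> real \<Rightarrow> complex mat" where
  "mat_powr A r = mat_fun (\<lambda>x. x powr r) A"

definition mat_exp :: "complex mat \<Rightarrow> complex mat" where
  "mat_exp A = mat_fun exp A"

text \<open>Logarithm on the support of \<open>A\<close>, extended by zero on the kernel.\<close>

definition mat_log :: "complex mat \<Rightarrow> complex mat" where
  "mat_log A = mat_fun (\<lambda>x. if x = 0 then 0 else ln x) A"

definition supp_proj :: "complex mat \<Rightarrow> complex mat" where
  "supp_proj A = mat_fun (\<lambda>x. if x = 0 then 0 else 1) A"

definition orth_proj :: "nat \<Rightarrow> complex mat \<Rightarrow> bool" where
  "orth_proj n P \<longleftrightarrow> hermitian_mat n P \<and> P * P = P"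

text \<open>Meet of two orthogonal projections: the orthogonal projection onto the intersection of
  their ranges (the range of a projection being its set of fixed vectors).\<close>

definition proj_meet :: "complex mat \<Rightarrow> complex mat \<Rightarrow> complex mat" where
  "proj_meet P Q = (THE R. orth_proj (dim_row P) R \<and>
     (\<forall>v\<in>carrier_vec (dim_row P). R *\<^sub>v v = v \<longleftrightarrow> P *\<^sub>v v = v \<and> Q *\<^sub>v v = v))"

definition geo_mean_formula :: "real \<Rightarrow> complex mat \<Rightarrow> complex mat \<Rightarrow> complex mat" where
  "geo_mean_formula \<alpha> A B =
     mat_powr A (1/2) * mat_powr (mat_powr A (-1/2) * B * mat_powr A (-1/2)) \<alpha> * mat_powr A (1/2)"

text \<open>\<open>geo_mean \<alpha> A B\<close> is the weighted geometric mean of \<open>A\<close> and \<open>B\<close>. The second branch (an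
  entrywise limit) is meant for \<open>0 < \<alpha> < 1\<close> only; for \<open>\<alpha> > 1\<close> the mean is only used under the
  support condition of the first branch.\<close>

definition geo_mean :: "real \<Rightarrow> complex mat \<Rightarrow> complex mat \<Rightarrow> complex mat" where
  "geo_mean \<alpha> A B =
     (if supp_proj B \<preceq>\<^sub>L supp_proj A then geo_mean_formula \<alpha> A B
      else mat (dim_row A) (dim_row A) (\<lambda>(i, j). Lim (at_right (0::real)) (\<lambda>\<epsilon>.
        geo_mean_formula \<alpha> (A + complex_of_real \<epsilon> \<cdot>\<^sub>m 1\<^sub>m (dim_row A))
                           (B + complex_of_real \<epsilon> \<cdot>\<^sub>m 1\<^sub>m (dim_row A)) $$ (i, j))))"

definition G_mean :: "real \<Rightarrow> real \<Rightarrow> complex mat \<Rightarrow> complex mat \<Rightarrow> complex mat" where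
  "G_mean \<alpha> p A B = mat_powr (geo_mean \<alpha> (mat_powr A p) (mat_powr B p)) (1/p)"

definition R_mean :: "real \<Rightarrow> real \<Rightarrow> complex mat \<Rightarrow> complex mat \<Rightarrow> complex mat" where
  "R_mean \<alpha> p A B =
     mat_powr (mat_powr A ((1-\<alpha>)/2 * p) * mat_powr B (\<alpha> * p) * mat_powr A ((1-\<alpha>)/2 * p)) (1/p)"

definition SG_mean :: "real \<Rightarrow> real \<Rightarrow> complex mat \<Rightarrow> complex mat \<Rightarrow> complex mat" where
  "SG_mean \<alpha> p A B =
     (let C = mat_powr (geo_mean (1/2) (mat_powr A (-p)) (mat_powr B p)) \<alpha>
      in mat_powr (C * mat_powr A p * C) (1/p))"

definition SGt_mean :: "real \<Rightarrow> real \<Rightarrow> complex mat \<Rightarrow> complex mat \<Rightarrow> complex mat" where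
  "SGt_mean \<alpha> p A B =
     (let C = mat_powr (geo_mean \<alpha> (mat_powr A (-p)) (mat_powr B p)) (1/2)
      in mat_powr (C * mat_powr A (2 * (1-\<alpha>) * p) * C) (1/p))"

definition LE_mean :: "real \<Rightarrow> complex mat \<Rightarrow> complex mat \<Rightarrow> complex mat" where
  "LE_mean \<alpha> A B =
     (let P0 = proj_meet (supp_proj A) (supp_proj B)
      in P0 * mat_exp (complex_of_real (1-\<alpha>) \<cdot>\<^sub>m (P0 * mat_log A * P0)
                       + complex_of_real \<alpha> \<cdot>\<^sub>m (P0 * mat_log B * P0)))"

datatype mean_kind = R | G | SG | SGt | LE

primrec qmean :: "mean_kind \<Rightarrow> real \<Rightarrow> real \<Rightarrow> complex mat \<Rightarrow> complex mat \<Rightarrow> complex mat" where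
  "qmean R \<alpha> p A B = R_mean \<alpha> p A B"
| "qmean G \<alpha> p A B = G_mean \<alpha> p A B"
| "qmean SG \<alpha> p A B = SG_mean \<alpha> p A B"
| "qmean SGt \<alpha> p A B = SGt_mean \<alpha> p A B"
| "qmean LE \<alpha> p A B = LE_mean \<alpha> A B"

text \<open>The \<open>n \<times> n\<close> part of the domain (meant for \<open>\<alpha> > 0\<close>, \<open>\<alpha> \<noteq> 1\<close>).\<close>

definition qmean_dom :: "mean_kind \<Rightarrow> real \<Rightarrow> nat \<Rightarrow> (complex mat \<times> complex mat) set" where
  "qmean_dom k \<alpha> n = {(A, B). psd_mat n A \<and> psd_mat n B \<and>
     (\<alpha> > 1 \<or> k = SG \<or> k = SGt \<longrightarrow> supp_proj B \<preceq>\<^sub>L supp_proj A)}"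

text \<open>The matrix \<open>qmean k \<alpha> p A B\<close> is positive semidefinite on the domain, so that its trace is
  real; \<open>Re\<close> only changes the type.\<close>

definition tr_qmean :: "mean_kind \<Rightarrow> real \<Rightarrow> real \<Rightarrow> complex mat \<Rightarrow> complex mat \<Rightarrow> real" where
  "tr_qmean k \<alpha> p A B = Re (mat_trace (qmean k \<alpha> p A B))"

definition mat_mix :: "real \<Rightarrow> complex mat \<Rightarrow> complex mat \<Rightarrow> complex mat" where
  "mat_mix t A B = complex_of_real (1 - t) \<cdot>\<^sub>m A + complex_of_real t \<cdot>\<^sub>m B"

definition tr_jointly_concave :: "mean_kind \<Rightarrow> real \<Rightarrow> real \<Rightarrow> bool" where
  "tr_jointly_concave k \<alpha> p \<longleftrightarrow>
     (\<forall>n\<ge>1. \<forall>(A1, B1)\<in>qmean_dom k \<alpha> n. \<forall>(A2, B2)\<in>qmean_dom k \<alpha> n. \<forall>t\<in>{0..1}.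
        (1 - t) * tr_qmean k \<alpha> p A1 B1 + t * tr_qmean k \<alpha> p A2 B2
          \<le> tr_qmean k \<alpha> p (mat_mix t A1 A2) (mat_mix t B1 B2))"

definition tr_jointly_convex :: "mean_kind \<Rightarrow> real \<Rightarrow> real \<Rightarrow> bool" where
  "tr_jointly_convex k \<alpha> p \<longleftrightarrow>
     (\<forall>n\<ge>1. \<forall>(A1, B1)\<in>qmean_dom k \<alpha> n. \<forall>(A2, B2)\<in>qmean_dom k \<alpha> n. \<forall>t\<in>{0..1}.
        tr_qmean k \<alpha> p (mat_mix t A1 A2) (mat_mix t B1 B2)
          \<le> (1 - t) * tr_qmean k \<alpha> p A1 B1 + t * tr_qmean k \<alpha> p A2 B2)"

end

theory Submission
  imports Defs "HOL-Analysis.Convex" "Jordan_Normal_Form.Spectral_Radius"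
begin

text \<open>Suppose \<open>Tr M\<close> is jointly concave. For the bound by \<open>G\<close>, the spectral decomposition of
  \<open>A^(-1/2) B A^(-1/2)\<close> writes the pair \<open>(A, B)\<close> as a sum of commuting pairs, on which all the means agree and
  have traces adding up to \<open>Tr G\<close>. For the bound by \<open>R\<close>, concavity and unitary invariance
  make \<open>Tr M\<close> monotone under pinching \<open>B\<close> in the eigenspaces of \<open>A\<close>; the pinched pair commutes,
  so that \<open>M\<close> may be replaced by \<open>R\<close>, and undoing the pinching inside \<open>Tr R\<close> costs a factor
  polynomial in the number of distinct eigenvalues of \<open>A\<close>. Both traces are multiplicative under
  tensor powers, while this number grows only polynomially, so that the factor disappears in
  the limit. The convex case is the same with all inequalities reversed. Singular pairs are
  reached by regularisation.\<close>

subsection \<open>Square complex matrices\<close>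

text \<open>Linearity explains the two extremal exponents. For \<open>p = 1/\<alpha>\<close> the
  matrix under the outer power of \<open>R\<close> is linear in \<open>B\<close>, so pinching passes
  through it and only the power \<alpha> has to be compared. For \<open>p = 1\<close> the mean
  \<open>G\<close> is the geometric mean itself, which is additive over the commuting pairs of the
  decomposition. The obstacle is the boundary. For the bound by \<open>R\<close>, a singular pair is
  mixed with (1, 1); joint concavity or convexity itself carries the mixture through
  \<open>Tr M\<close>, so a limit is taken only in \<open>Tr R\<close>. For the bound by
  \<open>G\<close>, the decomposition works directly as long as the support of \<open>A\<close>
  contains that of \<open>B\<close>. Otherwise \<alpha> is below 1 and the geometric mean is defined
  by a limit. That limit exists because the mean is jointly monotone, which rests on the
  Loewner-Heinz inequality; and upper semicontinuity of \<open>Tr M\<close> along the regularisation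
  is then proved separately for \<open>R\<close>, \<open>G\<close> and \<open>LE\<close>. The range
  of \<alpha> is read off from 1 by 1 matrices.\<close>

abbreviation sq :: "nat \<Rightarrow> complex mat set" where
  "sq n \<equiv> carrier_mat n n"

lemma sq_mult [simp, intro]: "A \<in> sq n \<Longrightarrow> B \<in> sq n \<Longrightarrow> A * B \<in> sq n"
  by (rule mult_carrier_mat)

lemma sq_assoc: "A \<in> sq n \<Longrightarrow> B \<in> sq n \<Longrightarrow> C \<in> sq n \<Longrightarrow> (A * B) * C = A * (B * C)"
  by (rule assoc_mult_mat)

lemma mult_idx:
  "A \<in> sq n \<Longrightarrow> B \<in> sq n \<Longrightarrow> i < n \<Longrightarrow> j < n \<Longrightarrow> (A * B) $$ (i, j) = (\<Sum>k<n. A $$ (i, k) * B $$ (k, j))"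
  by (auto simp: scalar_prod_def lessThan_atLeast0)

lemma adj_carrier [simp, intro]: "A \<in> sq n \<Longrightarrow> mat_adjoint A \<in> sq n"
  unfolding mat_adjoint_def by auto

lemma adj_idx: "A \<in> sq n \<Longrightarrow> i < n \<Longrightarrow> j < n \<Longrightarrow> mat_adjoint A $$ (i, j) = cnj (A $$ (j, i))"
  unfolding mat_adjoint_def by (auto simp: mat_of_rows_def)

lemma sq_eqI:
  "A \<in> sq n \<Longrightarrow> B \<in> sq n \<Longrightarrow> (\<And>i j. i < n \<Longrightarrow> j < n \<Longrightarrow> A $$ (i, j) = B $$ (i, j)) \<Longrightarrow> A = B"
  by (intro eq_matI) auto

lemma adj_mult: "A \<in> sq n \<Longrightarrow> B \<in> sq n \<Longrightarrow> mat_adjoint (A * B) = mat_adjoint B * mat_adjoint A"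
  by (rule sq_eqI[of _ n]) (auto simp: adj_idx[of _ n] mult_idx[of _ n] mult.commute simp del: index_mult_mat)

lemma adj_adj [simp]: "A \<in> sq n \<Longrightarrow> mat_adjoint (mat_adjoint A) = A"
  by (rule sq_eqI[of _ n]) (auto simp: adj_idx[of _ n])

lemma adj_one [simp]: "mat_adjoint (1\<^sub>m n :: complex mat) = 1\<^sub>m n"
  by (rule sq_eqI[of _ n]) (auto simp: adj_idx[of _ n])

lemma sq_one [simp]: "A \<in> sq n \<Longrightarrow> 1\<^sub>m n * A = A" "A \<in> sq n \<Longrightarrow> A * 1\<^sub>m n = A"
  by auto

section \<open>Real diagonal matrices and their unitary conjugates\<close>

definition dg :: "nat \<Rightarrow> (nat \<Rightarrow> real) \<Rightarrow> complex mat" where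
  "dg n d = mat_diag n (\<lambda>i. complex_of_real (d i))"

lemma dg_carrier [simp, intro]: "dg n d \<in> sq n"
  by (simp add: dg_def)

lemma dg_idx: "i < n \<Longrightarrow> j < n \<Longrightarrow> dg n d $$ (i, j) = (if i = j then complex_of_real (d i) else 0)"
  by (simp add: dg_def mat_diag_def)

lemma dg_adj [simp]: "mat_adjoint (dg n d) = dg n d"
  by (rule sq_eqI[of _ n]) (auto simp: adj_idx[of _ n] dg_idx)

lemma dg_mult [simp]: "dg n d * dg n e = dg n (\<lambda>i. d i * e i)"
  by (simp add: dg_def)

lemma dg_cong: "(\<And>i. i < n \<Longrightarrow> d i = e i) \<Longrightarrow> dg n d = dg n e"
  by (rule sq_eqI[of _ n]) (auto simp: dg_idx)

lemma dg_one [simp]: "dg n (\<lambda>_. 1) = 1\<^sub>m n"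
  by (simp add: dg_def)

lemma dg_left_idx: "A \<in> sq n \<Longrightarrow> i < n \<Longrightarrow> j < n \<Longrightarrow> (dg n d * A) $$ (i, j) = d i * A $$ (i, j)"
  unfolding dg_def by (subst mat_diag_mult_left[of _ n n]) auto

lemma dg_right_idx: "A \<in> sq n \<Longrightarrow> i < n \<Longrightarrow> j < n \<Longrightarrow> (A * dg n d) $$ (i, j) = A $$ (i, j) * d j"
  unfolding dg_def by (subst mat_diag_mult_right[of _ n n]) auto

text \<open>For unitary \<open>U\<close> this is a spectral decomposition. \<open>U\<close> is left
  arbitrary because \<open>compare_G\<close> inserts a matrix \<open>W\<close> that need not be
  unitary; the value is then the sum over i of \<open>d i\<close> times column i times the adjoint
  of that column.\<close>

definition ud :: "nat \<Rightarrow> complex mat \<Rightarrow> (nat \<Rightarrow> real) \<Rightarrow> complex mat" where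
  "ud n U d = U * dg n d * mat_adjoint U"

lemma ud_carrier [simp, intro]: "U \<in> sq n \<Longrightarrow> ud n U d \<in> sq n"
  by (simp add: ud_def)

lemma ud_idx:
  "U \<in> sq n \<Longrightarrow> r < n \<Longrightarrow> c < n \<Longrightarrow>
   ud n U d $$ (r, c) = (\<Sum>i<n. complex_of_real (d i) * U $$ (r, i) * cnj (U $$ (c, i)))"
  by (subst ud_def, subst mult_idx[of _ n])
    (auto simp: dg_right_idx[of _ n] adj_idx[of _ n] algebra_simps simp del: index_mult_mat)

lemma ud_cong: "(\<And>i. i < n \<Longrightarrow> d i = e i) \<Longrightarrow> ud n U d = ud n U e"
  using dg_cong[of n d e] by (simp add: ud_def)

lemma unitaryD:
  assumes "unitary_mat n U"
  shows "U \<in> sq n" "U * mat_adjoint U = 1\<^sub>m n" "mat_adjoint U * U = 1\<^sub>m n"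
  using assms by (auto simp: unitary_mat_def)

lemma unitaryI: "U \<in> sq n \<Longrightarrow> mat_adjoint U * U = 1\<^sub>m n \<Longrightarrow> unitary_mat n U"
  unfolding unitary_mat_def by (metis adj_carrier mat_mult_left_right_inverse)

lemma unitary_adj: "unitary_mat n U \<Longrightarrow> unitary_mat n (mat_adjoint U)"
  unfolding unitary_mat_def by (auto simp: adj_adj[of _ n])

lemma unitary_mult: 
  assumes "unitary_mat n U" "unitary_mat n V"
  shows "unitary_mat n (U * V)"
proof (rule unitaryI)
  note c = unitaryD[OF assms(1)] unitaryD[OF assms(2)]
  show "U * V \<in> sq n" using c by auto
  have "mat_adjoint (U * V) * (U * V) = mat_adjoint V * (mat_adjoint U * U) * V"
    using c(1,4) by (simp add: adj_mult[of _ n] sq_assoc[of _ n])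
  then show "mat_adjoint (U * V) * (U * V) = 1\<^sub>m n" using c by simp
qed

lemma unitary_one [simp]: "unitary_mat n (1\<^sub>m n)"
  by (simp add: unitary_mat_def)

lemma ud_mult:
  assumes "unitary_mat n U"
  shows "ud n U d * ud n U e = ud n U (\<lambda>i. d i * e i)"
proof -
  note c = unitaryD[OF assms]
  have "ud n U d * ud n U e = U * (dg n d * ((mat_adjoint U * U) * dg n e)) * mat_adjoint U"
    using c(1) by (simp add: ud_def sq_assoc[of _ n])
  also have "\<dots> = ud n U (\<lambda>i. d i * e i)"
    using c by (simp add: ud_def)
  finally show ?thesis .
qed

lemma ud_adj: "U \<in> sq n \<Longrightarrow> mat_adjoint (ud n U d) = ud n U d"
  by (simp add: ud_def adj_mult[of _ n] sq_assoc[of _ n])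

lemma ud_hermitian [simp]: "U \<in> sq n \<Longrightarrow> hermitian_mat n (ud n U d)"
  by (simp add: hermitian_mat_def ud_adj)

lemma ud_one: "unitary_mat n U \<Longrightarrow> ud n U (\<lambda>_. 1) = 1\<^sub>m n"
  using unitaryD[of n U] by (simp add: ud_def)

lemma ud_left: "U \<in> sq n \<Longrightarrow> V \<in> sq n \<Longrightarrow> V * ud n U d * mat_adjoint V = ud n (V * U) d"
  by (simp add: ud_def adj_mult[of _ n] sq_assoc[of _ n])

lemma ud_diag:
  assumes "unitary_mat n U" shows "mat_adjoint U * ud n U d * U = dg n d"
proof -
  note u = unitaryD[OF assms]
  have "mat_adjoint U * ud n U d * U = (mat_adjoint U * U) * dg n d * (mat_adjoint U * U)"
    using u(1) by (simp add: ud_def sq_assoc[of _ n])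
  then show ?thesis using u by simp
qed

lemma conj_linear:
  fixes X Y Z W :: "complex mat"
  assumes X: "X \<in> sq n" and Y: "Y \<in> sq n" and Z: "Z \<in> sq n" and W: "W \<in> sq n"
  shows "X * (x \<cdot>\<^sub>m Y + y \<cdot>\<^sub>m Z) * W = x \<cdot>\<^sub>m (X * Y * W) + y \<cdot>\<^sub>m (X * Z * W)"
proof -
  have "X * (x \<cdot>\<^sub>m Y + y \<cdot>\<^sub>m Z) = X * (x \<cdot>\<^sub>m Y) + X * (y \<cdot>\<^sub>m Z)"
    using X Y Z by (intro mult_add_distrib_mat[of _ n n]) auto
  also have "\<dots> = x \<cdot>\<^sub>m (X * Y) + y \<cdot>\<^sub>m (X * Z)"
    using mult_smult_distrib[OF X Y, of x] mult_smult_distrib[OF X Z, of y] by simp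
  finally have "X * (x \<cdot>\<^sub>m Y + y \<cdot>\<^sub>m Z) * W = (x \<cdot>\<^sub>m (X * Y) + y \<cdot>\<^sub>m (X * Z)) * W" by simp
  also have "\<dots> = x \<cdot>\<^sub>m (X * Y) * W + y \<cdot>\<^sub>m (X * Z) * W"
    using X Y Z W by (intro add_mult_distrib_mat[of _ n n]) auto
  also have "\<dots> = x \<cdot>\<^sub>m (X * Y * W) + y \<cdot>\<^sub>m (X * Z * W)"
    using X Y Z W mult_smult_assoc_mat[of "X * Y" n n W n x] mult_smult_assoc_mat[of "X * Z" n n W n y] by simp
  finally show ?thesis .
qed

subsection \<open>The spectral theorem\<close>

lemma hermD: "hermitian_mat n A \<Longrightarrow> A \<in> sq n" "hermitian_mat n A \<Longrightarrow> mat_adjoint A = A"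
  by (auto simp: hermitian_mat_def)

lemma herm_idx: "hermitian_mat n A \<Longrightarrow> i < n \<Longrightarrow> j < n \<Longrightarrow> cnj (A $$ (i, j)) = A $$ (j, i)"
  using adj_idx[of A n j i] by (auto simp: hermitian_mat_def)

lemma herm_conj:
  "hermitian_mat n A \<Longrightarrow> X \<in> sq n \<Longrightarrow> hermitian_mat n (X * A * mat_adjoint X)"
  by (auto simp: hermitian_mat_def adj_mult[of _ n] sq_assoc[of _ n])

text \<open>Prepares the deflation in the spectral theorem: complete \<open>v\<close> to a basis,
  orthogonalise, normalise. Gram-Schmidt leaves its first vector alone, so \<open>v\<close> changes
  only by the positive factor \<open>c\<close>.\<close>

lemma unitary_with_first_col:
  fixes v :: "complex vec"
  assumes v: "v \<in> carrier_vec n" "v \<noteq> 0\<^sub>v n"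
  obtains U c where "unitary_mat n U" "c > (0::real)" "\<And>i. i < n \<Longrightarrow> U $$ (i, 0) = c * v $ i"
proof -
  have n: "0 < n" using v by (cases n) auto
  interpret cof_vec_space n "TYPE(complex)" .
  define b where "b = basis_completion v"
  define ws where "ws = gram_schmidt n b"
  define W where "W = mat_of_cols n ws"
  from basis_completion[OF v, folded b_def]
  have span_b: "span (set b) = carrier_vec n" and dist_b: "distinct b" 
    and indep: "\<not> lin_dep (set b)" and b: "set b \<subseteq> carrier_vec n" and hdb: "hd b = v" 
    and len_b: "length b = n" by auto
  from hdb len_b n obtain vs where bv: "b = v # vs" by (cases b, auto)
  from gram_schmidt_result[OF b dist_b indep refl, folded ws_def]
  have ws: "set ws \<subseteq> carrier_vec n" "corthogonal ws" "length ws = n" 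
    by (auto simp: len_b)
  from gram_schmidt_hd[OF v(1), of vs, folded bv] have hdws: "hd ws = v" unfolding ws_def .
  have orth_W: "corthogonal_mat W" using orthogonal_mat_of_cols ws unfolding W_def .
  have W: "W \<in> sq n" using ws unfolding W_def using mat_of_cols_carrier(1)[of n ws] by auto
  have W0: "W $$ (i, 0) = v $ i" if "i < n" for i
  proof -
    have "hd ws = ws ! 0" using n ws(3) by (cases ws) auto
    then show ?thesis using that n ws hdws by (auto simp: W_def mat_of_cols_def)
  qed
  let ?B = "mat_adjoint W * W"
  have Bc: "?B \<in> sq n" using W by auto
  have off: "?B $$ (i, j) = 0" if "i < n" "j < n" "i \<noteq> j" for i j
    using orth_W that Bc unfolding corthogonal_mat_def Let_def diagonal_mat_def
    by (simp add: carrier_matD[OF Bc] del: index_mult_mat)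
  \<comment> \<open>The columns of \<open>W\<close> are orthogonal but not yet of length one;
    \<open>g j\<close> is the squared length of column j.\<close>
  define g where "g j = (\<Sum>k<n. (cmod (W $$ (k, j)))\<^sup>2)" for j
  have Bjj: "?B $$ (j, j) = complex_of_real (g j)" if "j < n" for j
    using that W unfolding g_def of_real_sum
    by (simp add: mult_idx[of _ n] adj_idx[of _ n] complex_norm_square mult.commute del: index_mult_mat of_real_power)
  have g: "g j > 0" if "j < n" for j
  proof -
    have "?B $$ (j, j) \<noteq> 0" using orth_W that W unfolding corthogonal_mat_def Let_def by auto
    then have "g j \<noteq> 0" using Bjj[OF that] by auto
    moreover have "g j \<ge> 0" unfolding g_def by (intro sum_nonneg) auto
    ultimately show ?thesis by simp
  qed
  define U where "U = W * dg n (\<lambda>j. 1 / sqrt (g j))"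
  have U: "U \<in> sq n" using W by (auto simp: U_def)
  have "mat_adjoint U * U = dg n (\<lambda>j. 1 / sqrt (g j)) * (?B * dg n (\<lambda>j. 1 / sqrt (g j)))"
    using W by (simp add: U_def adj_mult[of _ n] sq_assoc[of _ n])
  also have "\<dots> = 1\<^sub>m n"
  proof (rule sq_eqI[of _ n])
    fix i j assume ij: "i < n" "j < n"
    have "(dg n (\<lambda>j. 1 / sqrt (g j)) * (?B * dg n (\<lambda>j. 1 / sqrt (g j)))) $$ (i, j) =
      complex_of_real (1 / sqrt (g i)) * (?B $$ (i, j) * complex_of_real (1 / sqrt (g j)))"
      using ij Bc by (simp add: dg_left_idx[of _ n] dg_right_idx[of _ n] del: index_mult_mat)
    also have "\<dots> = 1\<^sub>m n $$ (i, j)"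
    proof (cases "i = j")
      case True
      have "1 / sqrt (g i) * (g i * (1 / sqrt (g i))) = 1"
        using g[OF ij(1)] by (simp add: field_simps)
      then have "complex_of_real (1 / sqrt (g i)) * (complex_of_real (g i) * complex_of_real (1 / sqrt (g i))) = 1"
        by (metis of_real_1 of_real_mult)
      then show ?thesis using True ij Bjj by simp
    qed (use ij off in auto)
    finally show "(dg n (\<lambda>j. 1 / sqrt (g j)) * (?B * dg n (\<lambda>j. 1 / sqrt (g j)))) $$ (i, j) = 1\<^sub>m n $$ (i, j)" .
  qed (use Bc in auto)
  finally have "unitary_mat n U" using U by (intro unitaryI)
  moreover have "1 / sqrt (g 0) > 0" using g n by simp
  moreover have "U $$ (i, 0) = complex_of_real (1 / sqrt (g 0)) * v $ i" if "i < n" for i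
    using that n W W0 by (simp add: U_def dg_right_idx[of _ n] del: index_mult_mat)
  ultimately show ?thesis by (rule that)
qed

text \<open>The direct sum of the 1 by 1 identity and \<open>V\<close>; it lifts a diagonalisation
  of the lower right block to the full size.\<close>

definition bord :: "nat \<Rightarrow> complex mat \<Rightarrow> complex mat" where
  "bord n V = mat (Suc n) (Suc n) (\<lambda>(i, j). if i = 0 then (if j = 0 then 1 else 0)
     else if j = 0 then 0 else V $$ (i - 1, j - 1))"

lemma bord_carrier [simp]: "bord n V \<in> sq (Suc n)" by (simp add: bord_def)

lemma bord_idx [simp]:
  "j < Suc n \<Longrightarrow> bord n V $$ (0, j) = (if j = 0 then 1 else 0)"
  "i < n \<Longrightarrow> bord n V $$ (Suc i, 0) = 0"
  "i < n \<Longrightarrow> j < n \<Longrightarrow> bord n V $$ (Suc i, Suc j) = V $$ (i, j)"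
  by (auto simp: bord_def)

lemma bord_unitary: 
  assumes "unitary_mat n V" shows "unitary_mat (Suc n) (bord n V)"
proof (rule unitaryI)
  note c = unitaryD[OF assms]
  show "mat_adjoint (bord n V) * bord n V = 1\<^sub>m (Suc n)"
  proof (rule sq_eqI[of _ "Suc n"])
    fix i j assume ij: "i < Suc n" "j < Suc n"
    have *: "(\<Sum>k<n. cnj (V $$ (k, i')) * V $$ (k, j')) = (if i' = j' then 1 else 0)" if "i' < n" "j' < n" for i' j'
    proof -
      have "(mat_adjoint V * V) $$ (i', j') = (\<Sum>k<n. cnj (V $$ (k, i')) * V $$ (k, j'))"
        using c(1) that by (simp add: mult_idx[of _ n] adj_idx del: index_mult_mat)
      then show ?thesis using c that by simp
    qed
    show "(mat_adjoint (bord n V) * bord n V) $$ (i, j) = 1\<^sub>m (Suc n) $$ (i, j)"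
      using ij by (cases i; cases j) (auto simp: mult_idx[of _ "Suc n"] adj_idx[of _ "Suc n"] sum.lessThan_Suc_shift * simp del: index_mult_mat sum.lessThan_Suc)
  qed auto
qed simp

text \<open>In a unitary basis that begins with an eigenvector, the first column vanishes below the
  corner. Since the matrix is Hermitian, the first row is cleared as well, and a smaller Hermitian
  block splits off.\<close>

lemma spectral_theorem:
  assumes "hermitian_mat n A"
  shows "\<exists>U d. unitary_mat n U \<and> A = ud n U d"
  using assms
proof (induction n arbitrary: A)
  case 0
  have "A = ud 0 (1\<^sub>m 0) (\<lambda>_. 0)" using hermD[OF 0] by (intro sq_eqI[of _ 0]) auto
  then show ?case using unitary_one by blast
next
  case (Suc n)
  let ?m = "Suc n"
  have A: "A \<in> sq ?m" using hermD[OF Suc.prems] by auto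
  from spectrum_non_empty[OF A] obtain e where "eigenvalue A e"
    by (auto simp: spectrum_def)
  then obtain v where v: "v \<in> carrier_vec ?m" "v \<noteq> 0\<^sub>v ?m" "A *\<^sub>v v = e \<cdot>\<^sub>v v"
    using A unfolding eigenvalue_def eigenvector_def by auto
  obtain U c where U: "unitary_mat ?m U" and c: "c > (0::real)" 
    and U0: "\<And>i. i < ?m \<Longrightarrow> U $$ (i, 0) = c * v $ i"
    using unitary_with_first_col[OF v(1,2)] by metis
  note uc = unitaryD[OF U]
  define B where "B = mat_adjoint U * A * U"
  have B: "hermitian_mat ?m B"
    using herm_conj[OF Suc.prems, of "mat_adjoint U"] uc by (simp add: B_def)
  note Bc = hermD(1)[OF B]
  have AU: "(A * U) $$ (i, 0) = e * U $$ (i, 0)" if "i < ?m" for i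
  proof -
    have "(A * U) $$ (i, 0) = c * (\<Sum>k<?m. A $$ (i, k) * v $ k)"
      using A uc(1) that U0
      by (simp add: mult_idx[of _ ?m] sum_distrib_left algebra_simps del: index_mult_mat sum.lessThan_Suc)
    also have "(\<Sum>k<?m. A $$ (i, k) * v $ k) = (A *\<^sub>v v) $ i"
      using A that v(1) by (auto simp: scalar_prod_def lessThan_atLeast0 simp del: sum.lessThan_Suc)
    also have "\<dots> = e * v $ i" using v that by simp
    finally show ?thesis using U0[OF that] by simp
  qed
  have Bi0: "B $$ (i, 0) = (if i = 0 then e else 0)" if i: "i < ?m" for i
  proof -
    have "B $$ (i, 0) = (\<Sum>k<?m. mat_adjoint U $$ (i, k) * (A * U) $$ (k, 0))"
      using A uc(1) i by (simp add: B_def sq_assoc[of _ ?m] mult_idx[of _ ?m] del: index_mult_mat sum.lessThan_Suc)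
    also have "\<dots> = e * (\<Sum>k<?m. mat_adjoint U $$ (i, k) * U $$ (k, 0))"
      by (simp add: AU sum_distrib_left algebra_simps del: index_mult_mat sum.lessThan_Suc)
    also have "(\<Sum>k<?m. mat_adjoint U $$ (i, k) * U $$ (k, 0)) = (mat_adjoint U * U) $$ (i, 0)"
      using uc(1) i by (simp add: mult_idx[of _ ?m] del: index_mult_mat sum.lessThan_Suc)
    finally show ?thesis using uc i by simp
  qed
  have B0i: "B $$ (0, i) = (if i = 0 then cnj e else 0)" if i: "i < ?m" for i
    using herm_idx[OF B, of i 0] Bi0[OF i] i by auto
  \<comment> \<open>The corner entry belongs to both the first column and the first row, so the
    eigenvalue is real.\<close>
  have e: "cnj e = e" using Bi0[of 0] B0i[of 0] by simp
  then have e: "complex_of_real (Re e) = e" by (simp add: complex_eq_iff)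
  define B3 where "B3 = mat n n (\<lambda>(i, j). B $$ (Suc i, Suc j))"
  have "hermitian_mat n B3"
    unfolding hermitian_mat_def
  proof
    show B3: "B3 \<in> sq n" by (simp add: B3_def)
    have "mat_adjoint B3 $$ (i, j) = B3 $$ (i, j)" if "i < n" "j < n" for i j
      using that by (simp add: adj_idx[OF B3]) (simp add: B3_def herm_idx[OF B])
    then show "mat_adjoint B3 = B3" using B3
      by (intro sq_eqI[of _ n]) auto
  qed
  from Suc.IH[OF this] obtain V d where V: "unitary_mat n V" and B3: "B3 = ud n V d" by blast
  define d' where "d' i = (if i = 0 then Re e else d (i - 1))" for i
  have Bb: "B = ud ?m (bord n V) d'"
  proof (rule sq_eqI[of _ ?m])
    fix i j assume ij: "i < ?m" "j < ?m"
    have *: "B $$ (Suc i', Suc j') = (\<Sum>k<n. complex_of_real (d k) * V $$ (i', k) * cnj (V $$ (j', k)))"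
      if "i' < n" "j' < n" for i' j'
      using that ud_idx[OF unitaryD(1)[OF V], of i' j' d] by (simp add: B3_def flip: B3)
    show "B $$ (i, j) = ud ?m (bord n V) d' $$ (i, j)"
      using ij by (cases i; cases j)
       (auto simp: ud_idx[of _ ?m] Bi0 B0i d'_def e * sum.lessThan_Suc_shift simp del: sum.lessThan_Suc)
  qed (use Bc in auto)
  have "A = (U * mat_adjoint U) * A * (U * mat_adjoint U)" using uc A by simp
  also have "\<dots> = U * B * mat_adjoint U" using A uc(1) by (simp add: B_def sq_assoc[of _ ?m])
  also have "\<dots> = ud ?m (U * bord n V) d'" using uc Bb by (simp add: ud_left)
  finally show ?case using unitary_mult[OF U bord_unitary[OF V]] by blast
qed

subsection \<open>Functional calculus\<close>

text \<open>Entrywise, \<open>W * dg d = dg e * W\<close> says that \<open>W\<close> only links equal eigenvalues; so any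
  function of the eigenvalues is intertwined as well.\<close>

lemma dg_intertwine:
  assumes W: "W \<in> sq n" and eq: "W * dg n d = dg n e * W"
  shows "W * dg n (f \<circ> d) = dg n (f \<circ> e) * W"
proof (rule sq_eqI[of _ n])
  fix i j assume ij: "i < n" "j < n"
  have "(W * dg n d) $$ (i, j) = (dg n e * W) $$ (i, j)" using eq by simp
  then have "W $$ (i, j) * complex_of_real (d j) = complex_of_real (e i) * W $$ (i, j)"
    using ij W by (simp add: dg_left_idx dg_right_idx del: index_mult_mat)
  then have "W $$ (i, j) = 0 \<or> d j = e i" by (auto simp: mult.commute)
  then show "(W * dg n (f \<circ> d)) $$ (i, j) = (dg n (f \<circ> e) * W) $$ (i, j)"
    using ij W by (auto simp add: dg_left_idx dg_right_idx simp del: index_mult_mat)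
qed (use W in auto)

text \<open>Written in the two eigenbases, \<open>X\<close> becomes
  \<open>mat_adjoint V * X * U\<close>, which intertwines the diagonal matrices, so
  \<open>dg_intertwine\<close> applies.\<close>

lemma ud_intertwine:
  assumes U: "unitary_mat n U" and V: "unitary_mat n V" and X: "X \<in> sq n"
    and eq: "X * ud n U d = ud n V e * X"
  shows "X * ud n U (f \<circ> d) = ud n V (f \<circ> e) * X"
proof -
  note u = unitaryD[OF U] and v = unitaryD[OF V]
  define W where "W = mat_adjoint V * X * U"
  have W: "W \<in> sq n" using u v X by (auto simp: W_def)
  have *: "V * W * mat_adjoint U = X"
  proof -
    have "V * W * mat_adjoint U = (V * mat_adjoint V) * X * (U * mat_adjoint U)"
      using u(1) v(1) X by (simp add: W_def sq_assoc[of _ n])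
    then show ?thesis using u v X by simp
  qed
  have l: "X * ud n U c = V * (W * dg n c) * mat_adjoint U" for c
  proof -
    have "X * ud n U c = (V * W * mat_adjoint U) * (U * dg n c * mat_adjoint U)"
      by (simp only: * ud_def)
    also have "\<dots> = V * W * (mat_adjoint U * U) * dg n c * mat_adjoint U"
      using u(1) v(1) W by (simp add: sq_assoc[of _ n])
    also have "\<dots> = V * (W * dg n c) * mat_adjoint U"
      using u v W by (simp add: sq_assoc[of V n W])
    finally show ?thesis .
  qed
  have r: "ud n V c * X = V * (dg n c * W) * mat_adjoint U" for c
  proof -
    have "ud n V c * X = (V * dg n c * mat_adjoint V) * (V * W * mat_adjoint U)"
      by (simp only: * ud_def)
    also have "\<dots> = V * dg n c * (mat_adjoint V * V) * W * mat_adjoint U"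
      using u(1) v(1) W by (simp add: sq_assoc[of _ n])
    also have "\<dots> = V * (dg n c * W) * mat_adjoint U"
      using u v W by (simp add: sq_assoc[of V n "dg n c"])
    finally show ?thesis .
  qed
  have cancel: "mat_adjoint V * (V * Z * mat_adjoint U) * U = Z" if "Z \<in> sq n" for Z
  proof -
    have "mat_adjoint V * (V * Z * mat_adjoint U) * U = (mat_adjoint V * V) * Z * (mat_adjoint U * U)"
      using u(1) v(1) that by (simp add: sq_assoc[of _ n])
    then show ?thesis using u v that by simp
  qed
  have "V * (W * dg n d) * mat_adjoint U = V * (dg n e * W) * mat_adjoint U" using eq l[of d] r[of e] by metis
  then have "W * dg n d = dg n e * W" using cancel[of "W * dg n d"] cancel[of "dg n e * W"] W
    by (metis dg_carrier sq_mult)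
  then have "W * dg n (f \<circ> d) = dg n (f \<circ> e) * W" by (rule dg_intertwine[OF W])
  then show ?thesis using l[of "f \<circ> d"] r[of "f \<circ> e"] by metis
qed

text \<open>The case \<open>X = 1\<close>. It makes the \<open>THE\<close> in \<open>mat_fun\<close>
  well defined: the value does not depend on the diagonalisation.\<close>

lemma ud_unique:
  assumes U: "unitary_mat n U" and V: "unitary_mat n V" and eq: "ud n U d = ud n V e"
  shows "ud n U (f \<circ> d) = ud n V (f \<circ> e)"
  using ud_intertwine[OF U V, of "1\<^sub>m n" d e f] unitaryD[OF U] unitaryD[OF V] eq
  by (simp add: ud_carrier)

lemma mat_fun_ud:
  assumes U: "unitary_mat n U"
  shows "mat_fun f (ud n U d) = ud n U (f \<circ> d)"
proof -
  have dim: "dim_row (ud n U d) = n" using unitaryD(1)[OF U] by (simp add: carrier_matD(1)[of _ n n])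
  have eq: "V * mat_diag n (\<lambda>i. complex_of_real (g i)) * mat_adjoint V = ud n V g" for V g
    by (simp add: ud_def dg_def)
  show ?thesis
    unfolding mat_fun_def dim eq
  proof (rule the_equality)
    show "\<exists>Ua da. unitary_mat n Ua \<and> ud n U d = ud n Ua da \<and> ud n U (f \<circ> d) = ud n Ua (\<lambda>i. f (da i))"
      using U unfolding comp_def by blast
    fix B assume "\<exists>Ua da. unitary_mat n Ua \<and> ud n U d = ud n Ua da \<and> B = ud n Ua (\<lambda>i. f (da i))"
    then obtain V e where "unitary_mat n V" "ud n U d = ud n V e" "B = ud n V (f \<circ> e)"
      unfolding comp_def by blast
    then show "B = ud n U (f \<circ> d)" using ud_unique[OF U, of V d e f] by simp
  qed
qed

lemma mat_fun_intertwine: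
  assumes A: "hermitian_mat n A" and B: "hermitian_mat n B" and X: "X \<in> sq n" and eq: "X * A = B * X"
  shows "X * mat_fun f A = mat_fun f B * X"
proof -
  from spectral_theorem[OF A] spectral_theorem[OF B] obtain U d V e
    where "unitary_mat n U" "A = ud n U d" "unitary_mat n V" "B = ud n V e" by blast
  then show ?thesis using ud_intertwine[of n U V X d e f, OF _ _ X] eq mat_fun_ud by metis
qed

lemma mat_fun_herm: "hermitian_mat n A \<Longrightarrow> hermitian_mat n (mat_fun f A)"
  by (metis mat_fun_ud spectral_theorem ud_hermitian unitaryD(1))

lemma mat_fun_conj:
  assumes A: "hermitian_mat n A" and V: "unitary_mat n V"
  shows "mat_fun f (V * A * mat_adjoint V) = V * mat_fun f A * mat_adjoint V"
proof -
  from spectral_theorem[OF A] obtain U d where U: "unitary_mat n U" and "A = ud n U d" by blast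
  then show ?thesis
    using ud_left[OF unitaryD(1)[OF U] unitaryD(1)[OF V]] mat_fun_ud[OF unitary_mult[OF V U]] mat_fun_ud[OF U]
    by metis
qed

subsection \<open>Quadratic forms and positive matrices\<close>

text \<open>The argument is a function rather than a vector, so that columns of a matrix can be
  inserted directly; only its values below \<open>n\<close> count. Taking the real part keeps the
  form useful for matrices that are not Hermitian, as in \<open>loewner_heinz_mid\<close>.\<close>

definition qf :: "nat \<Rightarrow> complex mat \<Rightarrow> (nat \<Rightarrow> complex) \<Rightarrow> real" where
  "qf n A v = Re (\<Sum>i<n. \<Sum>j<n. cnj (v i) * A $$ (i, j) * v j)"

lemma qf_vec:
  assumes "A \<in> sq n" "v \<in> carrier_vec n"
  shows "Re ((A *\<^sub>v v) \<bullet>c v) = qf n A (\<lambda>i. v $ i)"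
  using assms unfolding qf_def
  by (auto simp: scalar_prod_def lessThan_atLeast0 sum_distrib_right sum_distrib_left algebra_simps
      intro!: sum.cong)

lemma qf_cong: "(\<And>i. i < n \<Longrightarrow> v i = w i) \<Longrightarrow> qf n A v = qf n A w"
  unfolding qf_def by (intro arg_cong[of _ _ Re] sum.cong) auto

lemma psd_iff: "psd_mat n A \<longleftrightarrow> hermitian_mat n A \<and> (\<forall>v. 0 \<le> qf n A v)"
proof
  assume A: "psd_mat n A"
  have "0 \<le> qf n A v" for v
  proof -
    have "qf n A v = qf n A (\<lambda>i. Matrix.vec n v $ i)" by (rule qf_cong) auto
    also have "\<dots> \<ge> 0" using A qf_vec[of A n "Matrix.vec n v"]
      unfolding psd_mat_def hermitian_mat_def by (metis vec_carrier)
    finally show ?thesis .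
  qed
  then show "hermitian_mat n A \<and> (\<forall>v. 0 \<le> qf n A v)" using A by (auto simp: psd_mat_def)
qed (auto simp: psd_mat_def hermitian_mat_def qf_vec)

lemma qf_add: "A \<in> sq n \<Longrightarrow> B \<in> sq n \<Longrightarrow> qf n (A + B) v = qf n A v + qf n B v"
  by (simp add: qf_def algebra_simps sum.distrib)

lemma qf_minus: "A \<in> sq n \<Longrightarrow> B \<in> sq n \<Longrightarrow> qf n (A - B) v = qf n A v - qf n B v"
  by (simp add: qf_def algebra_simps sum_subtractf)

lemma qf_smult: "A \<in> sq n \<Longrightarrow> qf n (complex_of_real c \<cdot>\<^sub>m A) v = c * qf n A v"
proof -
  assume "A \<in> sq n"
  then have "(\<Sum>i<n. \<Sum>j<n. cnj (v i) * (complex_of_real c \<cdot>\<^sub>m A) $$ (i, j) * v j)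
     = complex_of_real c * (\<Sum>i<n. \<Sum>j<n. cnj (v i) * A $$ (i, j) * v j)"
    by (simp add: sum_distrib_left algebra_simps)
  then show ?thesis by (simp add: qf_def)
qed

lemma sum_swap3: "(\<Sum>i\<in>A. \<Sum>j\<in>B. \<Sum>k\<in>C. f i j k) = (\<Sum>k\<in>C. \<Sum>i\<in>A. \<Sum>j\<in>B. f i j k)"
proof -
  have "(\<Sum>i\<in>A. \<Sum>j\<in>B. \<Sum>k\<in>C. f i j k) = (\<Sum>i\<in>A. \<Sum>k\<in>C. \<Sum>j\<in>B. f i j k)"
    by (rule sum.cong[OF refl], rule sum.swap)
  also have "\<dots> = (\<Sum>k\<in>C. \<Sum>i\<in>A. \<Sum>j\<in>B. f i j k)" by (rule sum.swap)
  finally show ?thesis .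
qed

lemma qf_ud:
  assumes U: "U \<in> sq n"
  shows "qf n (ud n U d) v = (\<Sum>k<n. d k * (cmod (\<Sum>i<n. cnj (U $$ (i, k)) * v i))\<^sup>2)"
proof -
  let ?s = "\<lambda>k. \<Sum>i<n. cnj (U $$ (i, k)) * v i"
  have "(\<Sum>i<n. \<Sum>j<n. cnj (v i) * ud n U d $$ (i, j) * v j) =
     (\<Sum>i<n. \<Sum>j<n. \<Sum>k<n. complex_of_real (d k) * (cnj (v i) * U $$ (i, k) * (cnj (U $$ (j, k)) * v j)))"
    using U by (simp add: ud_idx sum_distrib_left sum_distrib_right algebra_simps)
  also have "\<dots> = (\<Sum>k<n. \<Sum>i<n. \<Sum>j<n. complex_of_real (d k) * (cnj (v i) * U $$ (i, k) * (cnj (U $$ (j, k)) * v j)))"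
    by (rule sum_swap3)
  also have "\<dots> = (\<Sum>k<n. complex_of_real (d k) * (cnj (?s k) * ?s k))"
    by (simp add: sum_distrib_left sum_distrib_right algebra_simps)
  also have "\<dots> = complex_of_real (\<Sum>k<n. d k * (cmod (?s k))\<^sup>2)"
    by (simp add: complex_norm_square mult.commute del: of_real_power)
  finally show ?thesis unfolding qf_def by simp
qed

lemma qf_conj:
  assumes "A \<in> sq n" "X \<in> sq n"
  shows "qf n (mat_adjoint X * A * X) v = qf n A (\<lambda>i. \<Sum>j<n. X $$ (i, j) * v j)"
proof -
  have "(\<Sum>i<n. \<Sum>j<n. cnj (v i) * (mat_adjoint X * A * X) $$ (i, j) * v j) =
     (\<Sum>i<n. \<Sum>j<n. \<Sum>l<n. \<Sum>k<n. cnj (X $$ (k, i) * v i) * A $$ (k, l) * (X $$ (l, j) * v j))"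
    using assms by (simp add: mult_idx[of _ n] adj_idx[of _ n] sum_distrib_left sum_distrib_right
      algebra_simps del: index_mult_mat)
  also have "\<dots> = (\<Sum>k<n. \<Sum>l<n. \<Sum>i<n. \<Sum>j<n. cnj (X $$ (k, i) * v i) * A $$ (k, l) * (X $$ (l, j) * v j))"
  proof -
    have "(\<Sum>i<n. \<Sum>j<n. \<Sum>l<n. \<Sum>k<n. F i j k l) = (\<Sum>k<n. \<Sum>l<n. \<Sum>i<n. \<Sum>j<n. F i j k l)" 
      for F :: "nat \<Rightarrow> nat \<Rightarrow> nat \<Rightarrow> nat \<Rightarrow> complex"
    proof -
      have "(\<Sum>i<n. \<Sum>j<n. \<Sum>l<n. \<Sum>k<n. F i j k l) = (\<Sum>l<n. \<Sum>i<n. \<Sum>j<n. \<Sum>k<n. F i j k l)"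
        by (rule sum_swap3)
      also have "\<dots> = (\<Sum>l<n. \<Sum>k<n. \<Sum>i<n. \<Sum>j<n. F i j k l)"
        by (intro sum.cong[OF refl] sum_swap3)
      also have "\<dots> = (\<Sum>k<n. \<Sum>l<n. \<Sum>i<n. \<Sum>j<n. F i j k l)" by (rule sum.swap)
      finally show ?thesis .
    qed
    then show ?thesis .
  qed
  also have "\<dots> = (\<Sum>k<n. \<Sum>l<n. cnj (\<Sum>j<n. X $$ (k, j) * v j) * A $$ (k, l) * (\<Sum>j<n. X $$ (l, j) * v j))"
    by (simp add: sum_distrib_left sum_distrib_right algebra_simps)
  finally show ?thesis unfolding qf_def by simp
qed

lemma psd_herm: "psd_mat n A \<Longrightarrow> hermitian_mat n A"
  by (simp add: psd_iff)

lemma psd_sq [simp]: "psd_mat n A \<Longrightarrow> A \<in> sq n"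
  using hermD(1) psd_herm by blast

lemma psd_ud: "U \<in> sq n \<Longrightarrow> (\<And>i. i < n \<Longrightarrow> 0 \<le> d i) \<Longrightarrow> psd_mat n (ud n U d)"
  by (auto simp: psd_iff qf_ud intro!: sum_nonneg)

lemma unitary_col:
  assumes U: "unitary_mat n U" and i: "i < n" "k < n"
  shows "(\<Sum>l<n. cnj (U $$ (l, k)) * U $$ (l, i)) = (if k = i then 1 else 0)"
proof -
  note u = unitaryD[OF U]
  have "(mat_adjoint U * U) $$ (k, i) = (\<Sum>l<n. cnj (U $$ (l, k)) * U $$ (l, i))"
    using u(1) i by (simp add: mult_idx[of _ n] adj_idx[of _ n] del: index_mult_mat)
  then show ?thesis using u i by auto
qed

lemma qf_ud_col:
  assumes U: "unitary_mat n U" and i: "i < n"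
  shows "qf n (ud n U d) (\<lambda>l. U $$ (l, i)) = d i"
proof -
  have "qf n (ud n U d) (\<lambda>l. U $$ (l, i)) = (\<Sum>k<n. if k = i then d i else 0)"
    unfolding qf_ud[OF unitaryD(1)[OF U]] by (rule sum.cong) (auto simp: unitary_col[OF U i])
  then show ?thesis using i by simp
qed

lemma psd_spectral:
  assumes "psd_mat n A"
  obtains U d where "unitary_mat n U" "\<And>i. 0 \<le> d i" "A = ud n U d"
proof -
  from spectral_theorem[OF psd_herm[OF assms]] obtain U d where U: "unitary_mat n U" and A: "A = ud n U d" by blast
  have "d i \<ge> 0" if "i < n" for i
    using qf_ud_col[OF U that, of d] assms A by (metis psd_iff)
  \<comment> \<open>From index \<open>n\<close> on, \<open>d\<close> is unconstrained. Its positive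
    part gives the same matrix and is nonnegative at every index.\<close>
  then have "A = ud n U (\<lambda>i. max 0 (d i))" unfolding A by (intro ud_cong) auto
  then show ?thesis using that[OF U, of "\<lambda>i. max 0 (d i)"] by auto
qed

lemma psd_conj: 
  assumes A: "psd_mat n A" and X: "X \<in> sq n"
  shows "psd_mat n (X * A * mat_adjoint X)"
proof -
  have "qf n (X * A * mat_adjoint X) v \<ge> 0" for v
    using qf_conj[of A n "mat_adjoint X" v] A X by (auto simp: psd_iff hermitian_mat_def adj_adj[of _ n])
  then show ?thesis using herm_conj[OF psd_herm[OF A] X] by (simp add: psd_iff)
qed

lemma herm_add: "hermitian_mat n A \<Longrightarrow> hermitian_mat n B \<Longrightarrow> hermitian_mat n (A + B)"
  unfolding hermitian_mat_def
proof safe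
  assume *: "A \<in> sq n" "B \<in> sq n" "mat_adjoint A = A" "mat_adjoint B = B"
  have "cnj (A $$ (j, i)) = A $$ (i, j)" "cnj (B $$ (j, i)) = B $$ (i, j)" if "i < n" "j < n" for i j
    using that adj_idx[of A n i j] adj_idx[of B n i j] * by auto
  then show "mat_adjoint (A + B) = A + B"
    using * by (intro sq_eqI[of _ n]) (auto simp: adj_idx[of _ n])
qed auto

lemma herm_smult: "hermitian_mat n A \<Longrightarrow> hermitian_mat n (complex_of_real c \<cdot>\<^sub>m A)"
  unfolding hermitian_mat_def
proof safe
  assume *: "A \<in> sq n" "mat_adjoint A = A"
  have "cnj (A $$ (j, i)) = A $$ (i, j)" if "i < n" "j < n" for i j
    using that adj_idx[of A n i j] * by auto
  then show "mat_adjoint (complex_of_real c \<cdot>\<^sub>m A) = complex_of_real c \<cdot>\<^sub>m A"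
    using * by (intro sq_eqI[of _ n]) (auto simp: adj_idx[of _ n])
qed auto

lemma sq_diff_eq: "A \<in> sq n \<Longrightarrow> B \<in> sq n \<Longrightarrow> A - B = A + complex_of_real (-1) \<cdot>\<^sub>m B"
  by (rule sq_eqI[of _ n]) auto

lemma herm_minus: "hermitian_mat n A \<Longrightarrow> hermitian_mat n B \<Longrightarrow> hermitian_mat n (A - B)"
  using herm_add[OF _ herm_smult[of n B "-1"], of A] sq_diff_eq[of A n B] hermD by metis

lemma psd_add: "psd_mat n A \<Longrightarrow> psd_mat n B \<Longrightarrow> psd_mat n (A + B)"
  using psd_iff qf_add psd_sq herm_add by (metis add_nonneg_nonneg)

lemma psd_smult: "psd_mat n A \<Longrightarrow> 0 \<le> c \<Longrightarrow> psd_mat n (complex_of_real c \<cdot>\<^sub>m A)"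
  using psd_iff qf_smult psd_sq herm_smult by (metis mult_nonneg_nonneg)

lemma loewner_iff:
  "hermitian_mat n A \<Longrightarrow> hermitian_mat n B \<Longrightarrow> A \<preceq>\<^sub>L B \<longleftrightarrow> (\<forall>v. qf n A v \<le> qf n B v)"
  unfolding loewner_le_def
  using herm_minus[of n B A] hermD(1)[of n B] hermD(1)[of n A]
  by (auto simp: psd_iff qf_minus carrier_matD(1)[of _ n n])

text \<open>Null vectors of the form lie in the kernel: in the eigenbasis the form is a sum of
  nonnegative terms, so each of them vanishes, and with them the coordinates of
  \<open>A v\<close>.\<close>

lemma sq_zero_col:
  assumes A: "psd_mat n A" and z: "qf n A v = 0" and i: "i < n"
  shows "(\<Sum>j<n. A $$ (i, j) * v j) = 0"
proof -
  obtain U d where U: "unitary_mat n U" and d: "\<And>i. 0 \<le> d i" and Ae: "A = ud n U d"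
    using psd_spectral[OF A] by blast
  let ?s = "\<lambda>k. \<Sum>i<n. cnj (U $$ (i, k)) * v i"
  have "(\<Sum>k<n. d k * (cmod (?s k))\<^sup>2) = 0" using z Ae qf_ud[OF unitaryD(1)[OF U]] by simp
  then have "\<forall>k\<in>{..<n}. d k * (cmod (?s k))\<^sup>2 = 0"
    by (subst (asm) sum_nonneg_eq_0_iff) (auto simp: d)
  then have *: "complex_of_real (d k) * ?s k = 0" if "k < n" for k using that by auto
  have "(\<Sum>j<n. A $$ (i, j) * v j) = (\<Sum>j<n. \<Sum>k<n. U $$ (i, k) * (complex_of_real (d k) * (cnj (U $$ (j, k)) * v j)))"
    using unitaryD(1)[OF U] i by (simp add: Ae ud_idx[of _ n] sum_distrib_left sum_distrib_right algebra_simps)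
  also have "\<dots> = (\<Sum>k<n. \<Sum>j<n. U $$ (i, k) * (complex_of_real (d k) * (cnj (U $$ (j, k)) * v j)))"
    by (rule sum.swap)
  also have "\<dots> = (\<Sum>k<n. U $$ (i, k) * (complex_of_real (d k) * ?s k))"
    by (simp only: sum_distrib_left)
  also have "\<dots> = 0" by (rule sum.neutral) (use * in auto)
  finally show ?thesis .
qed

subsection \<open>Trace\<close>

lemma trace_comm:
  assumes "A \<in> sq n" "B \<in> sq n" shows "mat_trace (A * B) = mat_trace (B * A)"
proof -
  have "mat_trace (A * B) = (\<Sum>i<n. \<Sum>k<n. A $$ (i, k) * B $$ (k, i))"
    using assms by (simp add: mat_trace_def mult_idx[of _ n] del: index_mult_mat(1))
  also have "\<dots> = (\<Sum>k<n. \<Sum>i<n. A $$ (i, k) * B $$ (k, i))" by (rule sum.swap)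
  also have "\<dots> = mat_trace (B * A)"
    using assms by (simp add: mat_trace_def mult_idx[of _ n] mult.commute del: index_mult_mat(1))
  finally show ?thesis .
qed

abbreviation tr :: "complex mat \<Rightarrow> real" where "tr A \<equiv> Re (mat_trace A)"

lemma tr_idx: "A \<in> sq n \<Longrightarrow> tr A = (\<Sum>i<n. Re (A $$ (i, i)))"
  by (simp add: mat_trace_def carrier_matD(1)[of _ n n])

lemma trace_conj:
  assumes "unitary_mat n U" "A \<in> sq n"
  shows "mat_trace (U * A * mat_adjoint U) = mat_trace A"
proof -
  note u = unitaryD[OF assms(1)]
  have "mat_trace (U * A * mat_adjoint U) = mat_trace (mat_adjoint U * (U * A))"
    using u assms by (intro trace_comm) auto
  also have "mat_adjoint U * (U * A) = (mat_adjoint U * U) * A" using u(1) assms(2) by (simp add: sq_assoc[of _ n])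
  also have "\<dots> = A" using u assms by simp
  finally show ?thesis .
qed

lemma trace_ud: "unitary_mat n U \<Longrightarrow> mat_trace (ud n U d) = complex_of_real (\<Sum>i<n. d i)"
  unfolding ud_def by (simp add: trace_conj) (simp add: mat_trace_def dg_idx carrier_matD(1)[OF dg_carrier])

lemma tr_ud: "unitary_mat n U \<Longrightarrow> tr (ud n U d) = (\<Sum>i<n. d i)"
  by (simp add: trace_ud)

lemma tr_psd_nonneg: "psd_mat n A \<Longrightarrow> 0 \<le> tr A"
  by (erule psd_spectral) (auto simp: tr_ud intro!: sum_nonneg)

lemma trace_herm: 
  assumes "hermitian_mat n A" shows "mat_trace A = complex_of_real (tr A)"
proof -
  from spectral_theorem[OF assms] obtain U d where "unitary_mat n U" "A = ud n U d" by blast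
  then show ?thesis by (simp add: trace_ud)
qed

subsection \<open>Trace functionals of convex functions\<close>

text \<open>The squared moduli form a doubly stochastic matrix: they are weights for Jensen's
  inequality in one index and disappear on summation over the other.\<close>

lemma unitary_stoch:
  assumes W: "unitary_mat n W" and i: "i < n"
  shows "(\<Sum>k<n. (cmod (W $$ (k, i)))\<^sup>2) = 1" "(\<Sum>k<n. (cmod (W $$ (i, k)))\<^sup>2) = 1"
proof -
  have *: "(\<Sum>k<n. (cmod (W $$ (k, i)))\<^sup>2) = 1" if W: "unitary_mat n W" for W
  proof -
    have "complex_of_real (\<Sum>k<n. (cmod (W $$ (k, i)))\<^sup>2) = (\<Sum>l<n. cnj (W $$ (l, i)) * W $$ (l, i))"
      by (simp add: complex_norm_square mult.commute del: of_real_power)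
    also have "\<dots> = 1" using unitary_col[OF W i i] by simp
    finally show ?thesis using of_real_eq_1_iff by blast
  qed
  then show "(\<Sum>k<n. (cmod (W $$ (k, i)))\<^sup>2) = 1" using W .
  have "(\<Sum>k<n. (cmod (W $$ (i, k)))\<^sup>2) = (\<Sum>k<n. (cmod (mat_adjoint W $$ (k, i)))\<^sup>2)"
    using unitaryD(1)[OF W] i by (simp add: adj_idx[of _ n])
  then show "(\<Sum>k<n. (cmod (W $$ (i, k)))\<^sup>2) = 1" using *[OF unitary_adj[OF W]] by simp
qed

lemma qf_ud_unitary:
  assumes U: "unitary_mat n U" and V: "unitary_mat n V" and i: "i < n"
  shows "qf n (ud n V b) (\<lambda>l. U $$ (l, i)) = (\<Sum>k<n. (cmod ((mat_adjoint V * U) $$ (k, i)))\<^sup>2 * b k)"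
  using unitaryD(1)[OF U] unitaryD(1)[OF V] i
  by (simp add: qf_ud mult_idx[of _ n] adj_idx[of _ n] mult.commute del: index_mult_mat)

text \<open>Peierls' inequality: the columns of \<open>U\<close> are an orthonormal basis.\<close>

lemma peierls:
  assumes U: "unitary_mat n U" and V: "unitary_mat n V" and f: "convex_on S f"
    and b: "\<And>k. k < n \<Longrightarrow> b k \<in> S"
  shows "(\<Sum>i<n. f (qf n (ud n V b) (\<lambda>l. U $$ (l, i)))) \<le> (\<Sum>k<n. f (b k))"
proof -
  let ?p = "\<lambda>k i. (cmod ((mat_adjoint V * U) $$ (k, i)))\<^sup>2"
  note st = unitary_stoch[OF unitary_mult[OF unitary_adj[OF V] U]]
  have "(\<Sum>i<n. f (qf n (ud n V b) (\<lambda>l. U $$ (l, i)))) = (\<Sum>i<n. f (\<Sum>k<n. ?p k i *\<^sub>R b k))"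
    using qf_ud_unitary[OF U V] by (intro sum.cong) auto
  also have "\<dots> \<le> (\<Sum>i<n. \<Sum>k<n. ?p k i * f (b k))"
  proof (rule sum_mono)
    fix i assume i: "i \<in> {..<n}"
    then have "{..<n} \<noteq> {}" by auto
    then show "f (\<Sum>k<n. ?p k i *\<^sub>R b k) \<le> (\<Sum>k<n. ?p k i * f (b k))"
      using i st(1)[of i] b by (intro convex_on_sum[OF _ _ f]) auto
  qed
  also have "\<dots> = (\<Sum>k<n. (\<Sum>i<n. ?p k i) * f (b k))"
    by (subst sum.swap) (simp add: sum_distrib_right)
  also have "\<dots> = (\<Sum>k<n. f (b k))" using st(2) by simp
  finally show ?thesis .
qed

lemma qf_ud_in:
  assumes U: "unitary_mat n U" and V: "unitary_mat n V" and S: "convex S" 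
    and b: "\<And>k. k < n \<Longrightarrow> b k \<in> S" and i: "i < n"
  shows "qf n (ud n V b) (\<lambda>l. U $$ (l, i)) \<in> S"
proof -
  let ?p = "\<lambda>k i. (cmod ((mat_adjoint V * U) $$ (k, i)))\<^sup>2"
  have "(\<Sum>k<n. ?p k i *\<^sub>R b k) \<in> S"
    using unitary_stoch(1)[OF unitary_mult[OF unitary_adj[OF V] U] i] b S
    by (intro convex_sum) auto
  then show ?thesis using qf_ud_unitary[OF U V i] by simp
qed

text \<open>Both forms are evaluated at the eigenvectors of the smaller matrix. There monotonicity
  compares the values of \<open>f\<close> one by one, and Peierls' inequality passes on to the
  eigenvalues of the larger matrix.\<close>

lemma trace_mono_convex:
  assumes U: "unitary_mat n U" and V: "unitary_mat n V" and f: "convex_on S f" and m: "mono_on S f"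
    and a: "\<And>k. k < n \<Longrightarrow> a k \<in> S" and b: "\<And>k. k < n \<Longrightarrow> b k \<in> S"
    and le: "\<And>v. qf n (ud n U a) v \<le> qf n (ud n V b) v"
  shows "(\<Sum>k<n. f (a k)) \<le> (\<Sum>k<n. f (b k))"
proof -
  have "(\<Sum>k<n. f (a k)) \<le> (\<Sum>i<n. f (qf n (ud n V b) (\<lambda>l. U $$ (l, i))))"
  proof (rule sum_mono)
    fix i assume "i \<in> {..<n}"
    then show "f (a i) \<le> f (qf n (ud n V b) (\<lambda>l. U $$ (l, i)))"
      using le[of "\<lambda>l. U $$ (l, i)"] qf_ud_col[OF U, of i a] a qf_ud_in[OF U V convex_on_imp_convex[OF f], of b i] b
      by (intro mono_onD[OF m]) auto
  qed
  also have "\<dots> \<le> (\<Sum>k<n. f (b k))" by (rule peierls[OF U V f b])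
  finally show ?thesis .
qed

text \<open>Peierls' inequality now points the other way, so the eigenvectors of the larger matrix
  are used instead.\<close>

lemma trace_mono_concave:
  assumes U: "unitary_mat n U" and V: "unitary_mat n V" and f: "concave_on S f" and m: "mono_on S f"
    and a: "\<And>k. k < n \<Longrightarrow> a k \<in> S" and b: "\<And>k. k < n \<Longrightarrow> b k \<in> S"
    and le: "\<And>v. qf n (ud n U a) v \<le> qf n (ud n V b) v"
  shows "(\<Sum>k<n. f (a k)) \<le> (\<Sum>k<n. f (b k))"
proof -
  have S: "convex S" using f by (simp add: concave_on_iff)
  have "(\<Sum>k<n. f (a k)) \<le> (\<Sum>i<n. f (qf n (ud n U a) (\<lambda>l. V $$ (l, i))))"
    using peierls[OF V U, of S "\<lambda>x. - f x" a] f a by (simp add: concave_on_def sum_negf)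
  also have "\<dots> \<le> (\<Sum>k<n. f (b k))"
  proof (rule sum_mono)
    fix i assume "i \<in> {..<n}"
    then show "f (qf n (ud n U a) (\<lambda>l. V $$ (l, i))) \<le> f (b i)"
      using le[of "\<lambda>l. V $$ (l, i)"] qf_ud_col[OF V, of i b] b qf_ud_in[OF V U S, of a i] a
      by (intro mono_onD[OF m]) auto
  qed
  finally show ?thesis .
qed

section \<open>Convexity and concavity of powers\<close>

lemma powr_mono_on: "0 \<le> r \<Longrightarrow> mono_on {0..} (\<lambda>x::real. x powr r)"
  by (intro mono_onI powr_mono2) auto

lemma powr_convex_on:
  assumes r: "1 \<le> r" shows "convex_on {0..} (\<lambda>x::real. x powr r)"
proof (rule convex_on_linorderI)
  fix t x y :: real assume *: "0 < t" "t < 1" "x \<in> {0..}" "y \<in> {0..}" "x < y"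
  show "((1 - t) *\<^sub>R x + t *\<^sub>R y) powr r \<le> (1 - t) * x powr r + t * y powr r"
  proof (cases "x = 0")
    case True
    \<comment> \<open>With \<open>x = 0\<close> the claim is
      \<open>(t * y) powr r \<le> t * y powr r\<close>.\<close>
    have "t powr r \<le> t powr 1" using * r by (intro powr_mono') auto
    then show ?thesis using True * by (simp add: powr_mult mult_right_mono)
  next
    case False
    then show ?thesis using convex_onD[OF powr_convex[OF r], of t x y] * by auto
  qed
qed simp

lemma powr_concave_pos:
  assumes r: "0 < r" "r \<le> 1" shows "concave_on {0<..} (\<lambda>x::real. x powr r)"
  unfolding concave_on_def
proof (rule f''_ge0_imp_convex)
  show "((\<lambda>x. - (x powr r)) has_real_derivative - (r * x powr (r - 1))) (at x)" if "x \<in> {0<..}" for x :: real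
    using that by (auto intro!: derivative_eq_intros)
  show "((\<lambda>x. - (r * x powr (r - 1))) has_real_derivative - (r * ((r - 1) * x powr (r - 1 - 1)))) (at x)" if "x \<in> {0<..}" for x :: real
    using that by (auto intro!: derivative_eq_intros)
  show "0 \<le> - (r * ((r - 1) * x powr (r - 1 - 1)))" if "x \<in> {0<..}" for x :: real
    using r by (auto simp: mult_nonneg_nonpos2 mult_nonpos_nonneg mult_le_0_iff)
qed auto

lemma powr_concave_on:
  assumes r: "0 < r" "r \<le> 1" shows "concave_on {0..} (\<lambda>x::real. x powr r)"
proof (rule concave_on_linorderI)
  fix t x y :: real assume *: "0 < t" "t < 1" "x \<in> {0..}" "y \<in> {0..}" "x < y"
  show "((1 - t) *\<^sub>R x + t *\<^sub>R y) powr r \<ge> (1 - t) * x powr r + t * y powr r"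
  proof (cases "x = 0")
    case True
    have "t powr r \<ge> t powr 1" using * r by (intro powr_mono') auto
    then show ?thesis using True * r by (simp add: powr_mult mult_right_mono)
  next
    case False
    then show ?thesis using concave_onD[OF powr_concave_pos[OF r], of t x y] * by auto
  qed
qed simp

lemma trace_powr_mono:
  assumes U: "unitary_mat n U" and V: "unitary_mat n V" and r: "0 < r"
    and a: "\<And>k. 0 \<le> a k" and b: "\<And>k. 0 \<le> b k"
    and le: "\<And>v. qf n (ud n U a) v \<le> qf n (ud n V b) v"
  shows "(\<Sum>k<n. a k powr r) \<le> (\<Sum>k<n. b k powr r)"
proof (cases "1 \<le> r")
  case True
  show ?thesis
    using a b r by (intro trace_mono_convex[OF U V powr_convex_on[OF True] powr_mono_on _ _ le]) auto
next
  case False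
  show ?thesis
    using a b r False by (intro trace_mono_concave[OF U V powr_concave_on powr_mono_on _ _ le]) auto
qed

subsection \<open>Powers\<close>

lemma mat_powr_ud: "unitary_mat n U \<Longrightarrow> mat_powr (ud n U d) r = ud n U (\<lambda>i. d i powr r)"
  by (simp add: mat_powr_def mat_fun_ud comp_def)

lemma mat_powr_psd: "psd_mat n A \<Longrightarrow> psd_mat n (mat_powr A r)"
  by (erule psd_spectral) (auto simp: mat_powr_ud unitaryD(1) intro!: psd_ud)

lemma mat_powr_add: "psd_mat n A \<Longrightarrow> mat_powr A r * mat_powr A s = mat_powr A (r + s)"
  by (erule psd_spectral) (auto simp: mat_powr_ud ud_mult powr_add)

lemma mat_powr_powr: "psd_mat n A \<Longrightarrow> mat_powr (mat_powr A r) s = mat_powr A (r * s)"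
  by (erule psd_spectral) (auto simp: mat_powr_ud powr_powr)

lemma mat_powr_one: "psd_mat n A \<Longrightarrow> mat_powr A 1 = A"
  by (erule psd_spectral) (auto simp: mat_powr_ud)

lemma tr_powr_mono:
  assumes A: "psd_mat n A" and B: "psd_mat n B" and r: "0 < r" and le: "\<And>v. qf n A v \<le> qf n B v"
  shows "tr (mat_powr A r) \<le> tr (mat_powr B r)"
proof -
  obtain U a where U: "unitary_mat n U" and a: "\<And>i. 0 \<le> a i" and Ae: "A = ud n U a"
    using psd_spectral[OF A] by blast
  obtain V b where V: "unitary_mat n V" and b: "\<And>i. 0 \<le> b i" and Be: "B = ud n V b"
    using psd_spectral[OF B] by blast
  show ?thesis using trace_powr_mono[OF U V r a b] le U V by (simp add: Ae Be mat_powr_ud tr_ud)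
qed

lemma mat_powr_intertwine:
  assumes "hermitian_mat n A" "hermitian_mat n B" "X \<in> sq n" "X * A = B * X"
  shows "X * mat_powr A r = mat_powr B r * X"
  unfolding mat_powr_def by (rule mat_fun_intertwine[OF assms])

lemma psd_gram: "X \<in> sq n \<Longrightarrow> psd_mat n (X * mat_adjoint X)" "X \<in> sq n \<Longrightarrow> psd_mat n (mat_adjoint X * X)"
proof -
  have one: "psd_mat n (1\<^sub>m n)" using psd_ud[of "1\<^sub>m n" n "\<lambda>_. 1"] ud_one[of n "1\<^sub>m n"] by simp
  show X: "psd_mat n (X * mat_adjoint X)" if "X \<in> sq n" for X
    using psd_conj[OF one that] that by simp
  show "psd_mat n (mat_adjoint X * X)" if "X \<in> sq n"
    using X[of "mat_adjoint X"] that by (simp add: adj_adj[of _ n])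
qed

text \<open>\<open>X\<close> intertwines \<open>X\<^sup>* X\<close> and \<open>X X\<^sup>*\<close>, and so their powers.\<close>

lemma tr_powr_gram:
  assumes X: "X \<in> sq n"
  shows "tr (mat_powr (mat_adjoint X * X) r) = tr (mat_powr (X * mat_adjoint X) r)"
proof -
  note p = psd_gram[OF X]
  let ?A = "mat_adjoint X * X" and ?B = "X * mat_adjoint X"
  have s: "mat_powr C r = mat_powr C (r - 1) * C" if "psd_mat n C" for C
    using mat_powr_add[OF that, of "r - 1" 1] mat_powr_one[OF that] by simp
  have c: "mat_powr ?A (r - 1) \<in> sq n" "mat_powr ?B (r - 1) \<in> sq n"
    using mat_powr_psd[OF p(1)] mat_powr_psd[OF p(2)] by auto
  have "X * ?A = ?B * X" using X by (simp add: sq_assoc[of _ n])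
  from mat_powr_intertwine[OF psd_herm[OF p(2)] psd_herm[OF p(1)] X this]
  have i: "X * mat_powr ?A (r - 1) = mat_powr ?B (r - 1) * X" .
  have "mat_trace (mat_powr ?A r) = mat_trace ((mat_powr ?A (r - 1) * mat_adjoint X) * X)"
    using s[OF p(2)] X c by (simp add: sq_assoc[of _ n])
  also have "\<dots> = mat_trace (X * (mat_powr ?A (r - 1) * mat_adjoint X))"
    using X c by (intro trace_comm) auto
  also have "X * (mat_powr ?A (r - 1) * mat_adjoint X) = (X * mat_powr ?A (r - 1)) * mat_adjoint X"
    using X c by (simp add: sq_assoc[of _ n])
  also have "\<dots> = mat_powr ?B r"
    using s[OF p(1)] X c by (simp add: i sq_assoc[of _ n])
  finally show ?thesis by simp
qed

subsection \<open>Positive definite matrices\<close>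

text \<open>Positive definiteness in spectral form. As \<open>d\<close> is only read below
  \<open>n\<close>, asking for positivity at every index does not restrict the matrix (see
  \<open>pdI\<close>) and spares side conditions.\<close>

definition pd :: "nat \<Rightarrow> complex mat \<Rightarrow> bool" where
  "pd n A \<longleftrightarrow> (\<exists>U d. unitary_mat n U \<and> (\<forall>i. 0 < d i) \<and> A = ud n U d)"

lemma pdE:
  assumes "pd n A" obtains U d where "unitary_mat n U" "\<And>i. 0 < d i" "A = ud n U d"
  using assms by (auto simp: pd_def)

lemma pdI: 
  assumes "unitary_mat n U" "\<And>i. i < n \<Longrightarrow> 0 < d i" shows "pd n (ud n U d)"
proof -
  have "ud n U d = ud n U (\<lambda>i. if i < n then d i else 1)" by (rule ud_cong) auto
  then show ?thesis unfolding pd_def using assms by (intro exI[of _ U] exI[of _ "\<lambda>i. if i < n then d i else 1"]) auto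
qed

lemma pd_psd: "pd n A \<Longrightarrow> psd_mat n A"
  by (erule pdE) (auto intro!: psd_ud simp: unitaryD(1) less_imp_le)

lemma pd_sq [simp]: "pd n A \<Longrightarrow> A \<in> sq n"
  using pd_psd psd_sq by blast

lemma pd_powr: "pd n A \<Longrightarrow> pd n (mat_powr A r)"
  by (erule pdE) (auto simp: mat_powr_ud intro!: pdI, metis less_irrefl)

lemma pd_powr_zero: "pd n A \<Longrightarrow> mat_powr A 0 = 1\<^sub>m n"
  by (erule pdE) (auto simp: mat_powr_ud less_imp_neq[THEN not_sym] ud_one)

lemma pd_inverse: "pd n A \<Longrightarrow> mat_powr A r * mat_powr A (-r) = 1\<^sub>m n"
  using mat_powr_add[OF pd_psd, of n A r "-r"] pd_powr_zero[of n A] by simp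

text \<open>In the eigenbasis a diagonal entry of the identity is a multiple of \<open>a i\<close>,
  so no eigenvalue vanishes.\<close>

lemma pd_if_inverse:
  assumes A: "psd_mat n A" and Y: "Y \<in> sq n" "Y * A = 1\<^sub>m n"
  shows "pd n A"
proof -
  obtain U a where U: "unitary_mat n U" and a: "\<And>i. 0 \<le> a i" and Ae: "A = ud n U a"
    using psd_spectral[OF A] by blast
  note u = unitaryD[OF U]
  have "a i > 0" if i: "i < n" for i
  proof -
    have "mat_adjoint U * (Y * A) * U = (mat_adjoint U * Y * U * dg n a) * (mat_adjoint U * U)"
      using u(1) Y(1) by (simp add: Ae ud_def sq_assoc[of _ n])
    then have "1\<^sub>m n = mat_adjoint U * Y * U * dg n a"
      using u Y by (simp add: sq_mult)
    then have "1\<^sub>m n $$ (i, i) = (mat_adjoint U * Y * U) $$ (i, i) * complex_of_real (a i)"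
      using dg_right_idx[of "mat_adjoint U * Y * U" n i i a] u(1) Y(1) i by simp
    then have "a i \<noteq> 0" using i by auto
    then show ?thesis using a[of i] by simp
  qed
  then show ?thesis unfolding Ae using U by (intro pdI) auto
qed

lemma pd_conj:
  assumes A: "pd n A" and X: "X \<in> sq n" and Y: "Y \<in> sq n" "Y * X = 1\<^sub>m n"
  shows "pd n (X * A * mat_adjoint X)"
proof (rule pd_if_inverse)
  show "psd_mat n (X * A * mat_adjoint X)" using pd_psd[OF A] X by (rule psd_conj)
  let ?I = "mat_powr A (-1)"
  have I: "?I \<in> sq n" "?I * A = 1\<^sub>m n"
    using pd_inverse[OF A, of "-1"] mat_powr_one[OF pd_psd[OF A]] pd_powr[OF A] by auto
  have YX: "mat_adjoint Y * mat_adjoint X = 1\<^sub>m n"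
    using X Y adj_mult[of X n Y] mat_mult_left_right_inverse[of Y n X] by simp
  show "mat_adjoint Y * ?I * Y \<in> sq n" using I Y by auto
  have "mat_adjoint Y * ?I * Y * (X * A * mat_adjoint X) = mat_adjoint Y * (?I * ((Y * X) * A)) * mat_adjoint X"
    using I(1) Y(1) X A by (simp add: sq_assoc[of _ n])
  also have "\<dots> = 1\<^sub>m n" using I Y X A YX by simp
  finally show "mat_adjoint Y * ?I * Y * (X * A * mat_adjoint X) = 1\<^sub>m n" .
qed

lemma pd_conj_powr:
  assumes A: "pd n A" and B: "pd n B"
  shows "pd n (mat_powr A r * B * mat_powr A r)"
proof -
  have P: "pd n (mat_powr A r)" using pd_powr[OF A] .
  have "mat_powr A (-r) * mat_powr A r = 1\<^sub>m n" using pd_inverse[OF A, of "-r"] by simp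
  from pd_conj[OF B _ _ this] show ?thesis
    using P pd_powr[OF A, of "-r"] hermD(2)[OF psd_herm[OF pd_psd[OF P]]] by simp
qed

lemma psd_conj_powr:
  assumes A: "psd_mat n A" and B: "psd_mat n B"
  shows "psd_mat n (mat_powr A r * B * mat_powr A r)"
  using psd_conj[OF B, of "mat_powr A r"] mat_powr_psd[OF A, of r] hermD(2)[OF psd_herm] by auto

subsection \<open>Supports\<close>

lemma qf_one: "qf n (1\<^sub>m n) v = (\<Sum>i<n. (cmod (v i))\<^sup>2)"
  using qf_ud[of "1\<^sub>m n" n "\<lambda>_. 1" v] ud_one[of n "1\<^sub>m n"]
  by (simp add: if_distrib[where f = cnj] if_distrib[where f = "\<lambda>x. x * _"] cong: if_cong)

lemma qf_unitary_norm:
  assumes "unitary_mat n U"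
  shows "(\<Sum>k<n. (cmod (\<Sum>i<n. cnj (U $$ (i, k)) * v i))\<^sup>2) = (\<Sum>i<n. (cmod (v i))\<^sup>2)"
  using qf_ud[OF unitaryD(1)[OF assms], of "\<lambda>_. 1" v] ud_one[OF assms] qf_one[of n v] by simp

lemma qf_ud_le_one:
  assumes "unitary_mat n U" "\<And>i. i < n \<Longrightarrow> d i \<le> c"
  shows "qf n (ud n U d) v \<le> c * (\<Sum>i<n. (cmod (v i))\<^sup>2)"
  unfolding qf_ud[OF unitaryD(1)[OF assms(1)]] qf_unitary_norm[OF assms(1), of v, symmetric] sum_distrib_left
  by (intro sum_mono mult_right_mono) (use assms(2) in auto)

lemma supp_ud: "unitary_mat n U \<Longrightarrow> supp_proj (ud n U d) = ud n U (\<lambda>i. if d i = 0 then 0 else 1)"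
  by (simp add: supp_proj_def mat_fun_ud comp_def)

lemma supp_herm: "hermitian_mat n A \<Longrightarrow> hermitian_mat n (supp_proj A)"
  unfolding supp_proj_def by (rule mat_fun_herm)

lemma supp_psd: "psd_mat n A \<Longrightarrow> psd_mat n (supp_proj A)"
  by (erule psd_spectral) (auto simp: supp_ud unitaryD(1) intro!: psd_ud)

lemma qf_supp_zero:
  assumes "psd_mat n A" shows "qf n (supp_proj A) v = 0 \<longleftrightarrow> qf n A v = 0"
proof -
  obtain U a where U: "unitary_mat n U" and a: "\<And>i. 0 \<le> a i" and A: "A = ud n U a"
    using psd_spectral[OF assms] by blast
  show ?thesis
    unfolding A supp_ud[OF U] qf_ud[OF unitaryD(1)[OF U]] using a
    by (auto simp: sum_nonneg_eq_0_iff)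
qed

text \<open>An eigenvector of \<open>A\<close> for the eigenvalue 0 is a null vector of the form of
  \<open>B\<close> and hence lies in the kernel of \<open>B\<close>, so cutting it away changes
  nothing. The second identity is the adjoint of the first.\<close>

lemma mult_supp:
  assumes A: "psd_mat n A" and B: "psd_mat n B" and ker: "\<And>v. qf n A v = 0 \<Longrightarrow> qf n B v = 0"
  shows "B * supp_proj A = B" "supp_proj A * B = B"
proof -
  obtain U a where U: "unitary_mat n U" and a: "\<And>i. 0 \<le> a i" and Ae: "A = ud n U a"
    using psd_spectral[OF A] by blast
  note u = unitaryD[OF U]
  let ?p = "\<lambda>i. if a i = 0 then 0 else 1"
  have BU: "B * U * dg n ?p = B * U"
  proof (rule sq_eqI[of _ n])
    fix r i assume ri: "r < n" "i < n"
    show "(B * U * dg n ?p) $$ (r, i) = (B * U) $$ (r, i)"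
    proof (cases "a i = 0")
      case True
      have "qf n B (\<lambda>l. U $$ (l, i)) = 0"
        using qf_ud_col[OF U ri(2), of a] True by (intro ker) (simp add: Ae)
      then have "(B * U) $$ (r, i) = 0"
        using sq_zero_col[OF B _ ri(1)] ri B u(1) by (simp add: mult_idx[of _ n] del: index_mult_mat)
      then show ?thesis using ri B u(1) by (simp add: dg_right_idx[of _ n] del: index_mult_mat)
    next
      case False
      then show ?thesis using ri B u(1) by (simp add: dg_right_idx[of _ n] del: index_mult_mat)
    qed
  qed (use B u in auto)
  have "B * supp_proj A = B * U * dg n ?p * mat_adjoint U"
    using B u(1) unfolding Ae supp_ud[OF U] by (simp add: ud_def sq_assoc[of _ n])
  also have "\<dots> = B * U * mat_adjoint U" by (simp only: BU)
  also have "\<dots> = B" using B u by (simp add: sq_assoc[of _ n])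
  finally show *: "B * supp_proj A = B" .
  show "supp_proj A * B = B"
    using arg_cong[OF *, of mat_adjoint] adj_mult[of B n "supp_proj A"] B A supp_psd[OF A]
     hermD(2)[OF psd_herm[OF B]] hermD(2)[OF psd_herm[OF supp_psd[OF A]]] by simp
qed

text \<open>Replaces the order condition on supports by an inclusion of kernels, which is easier to
  check and to apply.\<close>

lemma supp_le_iff:
  assumes A: "psd_mat n A" and B: "psd_mat n B"
  shows "supp_proj B \<preceq>\<^sub>L supp_proj A \<longleftrightarrow> (\<forall>v. qf n A v = 0 \<longrightarrow> qf n B v = 0)"
proof -
  note sA = supp_psd[OF A] and sB = supp_psd[OF B]
  have le: "supp_proj B \<preceq>\<^sub>L supp_proj A \<longleftrightarrow> (\<forall>v. qf n (supp_proj B) v \<le> qf n (supp_proj A) v)"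
    using sA sB by (intro loewner_iff) (auto simp: psd_herm)
  show ?thesis
    unfolding le
  proof safe
    fix v assume "\<forall>v. qf n (supp_proj B) v \<le> qf n (supp_proj A) v" "qf n A v = 0"
    then have "qf n (supp_proj B) v \<le> 0" using qf_supp_zero[OF A, of v] by metis
    then have "qf n (supp_proj B) v = 0" using sB by (simp add: psd_iff order_antisym)
    then show "qf n B v = 0" using qf_supp_zero[OF B] by simp
  next
    fix v assume k: "\<forall>v. qf n A v = 0 \<longrightarrow> qf n B v = 0"
    let ?P = "supp_proj A" and ?Q = "supp_proj B"
    \<comment> \<open>The kernel inclusion gives \<open>Q = P * Q * P\<close>; since
      \<open>Q\<close> is at most the identity, it is at most \<open>P * P = P\<close>.\<close>
    have m: "?Q * ?P = ?Q" "?P * ?Q = ?Q"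
      using mult_supp[OF A sB] k qf_supp_zero[OF B] by auto
    have adj: "mat_adjoint ?P = ?P" using psd_herm[OF sA] by (rule hermD)
    have P2: "?P * ?P = ?P"
      using A by (elim psd_spectral) (simp add: supp_ud ud_mult if_distrib cong: if_cong)
    obtain V b where V: "unitary_mat n V" and "B = ud n V b"
      using psd_spectral[OF B] by blast
    then have Q: "?Q = ud n V (\<lambda>i. if b i = 0 then 0 else 1)" by (simp add: supp_ud)
    let ?w = "\<lambda>i. \<Sum>j<n. ?P $$ (i, j) * v j"
    have "qf n ?Q v = qf n (mat_adjoint ?P * ?Q * ?P) v" using m adj by simp
    also have "\<dots> = qf n ?Q ?w" using sA sB by (intro qf_conj) auto
    also have "\<dots> \<le> qf n (1\<^sub>m n) ?w"
      using qf_ud_le_one[OF V, of "\<lambda>i. if b i = 0 then 0 else 1" 1 ?w] by (auto simp: Q qf_one)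
    also have "\<dots> = qf n (mat_adjoint ?P * 1\<^sub>m n * ?P) v"
      using sA by (subst qf_conj) auto
    also have "\<dots> = qf n ?P v" using sA P2 adj by simp
    finally show "qf n ?Q v \<le> qf n ?P v" .
  qed
qed

lemma qf_pd_zero: 
  assumes A: "pd n A" and z: "qf n A v = 0" and i: "i < n" shows "v i = 0"
proof -
  obtain U d where U: "unitary_mat n U" and d: "\<And>i. 0 < d i" and Ae: "A = ud n U d" 
    using pdE[OF A] by blast
  have "\<forall>k\<in>{..<n}. d k * (cmod (\<Sum>i<n. cnj (U $$ (i, k)) * v i))\<^sup>2 = 0"
    using z d unfolding Ae qf_ud[OF unitaryD(1)[OF U]]
    by (subst (asm) sum_nonneg_eq_0_iff) (auto simp: less_imp_le)
  then have "(\<Sum>k<n. (cmod (\<Sum>i<n. cnj (U $$ (i, k)) * v i))\<^sup>2) = 0"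
    using d by (intro sum.neutral) (auto simp: less_imp_neq[THEN not_sym] less_irrefl)
  then have "(\<Sum>i<n. (cmod (v i))\<^sup>2) = 0" using qf_unitary_norm[OF U] by simp
  then show ?thesis using i by (subst (asm) sum_nonneg_eq_0_iff) auto
qed

lemma supp_le_pd: 
  assumes "pd n A" "psd_mat n B" shows "supp_proj B \<preceq>\<^sub>L supp_proj A"
proof -
  have "qf n B v = 0" if "qf n A v = 0" for v
  proof -
    have "qf n B v = qf n B (\<lambda>_. 0)" using qf_pd_zero[OF assms(1) that] by (intro qf_cong) auto
    then show ?thesis by (simp add: qf_def)
  qed
  then show ?thesis using supp_le_iff[OF pd_psd[OF assms(1)] assms(2)] by blast
qed

lemma geo_mean_pd: "pd n A \<Longrightarrow> psd_mat n B \<Longrightarrow> geo_mean \<alpha> A B = geo_mean_formula \<alpha> A B"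
  using supp_le_pd by (simp add: geo_mean_def)

lemma pd_geo_mean: "pd n A \<Longrightarrow> pd n B \<Longrightarrow> pd n (geo_mean \<alpha> A B)"
  unfolding geo_mean_pd[OF _ pd_psd] geo_mean_formula_def
  by (intro pd_conj_powr pd_powr)

lemma pd_supp: "pd n A \<Longrightarrow> supp_proj A = 1\<^sub>m n"
proof (erule pdE)
  fix U d assume *: "unitary_mat n U" "\<And>i. 0 < d i" "A = ud n U d"
  have "d i \<noteq> 0" for i using *(2)[of i] by auto
  then show ?thesis using * by (simp add: supp_ud ud_one)
qed

subsection \<open>Meets of projections\<close>

lemma mat_vec_eqI:
  fixes A B :: "complex mat"
  assumes "A \<in> sq n" "B \<in> sq n" "\<And>v. v \<in> carrier_vec n \<Longrightarrow> A *\<^sub>v v = B *\<^sub>v v"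
  shows "A = B"
proof (rule sq_eqI[OF assms(1,2)])
  fix i j assume ij: "i < n" "j < n"
  have "(A *\<^sub>v unit_vec n j) $ i = (B *\<^sub>v unit_vec n j) $ i" using assms(3)[of "unit_vec n j"] by simp
  then show "A $$ (i, j) = B $$ (i, j)" using ij assms(1,2) by simp
qed

text \<open>The point is uniqueness: two projections with the same fixed vectors absorb each other,
  \<open>T * T' = T'\<close> and \<open>T' * T = T\<close>, and taking the adjoint of one product
  identifies them.\<close>

lemma proj_meet_eqI:
  assumes P: "dim_row P = n" and T: "orth_proj n T"
    and fx: "\<And>v. v \<in> carrier_vec n \<Longrightarrow> T *\<^sub>v v = v \<longleftrightarrow> P *\<^sub>v v = v \<and> Q *\<^sub>v v = v"
  shows "proj_meet P Q = T"
  unfolding proj_meet_def P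
proof (rule the_equality)
  show "orth_proj n T \<and> (\<forall>v\<in>carrier_vec n. (T *\<^sub>v v = v) = (P *\<^sub>v v = v \<and> Q *\<^sub>v v = v))"
    using T fx by auto
next
  have absorb: "S * T = T" if S: "orth_proj n S" and T: "orth_proj n T" 
    and st: "\<And>v. v \<in> carrier_vec n \<Longrightarrow> T *\<^sub>v v = v \<Longrightarrow> S *\<^sub>v v = v" for S T
  proof -
    have c: "S \<in> sq n" "T \<in> sq n" "T * T = T" using S T by (auto simp: orth_proj_def hermitian_mat_def)
    show ?thesis
    proof (rule mat_vec_eqI[of _ n])
      fix v :: "complex vec" assume v: "v \<in> carrier_vec n"
      have "T *\<^sub>v (T *\<^sub>v v) = T *\<^sub>v v" using c v by (metis assoc_mult_mat_vec)
      then show "(S * T) *\<^sub>v v = T *\<^sub>v v" using st[of "T *\<^sub>v v"] c v by simp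
    qed (use c in auto)
  qed
  fix T' assume "orth_proj n T' \<and> (\<forall>v\<in>carrier_vec n. (T' *\<^sub>v v = v) = (P *\<^sub>v v = v \<and> Q *\<^sub>v v = v))"
  then have T': "orth_proj n T'" and fx': "\<And>v. v \<in> carrier_vec n \<Longrightarrow> T' *\<^sub>v v = v \<longleftrightarrow> T *\<^sub>v v = v"
    using fx by auto
  have e: "T * T' = T'" "T' * T = T" using absorb[OF T T'] absorb[OF T' T] fx' by auto
  have c: "T \<in> sq n" "T' \<in> sq n" "mat_adjoint T = T" "mat_adjoint T' = T'"
    using T T' by (auto simp: orth_proj_def hermitian_mat_def)
  show "T' = T" using adj_mult[OF c(1,2)] c e by simp
qed

lemma ud_vec:
  assumes "unitary_mat n U" "v \<in> carrier_vec n" "i < n"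
  shows "(ud n U d *\<^sub>v v) $ i = (\<Sum>k<n. U $$ (i, k) * (complex_of_real (d k) * (\<Sum>j<n. cnj (U $$ (j, k)) * v $ j)))"
proof -
  note u = unitaryD(1)[OF assms(1)]
  have "(ud n U d *\<^sub>v v) $ i = (\<Sum>j<n. ud n U d $$ (i, j) * v $ j)"
    using u assms by (auto simp: scalar_prod_def lessThan_atLeast0 carrier_matD[OF ud_carrier[OF u]])
  also have "\<dots> = (\<Sum>j<n. \<Sum>k<n. U $$ (i, k) * (complex_of_real (d k) * (cnj (U $$ (j, k)) * v $ j)))"
    using u assms by (simp add: ud_idx[of _ n] sum_distrib_right sum_distrib_left algebra_simps)
  also have "\<dots> = (\<Sum>k<n. \<Sum>j<n. U $$ (i, k) * (complex_of_real (d k) * (cnj (U $$ (j, k)) * v $ j)))"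
    by (rule sum.swap)
  finally show ?thesis by (simp only: sum_distrib_left)
qed

lemma ud_fixed_iff:
  assumes U: "unitary_mat n U" and v: "v \<in> carrier_vec n"
  shows "ud n U d *\<^sub>v v = v \<longleftrightarrow> (\<forall>k<n. d k = 1 \<or> (\<Sum>j<n. cnj (U $$ (j, k)) * v $ j) = 0)"
proof -
  note u = unitaryD(1)[OF U]
  let ?s = "\<lambda>v k. \<Sum>j<n. cnj (U $$ (j, k)) * v $ j"
  have s: "?s (ud n U d *\<^sub>v v) k = complex_of_real (d k) * ?s v k" if k: "k < n" for k
  proof -
    have "?s (ud n U d *\<^sub>v v) k = (\<Sum>j<n. \<Sum>l<n. cnj (U $$ (j, k)) * U $$ (j, l) * (complex_of_real (d l) * ?s v l))"
      using ud_vec[OF U v, of _ d] by (simp add: sum_distrib_left algebra_simps)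
    also have "\<dots> = (\<Sum>l<n. (\<Sum>j<n. cnj (U $$ (j, k)) * U $$ (j, l)) * (complex_of_real (d l) * ?s v l))"
      by (subst sum.swap) (simp only: sum_distrib_right)
    also have "\<dots> = (\<Sum>l<n. if k = l then complex_of_real (d l) * ?s v l else 0)"
      using unitary_col[OF U _ k] by (intro sum.cong) auto
    also have "\<dots> = complex_of_real (d k) * ?s v k" using k by simp
    finally show ?thesis .
  qed
  show ?thesis
  proof
    assume "ud n U d *\<^sub>v v = v"
    then show "\<forall>k<n. d k = 1 \<or> ?s v k = 0" using s by fastforce
  next
    assume a: "\<forall>k<n. d k = 1 \<or> ?s v k = 0"
    show "ud n U d *\<^sub>v v = v"
    proof (rule eq_vecI)
      fix i assume "i < dim_vec v"
      then have i: "i < n" using v by auto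
      have "(ud n U d *\<^sub>v v) $ i = (ud n U (\<lambda>_. 1) *\<^sub>v v) $ i"
        unfolding ud_vec[OF U v i] using a by (intro sum.cong) auto
      then show "(ud n U d *\<^sub>v v) $ i = v $ i" using v by (simp add: ud_one[OF U])
    qed (use u v in \<open>simp add: carrier_matD[OF ud_carrier[OF u]]\<close>)
  qed
qed

lemma proj_meet_ud:
  assumes U: "unitary_mat n U"
  shows "proj_meet (supp_proj (ud n U a)) (supp_proj (ud n U b)) = ud n U (\<lambda>i. if a i = 0 \<or> b i = 0 then 0 else 1)"
proof (rule proj_meet_eqI)
  show "dim_row (supp_proj (ud n U a)) = n"
    using unitaryD(1)[OF U] by (simp add: supp_ud[OF U] carrier_matD[OF ud_carrier])
  show "orth_proj n (ud n U (\<lambda>i. if a i = 0 \<or> b i = 0 then 0 else 1))"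
    using U by (simp add: orth_proj_def ud_mult unitaryD(1) if_distrib cong: if_cong)
qed (auto simp: supp_ud[OF U] ud_fixed_iff[OF U])

subsection \<open>Commuting pairs\<close>

lemma log_ud: "unitary_mat n U \<Longrightarrow> mat_log (ud n U d) = ud n U (\<lambda>i. if d i = 0 then 0 else ln (d i))"
  by (simp add: mat_log_def mat_fun_ud comp_def)

lemma exp_ud: "unitary_mat n U \<Longrightarrow> mat_exp (ud n U d) = ud n U (\<lambda>i. exp (d i))"
  by (simp add: mat_exp_def mat_fun_ud comp_def)

lemma ud_add: "U \<in> sq n \<Longrightarrow> ud n U a + ud n U b = ud n U (\<lambda>i. a i + b i)"
  by (rule sq_eqI[of _ n]) (auto simp: ud_idx[of _ n] carrier_matD[OF ud_carrier] sum.distrib algebra_simps)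

lemma ud_smult: "U \<in> sq n \<Longrightarrow> complex_of_real c \<cdot>\<^sub>m ud n U a = ud n U (\<lambda>i. c * a i)"
  by (rule sq_eqI[of _ n]) (auto simp: ud_idx[of _ n] carrier_matD[OF ud_carrier] sum_distrib_left algebra_simps)

lemma ud_dominated:
  assumes U: "unitary_mat n U" and a: "\<And>i. 0 \<le> a i" and b: "\<And>i. 0 \<le> b i" 
    and ab: "\<And>i. i < n \<Longrightarrow> a i = 0 \<Longrightarrow> b i = 0"
  shows "supp_proj (ud n U b) \<preceq>\<^sub>L supp_proj (ud n U a)"
proof -
  have "qf n (ud n U b) v = 0" if z: "qf n (ud n U a) v = 0" for v
  proof -
    let ?s = "\<lambda>k. (cmod (\<Sum>i<n. cnj (U $$ (i, k)) * v i))\<^sup>2"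
    have "\<forall>k\<in>{..<n}. a k * ?s k = 0"
      using z a unfolding qf_ud[OF unitaryD(1)[OF U]]
      by (subst (asm) sum_nonneg_eq_0_iff) auto
    then show ?thesis using ab unfolding qf_ud[OF unitaryD(1)[OF U]]
      by (intro sum.neutral) auto
  qed
  then show ?thesis using supp_le_iff[of n "ud n U a" "ud n U b"] a b unitaryD(1)[OF U] by (auto intro!: psd_ud)
qed

lemma geo_mean_ud:
  assumes U: "unitary_mat n U" and a: "\<And>i. 0 \<le> a i" and b: "\<And>i. 0 \<le> b i" 
    and ab: "\<And>i. i < n \<Longrightarrow> a i = 0 \<Longrightarrow> b i = 0"
  shows "geo_mean \<alpha> (ud n U a) (ud n U b) = ud n U (\<lambda>i. a i powr (1 - \<alpha>) * b i powr \<alpha>)"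
proof -
  have "geo_mean \<alpha> (ud n U a) (ud n U b) = 
     ud n U (\<lambda>i. a i powr (1 / 2) * (a i powr (-1/2) * b i * a i powr (-1/2)) powr \<alpha> * a i powr (1 / 2))"
    using ud_dominated[OF assms] U by (simp add: geo_mean_def geo_mean_formula_def mat_powr_ud ud_mult)
  also have "\<dots> = ud n U (\<lambda>i. a i powr (1 - \<alpha>) * b i powr \<alpha>)"
  proof (rule ud_cong)
    fix i assume i: "i < n"
    show "a i powr (1 / 2) * (a i powr (-1/2) * b i * a i powr (-1/2)) powr \<alpha> * a i powr (1 / 2) = a i powr (1 - \<alpha>) * b i powr \<alpha>"
    \<comment> \<open>If \<open>a i = 0\<close>, both sides vanish, because
      \<open>0 powr r = 0\<close> for every \<open>r\<close>.\<close>
    proof (cases "a i = 0")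
      case False
      have "a i powr (-1/2) * b i * a i powr (-1/2) = a i powr (-1) * b i"
        using powr_add[of "a i" "-1/2" "-1/2"] by (simp add: algebra_simps)
      then have "(a i powr (-1/2) * b i * a i powr (-1/2)) powr \<alpha> = a i powr (-\<alpha>) * b i powr \<alpha>"
        using a b powr_mult[of "a i powr -1" "b i" \<alpha>] by (simp only: powr_ge_zero powr_powr) simp
      moreover have "a i powr (1/2) * a i powr (-\<alpha>) * a i powr (1/2) = a i powr (1 - \<alpha>)"
        using powr_add[of "a i" "1/2" "-\<alpha>"] powr_add[of "a i" "1/2 - \<alpha>" "1/2"] by simp
      ultimately show ?thesis by (simp add: algebra_simps)
    qed (use ab[OF i] in auto)
  qed
  finally show ?thesis .
qed

text \<open>This is what allows one kind to be exchanged for another on commuting pairs. The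
  hypothesis \<open>ab\<close> puts the pair into the first branch of \<open>geo_mean\<close>; zero
  eigenvalues contribute 0 on both sides because \<open>0 powr r = 0\<close> also for negative
  \<open>r\<close>.\<close>

lemma qmean_ud:
  assumes U: "unitary_mat n U" and a: "\<And>i. 0 \<le> a i" and b: "\<And>i. 0 \<le> b i" 
    and ab: "\<And>i. i < n \<Longrightarrow> a i = 0 \<Longrightarrow> b i = 0" and p: "0 < p" 
  shows "qmean k \<alpha> p (ud n U a) (ud n U b) = ud n U (\<lambda>i. a i powr (1 - \<alpha>) * b i powr \<alpha>)"
proof -
  have ab': "a i powr r = 0 \<Longrightarrow> b i powr s = 0" if "i < n" for i r s
    using ab[OF that] by auto
  \<comment> \<open>Common end of the four kinds that carry \<open>p\<close>: the inner matrix has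
    the p-th powers of the final eigenvalues.\<close>
  have fin: "ud n U (\<lambda>i. f i powr (1 / p)) = ud n U (\<lambda>i. a i powr (1 - \<alpha>) * b i powr \<alpha>)"
    if "\<And>i. i < n \<Longrightarrow> f i = a i powr ((1 - \<alpha>) * p) * b i powr (\<alpha> * p)" for f
    using that a b p by (intro ud_cong) (simp add: powr_mult powr_powr)
  show ?thesis
  proof (cases k)
    case R
    have "a i powr ((1-\<alpha>)/2 * p) * b i powr (\<alpha> * p) * a i powr ((1-\<alpha>)/2 * p) = a i powr ((1 - \<alpha>) * p) * b i powr (\<alpha> * p)" for i
    proof -
      have "(1-\<alpha>)/2 * p + (1-\<alpha>)/2 * p = (1 - \<alpha>) * p" by simp
      then have "a i powr ((1 - \<alpha>) * p) = a i powr ((1-\<alpha>)/2 * p) * a i powr ((1-\<alpha>)/2 * p)"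
        by (metis powr_add)
      then show ?thesis by (simp only: mult_ac)
    qed
    then show ?thesis using R U fin by (simp add: R_mean_def mat_powr_ud ud_mult)
  next
    case G
    have "geo_mean \<alpha> (mat_powr (ud n U a) p) (mat_powr (ud n U b) p) = ud n U (\<lambda>i. (a i powr p) powr (1 - \<alpha>) * (b i powr p) powr \<alpha>)"
      unfolding mat_powr_ud[OF U] using ab' by (intro geo_mean_ud[OF U]) auto
    then show ?thesis using G U fin
      by (simp add: G_mean_def mat_powr_ud powr_powr mult.commute)
  next
    case SG
    have g: "geo_mean (1/2) (mat_powr (ud n U a) (-p)) (mat_powr (ud n U b) p) = ud n U (\<lambda>i. a i powr (- (p/2)) * b i powr (p/2))"
    proof -
      have "geo_mean (1/2) (mat_powr (ud n U a) (-p)) (mat_powr (ud n U b) p) = ud n U (\<lambda>i. (a i powr (-p)) powr (1 - 1/2) * (b i powr p) powr (1/2))"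
        unfolding mat_powr_ud[OF U] using ab' by (intro geo_mean_ud[OF U]) auto
      then show ?thesis by (simp add: powr_powr)
    qed
    have "(a i powr (- (p/2)) * b i powr (p/2)) powr \<alpha> * a i powr p * (a i powr (- (p/2)) * b i powr (p/2)) powr \<alpha>
       = a i powr ((1 - \<alpha>) * p) * b i powr (\<alpha> * p)" for i
    proof (cases "a i = 0 \<or> b i = 0")
      case False
      then show ?thesis using a[of i] b[of i] by (simp add: powr_def exp_add[symmetric] ln_mult algebra_simps)
    qed auto
    then show ?thesis using U fin unfolding SG qmean.simps SG_mean_def g Let_def by (simp add: mat_powr_ud ud_mult)
  next
    case SGt
    have g: "geo_mean \<alpha> (mat_powr (ud n U a) (-p)) (mat_powr (ud n U b) p) = ud n U (\<lambda>i. a i powr (- ((1-\<alpha>) * p)) * b i powr (\<alpha> * p))"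
    proof -
      have "geo_mean \<alpha> (mat_powr (ud n U a) (-p)) (mat_powr (ud n U b) p) = ud n U (\<lambda>i. (a i powr (-p)) powr (1 - \<alpha>) * (b i powr p) powr \<alpha>)"
        unfolding mat_powr_ud[OF U] using ab' by (intro geo_mean_ud[OF U]) auto
      then show ?thesis by (simp add: powr_powr mult.commute)
    qed
    have "(a i powr (- ((1-\<alpha>) * p)) * b i powr (\<alpha> * p)) powr (1/2) * a i powr (2 * (1-\<alpha>) * p) * (a i powr (- ((1-\<alpha>) * p)) * b i powr (\<alpha> * p)) powr (1/2)
       = a i powr ((1 - \<alpha>) * p) * b i powr (\<alpha> * p)" for i
    proof (cases "a i = 0 \<or> b i = 0")
      case False
      then show ?thesis using a[of i] b[of i] by (simp add: powr_def exp_add[symmetric] ln_mult algebra_simps)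
    qed auto
    then show ?thesis using U fin unfolding SGt qmean.simps SGt_mean_def g Let_def by (simp add: mat_powr_ud ud_mult)
  next
    case LE
    note u = unitaryD(1)[OF U]
    have "(if a i = 0 \<or> b i = 0 then 0 else 1) * exp ((1 - \<alpha>) * ((if a i = 0 \<or> b i = 0 then 0 else 1) * (if a i = 0 then 0 else ln (a i)) * (if a i = 0 \<or> b i = 0 then 0 else 1)) 
      + \<alpha> * ((if a i = 0 \<or> b i = 0 then 0 else 1) * (if b i = 0 then 0 else ln (b i)) * (if a i = 0 \<or> b i = 0 then 0 else 1)))
       = a i powr (1 - \<alpha>) * b i powr \<alpha>" for i
      by (auto simp: powr_def exp_add)
    then show ?thesis
      using LE U u by (simp add: LE_mean_def proj_meet_ud log_ud exp_ud ud_mult ud_smult ud_add del: of_real_diff)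
  qed
qed

lemma tr_qmean_ud:
  assumes U: "unitary_mat n U" and a: "\<And>i. 0 \<le> a i" and b: "\<And>i. 0 \<le> b i" 
    and ab: "\<And>i. i < n \<Longrightarrow> a i = 0 \<Longrightarrow> b i = 0" and p: "0 < p" 
  shows "tr_qmean k \<alpha> p (ud n U a) (ud n U b) = (\<Sum>i<n. a i powr (1 - \<alpha>) * b i powr \<alpha>)"
  using qmean_ud[OF assms, where k = k and \<alpha> = \<alpha>] tr_ud[OF U] by (simp add: tr_qmean_def)

subsection \<open>Kronecker products\<close>

definition kron :: "complex mat \<Rightarrow> complex mat \<Rightarrow> complex mat" where
  "kron A B = mat (dim_row A * dim_row B) (dim_col A * dim_col B)
     (\<lambda>(i, j). A $$ (i div dim_row B, j div dim_col B) * B $$ (i mod dim_row B, j mod dim_col B))"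

lemma kron_carrier [simp]: "A \<in> sq n \<Longrightarrow> B \<in> sq m \<Longrightarrow> kron A B \<in> sq (n * m)"
  by (auto simp: kron_def)

lemma kron_idx:
  "A \<in> sq n \<Longrightarrow> B \<in> sq m \<Longrightarrow> i < n * m \<Longrightarrow> j < n * m \<Longrightarrow>
   kron A B $$ (i, j) = A $$ (i div m, j div m) * B $$ (i mod m, j mod m)"
  by (auto simp: kron_def)

lemma div_mod_less: "i < n * m \<Longrightarrow> i div m < n" "i < n * m \<Longrightarrow> i mod m < (m::nat)"
  using less_mult_imp_div_less[of i n m] by (cases "m = 0"; auto)+

lemma sum_div_mod:
  fixes f :: "nat \<Rightarrow> nat \<Rightarrow> 'a::comm_monoid_add"
  shows "(\<Sum>k<n * m. f (k div m) (k mod m)) = (\<Sum>i<n. \<Sum>j<m. f i j)"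
proof -
  have "(\<Sum>k<n * m. f (k div m) (k mod m)) = (\<Sum>x\<in>{..<n} \<times> {..<m}. f (fst x) (snd x))"
  proof (rule sum.reindex_bij_witness[of _ "\<lambda>x. fst x * m + snd x" "\<lambda>k. (k div m, k mod m)"])
    fix x assume "x \<in> {..<n} \<times> {..<m}"
    then have x: "fst x < n" "snd x < m" by auto
    have "fst x * m + snd x < (fst x + 1) * m" using x by simp
    also have "\<dots> \<le> n * m" using x by (intro mult_right_mono) auto
    finally show "fst x * m + snd x \<in> {..<n * m}" by simp
    show "((fst x * m + snd x) div m, (fst x * m + snd x) mod m) = x" using x by auto
  qed (auto simp: div_mod_less)
  then show ?thesis by (simp add: sum.cartesian_product case_prod_unfold)
qed

lemma kron_mult:
  assumes "A \<in> sq n" "C \<in> sq n" "B \<in> sq m" "D \<in> sq m"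
  shows "kron A B * kron C D = kron (A * C) (B * D)"
proof (rule sq_eqI[of _ "n * m"])
  fix i j assume ij: "i < n * m" "j < n * m"
  note d = div_mod_less[OF ij(1)] div_mod_less[OF ij(2)]
  have "(kron A B * kron C D) $$ (i, j) =
    (\<Sum>k<n * m. (A $$ (i div m, k div m) * B $$ (i mod m, k mod m)) * (C $$ (k div m, j div m) * D $$ (k mod m, j mod m)))"
    using ij assms by (simp add: mult_idx[of _ "n * m"] kron_idx[of _ n _ m] del: index_mult_mat)
  also have "\<dots> = (\<Sum>k<n. \<Sum>l<m. (A $$ (i div m, k) * B $$ (i mod m, l)) * (C $$ (k, j div m) * D $$ (l, j mod m)))"
    by (rule sum_div_mod)
  also have "\<dots> = (\<Sum>k<n. A $$ (i div m, k) * C $$ (k, j div m)) * (\<Sum>l<m. B $$ (i mod m, l) * D $$ (l, j mod m))"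
    by (simp add: sum_product algebra_simps)
  also have "\<dots> = kron (A * C) (B * D) $$ (i, j)"
    using ij assms d by (simp add: mult_idx[of _ n] mult_idx[of _ m] kron_idx[of _ n _ m] del: index_mult_mat)
  finally show "(kron A B * kron C D) $$ (i, j) = kron (A * C) (B * D) $$ (i, j)" .
qed (use assms in auto)

lemma kron_adj:
  assumes "A \<in> sq n" "B \<in> sq m"
  shows "mat_adjoint (kron A B) = kron (mat_adjoint A) (mat_adjoint B)"
  using assms
  by (intro sq_eqI[of _ "n * m"])
   (auto simp: adj_idx[of _ "n * m"] kron_idx[of _ n _ m] adj_idx[of _ n] adj_idx[of _ m] div_mod_less)

lemma kron_dg: "kron (dg n d) (dg m e) = dg (n * m) (\<lambda>k. d (k div m) * e (k mod m))"
proof (rule sq_eqI[of _ "n * m"])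
  fix i j assume ij: "i < n * m" "j < n * m"
  have "i div m = j div m \<and> i mod m = j mod m \<longleftrightarrow> i = j" by (metis div_mult_mod_eq)
  then show "kron (dg n d) (dg m e) $$ (i, j) = dg (n * m) (\<lambda>k. d (k div m) * e (k mod m)) $$ (i, j)"
    using ij div_mod_less[OF ij(1)] div_mod_less[OF ij(2)]
    by (auto simp: kron_idx[of _ n _ m] dg_idx)
qed auto

lemma kron_one: "kron (1\<^sub>m n) (1\<^sub>m m) = 1\<^sub>m (n * m)"
  using kron_dg[of n "\<lambda>_. 1" m "\<lambda>_. 1"] by simp

lemma kron_unitary:
  assumes "unitary_mat n U" "unitary_mat m V" shows "unitary_mat (n * m) (kron U V)"
  using unitaryD[OF assms(1)] unitaryD[OF assms(2)]
  by (intro unitaryI) (auto simp: kron_adj[of _ n _ m] kron_mult[of _ n _ _ m] kron_one)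

lemma kron_ud:
  assumes "U \<in> sq n" "V \<in> sq m"
  shows "kron (ud n U d) (ud m V e) = ud (n * m) (kron U V) (\<lambda>k. d (k div m) * e (k mod m))"
  using assms by (simp add: ud_def kron_adj[of _ n _ m] kron_mult[of _ n _ _ m] kron_dg[symmetric])

lemma kron_trace:
  assumes "A \<in> sq n" "B \<in> sq m"
  shows "mat_trace (kron A B) = mat_trace A * mat_trace B"
proof -
  have "mat_trace (kron A B) = (\<Sum>k<n * m. A $$ (k div m, k div m) * B $$ (k mod m, k mod m))"
    using assms carrier_matD(1)[OF kron_carrier[OF assms]] by (simp add: mat_trace_def kron_idx[of _ n _ m])
  also have "\<dots> = (\<Sum>i<n. \<Sum>j<m. A $$ (i, i) * B $$ (j, j))" by (rule sum_div_mod)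
  also have "\<dots> = mat_trace A * mat_trace B"
    using assms by (simp add: mat_trace_def sum_product)
  finally show ?thesis .
qed

lemma kron_pd: "pd n A \<Longrightarrow> pd m B \<Longrightarrow> pd (n * m) (kron A B)"
  by (elim pdE) (auto simp: kron_ud unitaryD(1) intro!: pdI kron_unitary)

lemma kron_powr:
  assumes "psd_mat n A" "psd_mat m B"
  shows "mat_powr (kron A B) r = kron (mat_powr A r) (mat_powr B r)"
proof -
  obtain U a where U: "unitary_mat n U" and a: "\<And>i. 0 \<le> a i" and A: "A = ud n U a"
    using psd_spectral[OF assms(1)] by blast
  obtain V b where V: "unitary_mat m V" and b: "\<And>i. 0 \<le> b i" and B: "B = ud m V b"
    using psd_spectral[OF assms(2)] by blast
  show ?thesis
    using a b by (simp add: A B kron_ud unitaryD(1)[OF U] unitaryD(1)[OF V] mat_powr_ud[OF U] mat_powr_ud[OF V]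
      mat_powr_ud[OF kron_unitary[OF U V]] powr_mult)
qed

subsection \<open>Means of definite pairs\<close>

lemma exp_herm_pd: "hermitian_mat n A \<Longrightarrow> pd n (mat_exp A)"
  using spectral_theorem[of n A] by (auto simp: exp_ud intro!: pdI)

lemma log_herm: "hermitian_mat n A \<Longrightarrow> hermitian_mat n (mat_log A)"
  unfolding mat_log_def by (rule mat_fun_herm)

lemma LE_pd:
  assumes "pd n A" "pd n B"
  shows "LE_mean \<alpha> A B = mat_exp (complex_of_real (1 - \<alpha>) \<cdot>\<^sub>m mat_log A + complex_of_real \<alpha> \<cdot>\<^sub>m mat_log B)"
proof -
  have P: "proj_meet (supp_proj A) (supp_proj B) = 1\<^sub>m n"
    unfolding pd_supp[OF assms(1)] pd_supp[OF assms(2)]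
    by (rule proj_meet_eqI) (auto simp: orth_proj_def hermitian_mat_def)
  have h: "hermitian_mat n (mat_log A)" "hermitian_mat n (mat_log B)"
    using assms by (auto intro: log_herm psd_herm pd_psd)
  have "mat_exp (complex_of_real (1 - \<alpha>) \<cdot>\<^sub>m mat_log A + complex_of_real \<alpha> \<cdot>\<^sub>m mat_log B) \<in> sq n"
    using exp_herm_pd[OF herm_add[OF herm_smult[OF h(1)] herm_smult[OF h(2)]]] pd_sq by blast
  then show ?thesis using hermD(1)[OF h(1)] hermD(1)[OF h(2)] by (simp add: LE_mean_def P del: of_real_diff)
qed

lemma qmean_pd:
  assumes A: "pd n A" and B: "pd n B"
  shows "pd n (qmean k \<alpha> p A B)"
proof (cases k)
  case R
  show ?thesis unfolding R qmean.simps R_mean_def using A B by (intro pd_powr pd_conj_powr)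
next
  case G
  show ?thesis unfolding G qmean.simps G_mean_def using A B by (intro pd_powr pd_geo_mean)
next
  case SG
  show ?thesis unfolding SG qmean.simps SG_mean_def Let_def using A B by (intro pd_powr pd_conj_powr pd_geo_mean)
next
  case SGt
  show ?thesis unfolding SGt qmean.simps SGt_mean_def Let_def using A B by (intro pd_powr pd_conj_powr pd_geo_mean)
next
  case LE
  have "hermitian_mat n (mat_log A)" "hermitian_mat n (mat_log B)"
    using A B by (auto intro: log_herm psd_herm pd_psd)
  then show ?thesis using LE A B by (simp add: LE_pd exp_herm_pd herm_add herm_smult del: of_real_diff)
qed

text \<open>Conjugation by a unitary and the Kronecker product are both treated as maps \<open>\<phi>\<close> of
  this kind (the former ignores its second argument).\<close>

locale pd_hom =
  fixes n m N :: nat and \<phi> :: "complex mat \<Rightarrow> complex mat \<Rightarrow> complex mat"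
  assumes mult: "A \<in> sq n \<Longrightarrow> C \<in> sq n \<Longrightarrow> B \<in> sq m \<Longrightarrow> D \<in> sq m \<Longrightarrow> \<phi> A B * \<phi> C D = \<phi> (A * C) (B * D)"
    and pd: "pd n A \<Longrightarrow> pd m B \<Longrightarrow> pd N (\<phi> A B)"
    and powr: "pd n A \<Longrightarrow> pd m B \<Longrightarrow> mat_powr (\<phi> A B) r = \<phi> (mat_powr A r) (mat_powr B r)"
    and LE: "pd n A \<Longrightarrow> pd m A' \<Longrightarrow> pd n B \<Longrightarrow> pd m B' \<Longrightarrow>
      LE_mean \<alpha> (\<phi> A A') (\<phi> B B') = \<phi> (LE_mean \<alpha> A B) (LE_mean \<alpha> A' B')"
begin

lemma geo:
  assumes "pd n A" "pd m A'" "pd n B" "pd m B'"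
  shows "geo_mean \<alpha> (\<phi> A A') (\<phi> B B') = \<phi> (geo_mean \<alpha> A B) (geo_mean \<alpha> A' B')"
  using assms
  by (simp add: geo_mean_pd[OF _ pd_psd] pd geo_mean_formula_def powr mult pd_conj_powr pd_powr
    geo_mean_pd[OF pd pd_psd[OF pd]])

lemma qmean:
  assumes "pd n A" "pd m A'" "pd n B" "pd m B'"
  shows "qmean k \<alpha> p (\<phi> A A') (\<phi> B B') = \<phi> (qmean k \<alpha> p A B) (qmean k \<alpha> p A' B')"
  using assms
  by (cases k) (simp_all add: R_mean_def G_mean_def SG_mean_def SGt_mean_def Let_def
    geo powr mult LE pd_powr pd_geo_mean pd_conj_powr)

end

lemma log_conj:
  "hermitian_mat n A \<Longrightarrow> unitary_mat n V \<Longrightarrow> mat_log (V * A * mat_adjoint V) = V * mat_log A * mat_adjoint V"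
  unfolding mat_log_def by (rule mat_fun_conj)

lemma pd_unitary_conj: "unitary_mat n V \<Longrightarrow> pd n A \<Longrightarrow> pd n (V * A * mat_adjoint V)"
  using pd_conj[of n A V "mat_adjoint V"] unitaryD by auto

lemma conj_hom:
  assumes V: "unitary_mat n V"
  shows "pd_hom n n n (\<lambda>A B. V * A * mat_adjoint V)"
proof
  note v = unitaryD[OF V]
  fix A C :: "complex mat" assume c: "A \<in> sq n" "C \<in> sq n"
  have "V * A * mat_adjoint V * (V * C * mat_adjoint V) = V * A * ((mat_adjoint V * V) * C) * mat_adjoint V"
    using c v(1) by (simp add: sq_assoc[of _ n])
  also have "\<dots> = V * (A * C) * mat_adjoint V" using c v by (simp add: sq_assoc[of V n])
  finally show "V * A * mat_adjoint V * (V * C * mat_adjoint V) = V * (A * C) * mat_adjoint V" .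
next
  fix A assume "pd n A" then show "pd n (V * A * mat_adjoint V)" using V by (rule pd_unitary_conj[rotated])
next
  fix A r assume "pd n A"
  then show "mat_powr (V * A * mat_adjoint V) r = V * mat_powr A r * mat_adjoint V"
    unfolding mat_powr_def using V by (intro mat_fun_conj psd_herm pd_psd)
next
  note v = unitaryD[OF V]
  fix A B \<alpha> assume AB: "pd n A" "pd n B"
  have h: "hermitian_mat n A" "hermitian_mat n B" "hermitian_mat n (mat_log A)" "hermitian_mat n (mat_log B)"
    using AB by (auto intro: log_herm psd_herm pd_psd)
  let ?H = "complex_of_real (1 - \<alpha>) \<cdot>\<^sub>m mat_log A + complex_of_real \<alpha> \<cdot>\<^sub>m mat_log B"
  have H: "hermitian_mat n ?H" using h by (intro herm_add herm_smult)
  have c: "mat_log A \<in> sq n" "mat_log B \<in> sq n" using h by (auto intro: hermD)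
  have "complex_of_real (1 - \<alpha>) \<cdot>\<^sub>m (V * mat_log A * mat_adjoint V) + complex_of_real \<alpha> \<cdot>\<^sub>m (V * mat_log B * mat_adjoint V)
    = V * ?H * mat_adjoint V"
    using v(1) c by (intro conj_linear[symmetric]) auto
  then show "LE_mean \<alpha> (V * A * mat_adjoint V) (V * B * mat_adjoint V) = V * LE_mean \<alpha> A B * mat_adjoint V"
    using AB V mat_fun_conj[OF H V, of exp] h
    by (simp add: LE_pd pd_unitary_conj log_conj LE_pd[OF pd_unitary_conj[OF V AB(1)] pd_unitary_conj[OF V AB(2)]]
      mat_exp_def del: of_real_diff)
qed

text \<open>The logarithm turns a Kronecker product into a sum, so \<open>LE\<close> is not covered
  by the multiplicativity in \<open>pd_hom\<close>. Its compatibility is a separate assumption of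
  that locale, supplied by this lemma and \<open>kron_exp\<close>.\<close>

lemma kron_log:
  assumes "pd n A" "pd m B"
  shows "mat_log (kron A B) = kron (mat_log A) (1\<^sub>m m) + kron (1\<^sub>m n) (mat_log B)"
proof -
  obtain U a where U: "unitary_mat n U" and a: "\<And>i. 0 < a i" and A: "A = ud n U a"
    using pdE[OF assms(1)] by blast
  obtain V b where V: "unitary_mat m V" and b: "\<And>i. 0 < b i" and B: "B = ud m V b"
    using pdE[OF assms(2)] by blast
  note u = unitaryD(1)[OF U] and v = unitaryD(1)[OF V]
  have nz: "a i \<noteq> 0" "b i \<noteq> 0" for i using a[of i] b[of i] by auto
  show ?thesis
    unfolding A B ud_one[OF U, symmetric] ud_one[OF V, symmetric] log_ud[OF U] log_ud[OF V]
      kron_ud[OF u v] log_ud[OF kron_unitary[OF U V]] ud_add[OF kron_carrier[OF u v]]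
    using a b nz by (simp add: ln_mult)
qed

lemma kron_exp:
  assumes "hermitian_mat n H" "hermitian_mat m K"
  shows "mat_exp (kron H (1\<^sub>m m) + kron (1\<^sub>m n) K) = kron (mat_exp H) (mat_exp K)"
proof -
  obtain U h where U: "unitary_mat n U" and H: "H = ud n U h"
    using spectral_theorem[OF assms(1)] by blast
  obtain V k where V: "unitary_mat m V" and K: "K = ud m V k"
    using spectral_theorem[OF assms(2)] by blast
  note u = unitaryD(1)[OF U] and v = unitaryD(1)[OF V]
  show ?thesis
    unfolding H K ud_one[OF U, symmetric] ud_one[OF V, symmetric] exp_ud[OF U] exp_ud[OF V]
      kron_ud[OF u v] ud_add[OF kron_carrier[OF u v]] exp_ud[OF kron_unitary[OF U V]]
    by (simp add: exp_add)
qed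

lemma kron_hom: "pd_hom n m (n * m) kron"
proof
  show "kron A B * kron C D = kron (A * C) (B * D)" 
    if "A \<in> sq n" "C \<in> sq n" "B \<in> sq m" "D \<in> sq m" for A B C D 
    using that by (rule kron_mult)
  show "pd (n * m) (kron A B)" if "pd n A" "pd m B" for A B using that by (rule kron_pd)
  show "mat_powr (kron A B) r = kron (mat_powr A r) (mat_powr B r)" if "pd n A" "pd m B" for A B r
    using that by (intro kron_powr pd_psd)
next
  fix A A' B B' \<alpha> assume pd: "pd n A" "pd m A'" "pd n B" "pd m B'"
  then have h: "hermitian_mat n (mat_log A)" "hermitian_mat m (mat_log A')"
    "hermitian_mat n (mat_log B)" "hermitian_mat m (mat_log B')"
    by (auto intro: log_herm psd_herm pd_psd)
  note c = h[THEN hermD(1)]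
  let ?H = "complex_of_real (1 - \<alpha>) \<cdot>\<^sub>m mat_log A + complex_of_real \<alpha> \<cdot>\<^sub>m mat_log B"
  let ?K = "complex_of_real (1 - \<alpha>) \<cdot>\<^sub>m mat_log A' + complex_of_real \<alpha> \<cdot>\<^sub>m mat_log B'"
  have HK: "hermitian_mat n ?H" "hermitian_mat m ?K" by (intro herm_add herm_smult h)+
  have "complex_of_real (1 - \<alpha>) \<cdot>\<^sub>m mat_log (kron A A') + complex_of_real \<alpha> \<cdot>\<^sub>m mat_log (kron B B')
    = kron ?H (1\<^sub>m m) + kron (1\<^sub>m n) ?K"
    unfolding kron_log[OF pd(1,2)] kron_log[OF pd(3,4)]
  proof (rule sq_eqI[of _ "n * m"])
    fix i j assume ij: "i < n * m" "j < n * m"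
    note k = kron_idx[OF _ _ ij]
    note d = div_mod_less[OF ij(1)] div_mod_less[OF ij(2)]
    have kc: "dim_row (kron X Y) = n * m" "dim_col (kron X Y) = n * m" if "X \<in> sq n" "Y \<in> sq m" for X Y
      using carrier_matD[OF kron_carrier[OF that]] by auto
    have s: "complex_of_real (1 - \<alpha>) \<cdot>\<^sub>m mat_log A + complex_of_real \<alpha> \<cdot>\<^sub>m mat_log B \<in> sq n"
      "complex_of_real (1 - \<alpha>) \<cdot>\<^sub>m mat_log A' + complex_of_real \<alpha> \<cdot>\<^sub>m mat_log B' \<in> sq m"
      using c by auto
    show "(complex_of_real (1 - \<alpha>) \<cdot>\<^sub>m (kron (mat_log A) (1\<^sub>m m) + kron (1\<^sub>m n) (mat_log A')) + 
       complex_of_real \<alpha> \<cdot>\<^sub>m (kron (mat_log B) (1\<^sub>m m) + kron (1\<^sub>m n) (mat_log B'))) $$ (i, j)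
      = (kron ?H (1\<^sub>m m) + kron (1\<^sub>m n) ?K) $$ (i, j)"
      using ij c s d by (simp add: kc k algebra_simps del: of_real_diff)
  qed (use c in auto)
  then show "LE_mean \<alpha> (kron A A') (kron B B') = kron (LE_mean \<alpha> A B) (LE_mean \<alpha> A' B')"
    using kron_exp[OF HK] 
    by (simp add: LE_pd[OF pd(1,3)] LE_pd[OF pd(2,4)] LE_pd[OF kron_pd[OF pd(1,2)] kron_pd[OF pd(3,4)]] del: of_real_diff)
qed

lemma tr_qmean_conj:
  assumes "unitary_mat n V" "pd n A" "pd n B"
  shows "tr_qmean k \<alpha> p (V * A * mat_adjoint V) (V * B * mat_adjoint V) = tr_qmean k \<alpha> p A B"
  using pd_hom.qmean[OF conj_hom[OF assms(1)] assms(2) assms(2) assms(3) assms(3)]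
    trace_conj[OF assms(1) pd_sq[OF qmean_pd[OF assms(2,3)]]]
  by (simp add: tr_qmean_def)

lemma tr_qmean_kron:
  assumes "pd n A" "pd m A'" "pd n B" "pd m B'"
  shows "tr_qmean k \<alpha> p (kron A A') (kron B B') = tr_qmean k \<alpha> p A B * tr_qmean k \<alpha> p A' B'"
proof -
  note q = qmean_pd[OF assms(1,3), of k \<alpha> p] qmean_pd[OF assms(2,4), of k \<alpha> p]
  have "mat_trace (qmean k \<alpha> p (kron A A') (kron B B')) = mat_trace (qmean k \<alpha> p A B) * mat_trace (qmean k \<alpha> p A' B')"
    using pd_hom.qmean[OF kron_hom assms] kron_trace[OF q[THEN pd_sq]] by simp
  \<comment> \<open>Both traces are real, so the real part of their product is the product of their
    real parts.\<close>
  then show ?thesis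
    using trace_herm[OF psd_herm[OF pd_psd[OF q(1)]]] trace_herm[OF psd_herm[OF pd_psd[OF q(2)]]]
    by (metis Re_complex_of_real of_real_mult tr_qmean_def)
qed

subsection \<open>Jensen's inequality for joint concavity and convexity\<close>

text \<open>Concavity is the case \<open>\<sigma> = 1\<close>, convexity the case \<open>\<sigma> = -1\<close>.\<close>

definition jconc :: "real \<Rightarrow> mean_kind \<Rightarrow> real \<Rightarrow> real \<Rightarrow> bool" where
  "jconc \<sigma> k \<alpha> p \<longleftrightarrow> (\<forall>n\<ge>1. \<forall>(A1, B1)\<in>qmean_dom k \<alpha> n. \<forall>(A2, B2)\<in>qmean_dom k \<alpha> n. \<forall>t\<in>{0..1}.
     \<sigma> * ((1 - t) * tr_qmean k \<alpha> p A1 B1 + t * tr_qmean k \<alpha> p A2 B2)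
       \<le> \<sigma> * tr_qmean k \<alpha> p (mat_mix t A1 A2) (mat_mix t B1 B2))"

lemma jconc_concave: "tr_jointly_concave k \<alpha> p \<longleftrightarrow> jconc 1 k \<alpha> p"
  by (simp add: jconc_def tr_jointly_concave_def)

lemma jconc_convex: "tr_jointly_convex k \<alpha> p \<longleftrightarrow> jconc (-1) k \<alpha> p"
  unfolding jconc_def tr_jointly_convex_def by (simp only: mult_minus1 neg_le_iff_le)

lemma jconcD:
  assumes "jconc \<sigma> k \<alpha> p" "1 \<le> n" "(A1, B1) \<in> qmean_dom k \<alpha> n" "(A2, B2) \<in> qmean_dom k \<alpha> n" "0 \<le> t" "t \<le> 1"
  shows "\<sigma> * ((1 - t) * tr_qmean k \<alpha> p A1 B1 + t * tr_qmean k \<alpha> p A2 B2)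
       \<le> \<sigma> * tr_qmean k \<alpha> p (mat_mix t A1 A2) (mat_mix t B1 B2)"
  using assms unfolding jconc_def by fastforce

lemma dom_iff:
  "(A, B) \<in> qmean_dom k \<alpha> n \<longleftrightarrow> psd_mat n A \<and> psd_mat n B \<and>
     (\<alpha> > 1 \<or> k = SG \<or> k = SGt \<longrightarrow> (\<forall>v. qf n A v = 0 \<longrightarrow> qf n B v = 0))"
  using supp_le_iff[of n A B] by (auto simp: qmean_dom_def)

lemma dom_pd: "pd n A \<Longrightarrow> psd_mat n B \<Longrightarrow> (A, B) \<in> qmean_dom k \<alpha> n"
  unfolding qmean_dom_def using supp_le_pd pd_psd by auto

lemma mat_mix_psd: "psd_mat n A \<Longrightarrow> psd_mat n B \<Longrightarrow> 0 \<le> t \<Longrightarrow> t \<le> 1 \<Longrightarrow> psd_mat n (mat_mix t A B)"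
  unfolding mat_mix_def by (intro psd_add psd_smult) auto

lemma qf_mix: 
  "A \<in> sq n \<Longrightarrow> B \<in> sq n \<Longrightarrow> qf n (mat_mix t A B) v = (1 - t) * qf n A v + t * qf n B v"
  unfolding mat_mix_def by (simp add: qf_add qf_smult del: of_real_diff)

text \<open>A null vector of the mixture is null for each part of positive weight, so the kernel
  inclusion survives mixing.\<close>

lemma dom_mix:
  assumes 1: "(A1, B1) \<in> qmean_dom k \<alpha> n" and 2: "(A2, B2) \<in> qmean_dom k \<alpha> n" and t: "0 \<le> t" "t \<le> 1"
  shows "(mat_mix t A1 A2, mat_mix t B1 B2) \<in> qmean_dom k \<alpha> n"
proof -
  have p: "psd_mat n A1" "psd_mat n A2" "psd_mat n B1" "psd_mat n B2" using 1 2 by (auto simp: dom_iff)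
  have "qf n (mat_mix t B1 B2) v = 0"
    if d: "\<And>v. qf n A1 v = 0 \<Longrightarrow> qf n B1 v = 0" "\<And>v. qf n A2 v = 0 \<Longrightarrow> qf n B2 v = 0" 
      and z: "qf n (mat_mix t A1 A2) v = 0" for v
  proof -
    have "(1 - t) * qf n A1 v + t * qf n A2 v = 0" using z p by (simp add: qf_mix)
    then have "(1 - t) * qf n A1 v = 0 \<and> t * qf n A2 v = 0"
      using p t by (subst (asm) add_nonneg_eq_0_iff) (auto simp: psd_iff)
    then show ?thesis using p d[of v] by (auto simp: qf_mix)
  qed
  then show ?thesis using 1 2 mat_mix_psd[OF _ _ t] by (auto simp: dom_iff)
qed

section \<open>Averages of finitely many matrices\<close>

definition avg :: "nat \<Rightarrow> nat \<Rightarrow> (nat \<Rightarrow> complex mat) \<Rightarrow> complex mat" where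
  "avg n N F = mat n n (\<lambda>(i, j). (\<Sum>k<N. F k $$ (i, j)) / of_nat N)"

lemma avg_carrier [simp]: "avg n N F \<in> sq n" by (simp add: avg_def)

lemma avg_idx: "i < n \<Longrightarrow> j < n \<Longrightarrow> avg n N F $$ (i, j) = (\<Sum>k<N. F k $$ (i, j)) / of_nat N"
  by (simp add: avg_def)

lemma avg_Suc:
  assumes "F N \<in> sq n" "1 \<le> N"
  shows "avg n (Suc N) F = mat_mix (1 / real (Suc N)) (avg n N F) (F N)"
proof (rule sq_eqI[of _ n])
  fix i j assume ij: "i < n" "j < n"
  have N: "complex_of_nat N \<noteq> 0" "complex_of_nat (Suc N) \<noteq> 0" using assms by (auto simp del: of_nat_Suc)
  have e: "complex_of_real (1 - 1 / real (Suc N)) = of_nat N / of_nat (Suc N)" 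
    "complex_of_real (1 / real (Suc N)) = 1 / of_nat (Suc N)"
    using N(2) by (simp_all add: field_simps)
  show "avg n (Suc N) F $$ (i, j) = mat_mix (1 / real (Suc N)) (avg n N F) (F N) $$ (i, j)"
    using ij assms N unfolding mat_mix_def e
    by (simp add: avg_idx carrier_matD[OF avg_carrier] add_divide_distrib del: of_nat_Suc)
qed (use assms in \<open>auto simp: mat_mix_def\<close>)

text \<open>Membership of the averaged pair in the domain is carried along, because the induction
  step applies the two-point inequality to that pair.\<close>

lemma jensen:
  assumes jc: "jconc \<sigma> k \<alpha> p" and n: "1 \<le> n" and N: "1 \<le> N"
    and dom: "\<And>i. i < N \<Longrightarrow> (A i, B i) \<in> qmean_dom k \<alpha> n"
  shows "(avg n N A, avg n N B) \<in> qmean_dom k \<alpha> n \<and>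
    \<sigma> * ((\<Sum>i<N. tr_qmean k \<alpha> p (A i) (B i)) / real N) \<le> \<sigma> * tr_qmean k \<alpha> p (avg n N A) (avg n N B)"
  using N dom
proof (induction N rule: dec_induct)
  case base
  have "avg n 1 F = F 0" if "F 0 \<in> sq n" for F
    using that by (intro sq_eqI[of _ n]) (auto simp: avg_idx)
  moreover have "A 0 \<in> sq n" "B 0 \<in> sq n" using base[of 0] by (auto simp: dom_iff)
  ultimately show ?case using base[of 0] by simp
next
  case (step N)
  let ?f = "tr_qmean k \<alpha> p" and ?t = "1 / real (Suc N)"
  have IH: "(avg n N A, avg n N B) \<in> qmean_dom k \<alpha> n"
    "\<sigma> * ((\<Sum>i<N. ?f (A i) (B i)) / real N) \<le> \<sigma> * ?f (avg n N A) (avg n N B)"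
    using step.IH step.prems by auto
  have d: "(A N, B N) \<in> qmean_dom k \<alpha> n" using step.prems by simp
  have c: "A N \<in> sq n" "B N \<in> sq n" using d by (auto simp: dom_iff)
  have t: "0 \<le> ?t" "?t \<le> 1" by auto
  have N: "real N > 0" using step.hyps by simp
  have N1: "1 - ?t = real N / real (Suc N)" using N by (simp add: field_simps)
  have "\<sigma> * ((\<Sum>i<Suc N. ?f (A i) (B i)) / real (Suc N)) =
     (1 - ?t) * (\<sigma> * ((\<Sum>i<N. ?f (A i) (B i)) / real N)) + ?t * (\<sigma> * ?f (A N) (B N))"
    unfolding N1 using N by (simp add: divide_simps) (simp add: algebra_simps)
  also have "\<dots> \<le> (1 - ?t) * (\<sigma> * ?f (avg n N A) (avg n N B)) + ?t * (\<sigma> * ?f (A N) (B N))"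
    by (rule add_right_mono, rule mult_left_mono[OF IH(2)]) simp
  also have "\<dots> = \<sigma> * ((1 - ?t) * ?f (avg n N A) (avg n N B) + ?t * ?f (A N) (B N))"
    by (simp add: algebra_simps)
  also have "\<dots> \<le> \<sigma> * ?f (avg n (Suc N) A) (avg n (Suc N) B)"
    unfolding avg_Suc[of A N n, OF c(1) step.hyps(1)] avg_Suc[of B N n, OF c(2) step.hyps(1)]
    by (rule jconcD[OF jc n IH(1) d t])
  finally show ?case
    using dom_mix[OF IH(1) d t, folded avg_Suc[of A N n, OF c(1) step.hyps(1)] avg_Suc[of B N n, OF c(2) step.hyps(1)]] by blast
qed

lemma mix_ud: "U \<in> sq n \<Longrightarrow> mat_mix t (ud n U a) (ud n U b) = ud n U (\<lambda>i. (1 - t) * a i + t * b i)"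
  unfolding mat_mix_def by (simp add: ud_smult ud_add del: of_real_diff)

text \<open>Tests the midpoint of the 1 by 1 pairs (1, 0) and (1, 1), on which the trace of (1, b)
  is \<open>b powr \<alpha>\<close>. This alone decides on which side of 1 the exponent
  lies.\<close>

lemma jconc_alpha:
  assumes jc: "jconc \<sigma> k \<alpha> p" and p: "0 < p"
  shows "\<sigma> * (1 / 2) \<le> \<sigma> * (1 / 2) powr \<alpha>"
proof -
  let ?u = "ud 1 (1\<^sub>m 1)"
  have f: "tr_qmean k \<alpha> p (?u (\<lambda>_. 1)) (?u (\<lambda>_. b)) = b powr \<alpha>" if "b \<ge> 0" for b
    using that p by (subst tr_qmean_ud) auto
  have d: "(?u (\<lambda>_. 1), ?u (\<lambda>_. b)) \<in> qmean_dom k \<alpha> 1" if "b \<ge> 0" for b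
    using that by (intro dom_pd pdI psd_ud) auto
  have "\<sigma> * ((1 - 1/2) * tr_qmean k \<alpha> p (?u (\<lambda>_. 1)) (?u (\<lambda>_. 0)) + 1/2 * tr_qmean k \<alpha> p (?u (\<lambda>_. 1)) (?u (\<lambda>_. 1)))
    \<le> \<sigma> * tr_qmean k \<alpha> p (mat_mix (1/2) (?u (\<lambda>_. 1)) (?u (\<lambda>_. 1))) (mat_mix (1/2) (?u (\<lambda>_. 0)) (?u (\<lambda>_. 1)))"
    by (rule jconcD[OF jc _ d d]) auto
  then show ?thesis using f[of 0] f[of 1] f[of "1/2"] by (simp add: mix_ud)
qed

subsection \<open>Comparison with the maximal quantity\<close>

lemma tr_ud_general:
  assumes "W \<in> sq n"
  shows "tr (ud n W d) = (\<Sum>j<n. d j * (\<Sum>r<n. (cmod (W $$ (r, j)))\<^sup>2))"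
proof -
  have "ud n W d $$ (r, r) = complex_of_real (\<Sum>j<n. d j * (cmod (W $$ (r, j)))\<^sup>2)" if "r < n" for r
    using assms that by (simp add: ud_idx[of _ n] complex_norm_square algebra_simps del: of_real_power)
  then have "tr (ud n W d) = (\<Sum>r<n. \<Sum>j<n. d j * (cmod (W $$ (r, j)))\<^sup>2)"
    using assms by (simp add: tr_idx[of _ n])
  also have "\<dots> = (\<Sum>j<n. \<Sum>r<n. d j * (cmod (W $$ (r, j)))\<^sup>2)" by (rule sum.swap)
  finally show ?thesis by (simp only: sum_distrib_left)
qed

lemma avg_ud:
  assumes "W \<in> sq n"
  shows "avg n N (\<lambda>i. ud n W (d i)) = ud n W (\<lambda>j. (\<Sum>i<N. d i j) / real N)"
proof (rule sq_eqI[of _ n])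
  fix r c assume rc: "r < n" "c < n"
  have "(\<Sum>i<N. \<Sum>j<n. complex_of_real (d i j) * W $$ (r, j) * cnj (W $$ (c, j))) =
    (\<Sum>j<n. \<Sum>i<N. complex_of_real (d i j) * W $$ (r, j) * cnj (W $$ (c, j)))" by (rule sum.swap)
  then show "avg n N (\<lambda>i. ud n W (d i)) $$ (r, c) = ud n W (\<lambda>j. (\<Sum>i<N. d i j) / real N) $$ (r, c)"
    using rc assms by (simp add: avg_idx ud_idx[of _ n] sum_divide_distrib sum_distrib_right)
qed (use assms in auto)

lemma G_mean_one: 
  assumes A: "psd_mat n A" and B: "psd_mat n B" and g: "psd_mat n (geo_mean \<alpha> A B)"
  shows "qmean G \<alpha> 1 A B = geo_mean \<alpha> A B"
  using mat_powr_one[OF A] mat_powr_one[OF B] mat_powr_one[OF g] by (simp add: G_mean_def)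

lemma geo_mean_formula_psd: "psd_mat n A \<Longrightarrow> psd_mat n B \<Longrightarrow> psd_mat n (geo_mean_formula \<alpha> A B)"
  unfolding geo_mean_formula_def by (intro psd_conj_powr mat_powr_psd)

text \<open>With \<open>A\<^sup>-\<^sup>1\<^sup>/\<^sup>2 B A\<^sup>-\<^sup>1\<^sup>/\<^sup>2 = \<Sum>\<^sub>i l\<^sub>i P\<^sub>i\<close> (rank one projections), the pair \<open>(A, B)\<close> is the sum of
  the commuting pairs \<open>(Q\<^sub>i, l\<^sub>i Q\<^sub>i)\<close>, where \<open>Q\<^sub>i = A\<^sup>1\<^sup>/\<^sup>2 P\<^sub>i A\<^sup>1\<^sup>/\<^sup>2\<close>.\<close>

lemma compare_G:
  assumes jc: "jconc \<sigma> k \<alpha> p" and n: "1 \<le> n" and p: "0 < p"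
    and A: "psd_mat n A" and B: "psd_mat n B" and ker: "\<And>v. qf n A v = 0 \<Longrightarrow> qf n B v = 0"
  shows "\<sigma> * tr_qmean G \<alpha> 1 A B \<le> \<sigma> * tr_qmean k \<alpha> p A B"
proof -
  let ?h = "mat_powr A (1/2)" and ?C = "mat_powr A (-1/2) * B * mat_powr A (-1/2)"
  have h: "?h \<in> sq n" "mat_adjoint ?h = ?h" and s: "mat_powr A (-1/2) \<in> sq n"
    using mat_powr_psd[OF A, of "1/2"] mat_powr_psd[OF A, of "-1/2"] hermD(2)[OF psd_herm] by auto
  obtain V l where V: "unitary_mat n V" and l: "\<And>i. 0 \<le> l i" and C: "?C = ud n V l"
    using psd_spectral[OF psd_conj_powr[OF A B]] by blast
  note v = unitaryD[OF V]
  \<comment> \<open>The columns of \<open>W\<close> generate the rank-one terms: weights 1 give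
    \<open>A\<close>, weights \<open>l i\<close> give \<open>B\<close>, and weights
    \<open>l i powr \<alpha>\<close> give the geometric mean.\<close>
  define W where "W = ?h * V"
  have W: "W \<in> sq n" using h v by (simp add: W_def)
  have udW: "?h * ud n V d * ?h = ud n W d" for d
    using ud_left[OF v(1) h(1)] h by (simp add: W_def)
  have supp: "?h * mat_powr A (-1/2) = supp_proj A" "mat_powr A (-1/2) * ?h = supp_proj A"
  proof -
    obtain U a where "unitary_mat n U" "\<And>i. 0 \<le> a i" "A = ud n U a"
      using psd_spectral[OF A] by blast
    then have "mat_powr A 0 = supp_proj A" by (simp add: mat_powr_ud supp_ud)
    then show "?h * mat_powr A (-1/2) = supp_proj A" "mat_powr A (-1/2) * ?h = supp_proj A"
      using mat_powr_add[OF A] by auto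
  qed
  have A_eq: "ud n W (\<lambda>_. 1) = A"
    using udW[of "\<lambda>_. 1"] ud_one[OF V] h mat_powr_add[OF A, of "1/2" "1/2"] mat_powr_one[OF A] by simp
  \<comment> \<open>The two outer products are the support projection of \<open>A\<close>, which
    \<open>B\<close> absorbs by the kernel inclusion.\<close>
  have "ud n W l = (?h * mat_powr A (-1/2)) * B * (mat_powr A (-1/2) * ?h)"
    using udW[of l] h s B by (simp add: C[symmetric] sq_assoc[of _ n])
  also have "\<dots> = B" using mult_supp[OF A B ker] supp by simp
  finally have B_eq: "ud n W l = B" .
  have G: "tr_qmean G \<alpha> 1 A B = tr (ud n W (\<lambda>i. l i powr \<alpha>))"
  proof -
    have "geo_mean \<alpha> A B = geo_mean_formula \<alpha> A B"
      using supp_le_iff[OF A B] ker by (simp add: geo_mean_def)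
    moreover have "geo_mean_formula \<alpha> A B = ud n W (\<lambda>i. l i powr \<alpha>)"
      unfolding geo_mean_formula_def C mat_powr_ud[OF V] udW ..
    ultimately show ?thesis using G_mean_one[OF A B] geo_mean_formula_psd[OF A B] 
      unfolding tr_qmean_def by metis
  qed
  \<comment> \<open>\<open>jensen\<close> speaks of averages, so each of the \<open>n\<close> terms
    carries the factor \<open>real n\<close>.\<close>
  define Q where "Q i = ud n W (\<lambda>j. if j = i then real n else 0)" for i
  define Q' where "Q' i = ud n W (\<lambda>j. if j = i then real n * l j else 0)" for i
  have Q': "Q' i = complex_of_real (l i) \<cdot>\<^sub>m Q i" for i
    unfolding Q_def Q'_def ud_smult[OF W] by (rule ud_cong) auto
  have f: "(Q i, Q' i) \<in> qmean_dom k \<alpha> n \<and> tr_qmean k \<alpha> p (Q i) (Q' i) = l i powr \<alpha> * tr (Q i)" for i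
  proof -
    \<comment> \<open>\<open>W\<close> need not be unitary, so \<open>Q i\<close> is diagonalised
      afresh; its multiple \<open>Q' i\<close> is then diagonal in the same basis.\<close>
    have "psd_mat n (Q i)" unfolding Q_def using W by (intro psd_ud) auto
    then obtain U q where U: "unitary_mat n U" and q: "\<And>i. 0 \<le> q i" and Q: "Q i = ud n U q"
      using psd_spectral by blast
    have Q'_ud: "Q' i = ud n U (\<lambda>j. l i * q j)" unfolding Q' Q using unitaryD(1)[OF U] by (rule ud_smult)
    have "tr_qmean k \<alpha> p (Q i) (Q' i) = (\<Sum>j<n. q j powr (1 - \<alpha>) * (l i * q j) powr \<alpha>)"
      unfolding Q Q'_ud using q l p by (intro tr_qmean_ud[OF U]) auto
    also have "\<dots> = (\<Sum>j<n. l i powr \<alpha> * q j)"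
    proof (rule sum.cong[OF refl])
      fix j
      have "q j powr (1 - \<alpha>) * q j powr \<alpha> = q j"
        using q[of j] by (simp add: powr_add[symmetric])
      then show "q j powr (1 - \<alpha>) * (l i * q j) powr \<alpha> = l i powr \<alpha> * q j"
        using q[of j] l[of i] by (simp add: powr_mult algebra_simps)
    qed
    finally have "tr_qmean k \<alpha> p (Q i) (Q' i) = l i powr \<alpha> * tr (Q i)"
      using U by (simp add: Q tr_ud sum_distrib_left)
    moreover have "(Q i, Q' i) \<in> qmean_dom k \<alpha> n"
      unfolding qmean_dom_def Q Q'_ud
      using ud_dominated[OF U q, of "\<lambda>j. l i * q j"] q l unitaryD(1)[OF U] by (auto intro!: psd_ud)
    ultimately show ?thesis by simp
  qed
  have "avg n n Q = A"
    unfolding Q_def avg_ud[OF W] A_eq[symmetric] using n by (intro ud_cong) simp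
  moreover have "avg n n Q' = B"
    unfolding Q'_def avg_ud[OF W] B_eq[symmetric] using n by (intro ud_cong) simp
  moreover have "(\<Sum>i<n. tr_qmean k \<alpha> p (Q i) (Q' i)) / real n = tr_qmean G \<alpha> 1 A B"
  proof -
    have "(\<Sum>i<n. tr_qmean k \<alpha> p (Q i) (Q' i)) / real n =
       (\<Sum>i<n. l i powr \<alpha> * (real n * (\<Sum>r<n. (cmod (W $$ (r, i)))\<^sup>2))) / real n"
      using f by (simp add: Q_def tr_ud_general[OF W] if_distrib[where f = "\<lambda>x. x * _"] cong: if_cong)
    also have "\<dots> = (\<Sum>i<n. l i powr \<alpha> * (\<Sum>r<n. (cmod (W $$ (r, i)))\<^sup>2))"
      using n by (simp add: sum_divide_distrib)
    finally show ?thesis by (simp add: G tr_ud_general[OF W])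
  qed
  ultimately show ?thesis using jensen[OF jc n n, of Q Q'] f by auto
qed

subsection \<open>Simultaneous diagonalisation\<close>

lemma cnj_mult_norm: "cnj z * (complex_of_real c * z) = complex_of_real (c * (cmod z)\<^sup>2)"
proof -
  have "cnj z * (complex_of_real c * z) = complex_of_real c * (z * cnj z)" by (simp only: mult_ac)
  then show ?thesis by (simp only: complex_norm_square of_real_mult)
qed

lemma dg_as_ud: "dg n a = ud n (1\<^sub>m n) a"
  by (simp add: ud_def)

lemma ud_unconj:
  assumes U: "unitary_mat n U" and V: "V \<in> sq n" and B: "B \<in> sq n" 
    and eq: "mat_adjoint U * B * U = ud n V b"
  shows "B = ud n (U * V) b"
proof -
  note u = unitaryD[OF U]
  have "B = (U * mat_adjoint U) * B * (U * mat_adjoint U)" using u B by simp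
  also have "\<dots> = U * (mat_adjoint U * B * U) * mat_adjoint U"
    using u(1) B by (simp add: sq_assoc[of _ n])
  also have "\<dots> = ud n (U * V) b" unfolding eq using V u(1) by (rule ud_left)
  finally show ?thesis .
qed

lemma ud_eqI:
  assumes V: "unitary_mat n V" and B: "B \<in> sq n" 
    and eq: "\<And>i k. i < n \<Longrightarrow> k < n \<Longrightarrow> (\<Sum>j<n. B $$ (i, j) * V $$ (j, k)) = complex_of_real (b k) * V $$ (i, k)"
  shows "B = ud n V b"
proof -
  note v = unitaryD[OF V]
  have "B * V = V * dg n b"
    using v(1) B eq by (intro sq_eqI[of _ n]) (auto simp: mult_idx[of B n V] dg_right_idx[of _ n] simp del: index_mult_mat)
  then have "B * (V * mat_adjoint V) = V * dg n b * mat_adjoint V"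
    using v(1) B by (simp add: sq_assoc[of B n V, symmetric])
  then show ?thesis using v B by (simp add: ud_def)
qed

lemma ud_col_eq:
  assumes V: "unitary_mat n V" and ik: "i < n" "k < n"
  shows "(\<Sum>j<n. ud n V h $$ (i, j) * V $$ (j, k)) = complex_of_real (h k) * V $$ (i, k)"
proof -
  note v = unitaryD[OF V]
  have "ud n V h * V = V * dg n h * (mat_adjoint V * V)"
    using v(1) by (simp add: ud_def sq_assoc[of _ n])
  then have "(ud n V h * V) $$ (i, k) = (V * dg n h) $$ (i, k)" using v by simp
  then show ?thesis
    using v(1) ik by (simp add: mult_idx[of "ud n V h" n V] dg_right_idx[of _ n] mult.commute del: index_mult_mat)
qed

text \<open>The matrix \<open>B + c A\<close> with \<open>c\<close> so large that the gaps of \<open>c A\<close> exceed the width of the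
  spectrum of \<open>B\<close> has only common eigenvectors of \<open>A\<close> and \<open>B\<close>.\<close>

lemma simultaneous_diag_dg:
  assumes B: "hermitian_mat n B" and comm: "\<And>i j. i < n \<Longrightarrow> j < n \<Longrightarrow> a i \<noteq> a j \<Longrightarrow> B $$ (i, j) = 0"
  shows "\<exists>V a' b. unitary_mat n V \<and> dg n a = ud n V a' \<and> B = ud n V b \<and> (\<forall>k<n. a' k \<in> a ` {..<n})"
proof -
  obtain S s where S: "unitary_mat n S" and Bs: "B = ud n S s" using spectral_theorem[OF B] by blast
  have Bc: "B \<in> sq n" using hermD(1)[OF B] .
  define M where "M = (\<Sum>i<n. \<bar>s i\<bar>)"
  have M: "\<bar>s i\<bar> \<le> M" if "i < n" for i
    unfolding M_def using that by (intro member_le_sum) auto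
  have M1: "s i \<le> M" "- s i \<le> M" if "i < n" for i using M[OF that] by auto
  have M0: "M \<ge> 0" unfolding M_def by (intro sum_nonneg) auto
  have qB: "\<bar>qf n B w\<bar> \<le> M * (\<Sum>i<n. (cmod (w i))\<^sup>2)" for w
  proof -
    have "qf n B w \<le> M * (\<Sum>i<n. (cmod (w i))\<^sup>2)"
      unfolding Bs using M1 by (intro qf_ud_le_one[OF S])
    moreover have "- qf n B w = qf n (ud n S (\<lambda>i. - s i)) w"
      unfolding Bs qf_ud[OF unitaryD(1)[OF S]] by (simp add: sum_negf)
    moreover have "qf n (ud n S (\<lambda>i. - s i)) w \<le> M * (\<Sum>i<n. (cmod (w i))\<^sup>2)"
      using M1 by (intro qf_ud_le_one[OF S])
    ultimately show ?thesis by simp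
  qed
  \<comment> \<open>One constant for all pairs: the sum dominates each of its terms, and pairs with
    equal values of \<open>a\<close> contribute 0 because division by zero gives 0.\<close>
  define c where "c = (\<Sum>x\<in>{..<n} \<times> {..<n}. (2 * M + 1) / \<bar>a (fst x) - a (snd x)\<bar>)"
  have c: "c * \<bar>a i - a j\<bar> > 2 * M" if "i < n" "j < n" "a i \<noteq> a j" for i j
  proof -
    have "(2 * M + 1) / \<bar>a i - a j\<bar> \<le> c"
      unfolding c_def using that M0 member_le_sum[of "(i, j)" "{..<n} \<times> {..<n}" "\<lambda>x. (2 * M + 1) / \<bar>a (fst x) - a (snd x)\<bar>"]
      by auto
    then have "2 * M + 1 \<le> c * \<bar>a i - a j\<bar>" using that by (simp add: field_simps)
    then show ?thesis by simp
  qed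
  define H where "H = B + dg n (\<lambda>i. c * a i)"
  have "hermitian_mat n H" unfolding H_def using B by (intro herm_add) (auto simp: dg_as_ud)
  then obtain V h where V: "unitary_mat n V" and H: "H = ud n V h" using spectral_theorem by blast
  have BV: "(\<Sum>j<n. B $$ (i, j) * V $$ (j, k)) = complex_of_real (h k - c * a i) * V $$ (i, k)"
    if ik: "i < n" "k < n" for i k
  proof -
    have "(\<Sum>j<n. H $$ (i, j) * V $$ (j, k)) = (\<Sum>j<n. B $$ (i, j) * V $$ (j, k)) + (\<Sum>j<n. dg n (\<lambda>i. c * a i) $$ (i, j) * V $$ (j, k))"
      using ik Bc by (simp add: H_def algebra_simps sum.distrib carrier_matD[OF dg_carrier])
    also have "(\<Sum>j<n. dg n (\<lambda>i. c * a i) $$ (i, j) * V $$ (j, k)) = complex_of_real (c * a i) * V $$ (i, k)"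
      using ik by (simp add: dg_idx if_distrib[where f = "\<lambda>x. x * _"] cong: if_cong)
    finally show ?thesis using ud_col_eq[OF V ik, of h] by (simp add: H algebra_simps)
  qed
  \<comment> \<open>An eigenvector of \<open>H\<close> is cut down to the coordinates with
    \<open>a i = x\<close>. As \<open>B\<close> links only equal values of \<open>a\<close>, the
    nonzero piece is an eigenvector of \<open>B\<close> with eigenvalue \<open>h k - c * x\<close>,
    and the spectrum of \<open>B\<close> is bounded by \<open>M\<close>.\<close>
  have loc: "\<bar>h k - c * x\<bar> \<le> M" if k: "k < n" and i: "i < n" "V $$ (i, k) \<noteq> 0" "a i = x" for k i x
  proof -
    let ?w = "\<lambda>i. if a i = x then V $$ (i, k) else 0"
    let ?N = "\<Sum>i<n. (cmod (?w i))\<^sup>2"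
    have Bw: "(\<Sum>j<n. B $$ (i, j) * ?w j) = complex_of_real (h k - c * x) * ?w i" if "i < n" for i
    proof -
      have "(\<Sum>j<n. B $$ (i, j) * ?w j) = (if a i = x then \<Sum>j<n. B $$ (i, j) * V $$ (j, k) else 0)"
      proof (cases "a i = x")
        case True
        have "B $$ (i, j) * ?w j = B $$ (i, j) * V $$ (j, k)" if "j < n" for j
          using comm[OF \<open>i < n\<close> that] True by (cases "a j = x") auto
        then have "(\<Sum>j<n. B $$ (i, j) * ?w j) = (\<Sum>j<n. B $$ (i, j) * V $$ (j, k))"
          by (intro sum.cong[OF refl]) (simp only: lessThan_iff)
        then show ?thesis using True by simp
      next
        case False
        have "B $$ (i, j) * ?w j = 0" if "j < n" for j
          using comm[OF \<open>i < n\<close> that] False by (cases "a j = x") auto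
        then have "(\<Sum>j<n. B $$ (i, j) * ?w j) = 0"
          by (intro sum.neutral ballI) (simp only: lessThan_iff)
        then show ?thesis using False by simp
      qed
      then show ?thesis using BV[OF that k] by auto
    qed
    have "(\<Sum>i<n. \<Sum>j<n. cnj (?w i) * B $$ (i, j) * ?w j) = (\<Sum>i<n. cnj (?w i) * (\<Sum>j<n. B $$ (i, j) * ?w j))"
      by (simp only: sum_distrib_left mult.assoc)
    also have "\<dots> = (\<Sum>i<n. cnj (?w i) * (complex_of_real (h k - c * x) * ?w i))"
      using Bw by (intro sum.cong) auto
    also have "\<dots> = complex_of_real ((h k - c * x) * ?N)"
      by (simp only: cnj_mult_norm sum_distrib_left of_real_sum)
    finally have "qf n B ?w = (h k - c * x) * ?N" by (simp add: qf_def)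
    then have "\<bar>h k - c * x\<bar> * ?N \<le> M * ?N"
      using qB[of ?w] by (simp add: abs_mult sum_nonneg)
    moreover have "?N > 0"
      by (rule sum_pos2[of _ i]) (simp_all add: i)
    ultimately show ?thesis by simp
  qed
  \<comment> \<open>If a column of \<open>V\<close> met two different values of \<open>a\<close>,
    then \<open>h k\<close> would be within \<open>M\<close> of both \<open>c * a i\<close> and
    \<open>c * a j\<close>, against the choice of \<open>c\<close>.\<close>
  have uniq: "a i = a j" if "k < n" "i < n" "V $$ (i, k) \<noteq> 0" "j < n" "V $$ (j, k) \<noteq> 0" for i j k
  proof (rule ccontr)
    assume ne: "a i \<noteq> a j"
    have c0: "c \<ge> 0" unfolding c_def using M0 by (intro sum_nonneg) auto
    have "c * \<bar>a i - a j\<bar> = \<bar>c * (a i - a j)\<bar>" using c0 by (simp only: abs_mult abs_of_nonneg)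
    also have "\<dots> = \<bar>c * a i - c * a j\<bar>" by (simp only: right_diff_distrib)
    also have "\<dots> = \<bar>(h k - c * a j) - (h k - c * a i)\<bar>" by simp
    also have "\<dots> \<le> 2 * M"
      using loc[OF that(1,2,3) refl] loc[OF that(1,4,5) refl] by linarith
    finally show False using c[OF that(2,4) ne] by simp
  qed
  have ex: "\<exists>i<n. V $$ (i, k) \<noteq> 0" if "k < n" for k
  proof (rule ccontr)
    assume "\<not> ?thesis"
    then have "(\<Sum>i<n. (cmod (V $$ (i, k)))\<^sup>2) = 0" by (intro sum.neutral) auto
    then show False using unitary_stoch(1)[OF V that] by simp
  qed
  \<comment> \<open>The value of \<open>a\<close> at some nonzero entry of column \<open>k\<close>;
    by \<open>uniq\<close> every such entry gives the same value.\<close>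
  define a' where "a' k = a (SOME i. i < n \<and> V $$ (i, k) \<noteq> 0)" for k
  have a'1: "a' k \<in> a ` {..<n}" if "k < n" for k
    using someI_ex[OF ex[OF that]] by (auto simp: a'_def)
  have a'2: "a i = a' k" if "k < n" "i < n" "V $$ (i, k) \<noteq> 0" for i k
    using someI_ex[OF ex[OF that(1)]] uniq[OF that] unfolding a'_def by auto
  have A: "dg n a = ud n V a'"
  proof (rule ud_eqI[OF V])
    fix i k assume ik: "i < n" "k < n"
    have "(\<Sum>j<n. dg n a $$ (i, j) * V $$ (j, k)) = complex_of_real (a i) * V $$ (i, k)"
      using ik by (simp add: dg_idx if_distrib[where f = "\<lambda>x. x * _"] cong: if_cong)
    then show "(\<Sum>j<n. dg n a $$ (i, j) * V $$ (j, k)) = complex_of_real (a' k) * V $$ (i, k)"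
      using a'2[OF ik(2,1)] by auto
  qed auto
  have "B = ud n V (\<lambda>k. h k - c * a' k)"
  proof (rule ud_eqI[OF V Bc])
    fix i k assume ik: "i < n" "k < n"
    show "(\<Sum>j<n. B $$ (i, j) * V $$ (j, k)) = complex_of_real (h k - c * a' k) * V $$ (i, k)"
      using BV[OF ik] a'2[OF ik(2,1)] by (cases "V $$ (i, k) = 0") auto
  qed
  then show ?thesis using V A a'1 by blast
qed

text \<open>Conjugation by \<open>U\<close> makes the first matrix diagonal, and commuting then
  means that the second has no entries between different eigenvalues.\<close>

lemma simultaneous_diag:
  assumes U: "unitary_mat n U" and A: "A = ud n U a" and B: "hermitian_mat n B" and comm: "A * B = B * A"
  shows "\<exists>V a' b. unitary_mat n V \<and> A = ud n V a' \<and> B = ud n V b \<and> (\<forall>k<n. a' k \<in> a ` {..<n})"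
proof -
  note u = unitaryD[OF U]
  have Bc: "B \<in> sq n" using hermD(1)[OF B] .
  define B1 where "B1 = mat_adjoint U * B * U"
  have B1: "hermitian_mat n B1" using herm_conj[OF B, of "mat_adjoint U"] u by (simp add: B1_def)
  have B1c: "B1 \<in> sq n" using hermD(1)[OF B1] .
  have A1: "mat_adjoint U * A * U = dg n a" unfolding A by (rule ud_diag[OF U])
  have Ac: "A \<in> sq n" using u A by auto
  have "dg n a * B1 = mat_adjoint U * A * (U * mat_adjoint U) * B * U"
    unfolding A1[symmetric] B1_def using u(1) Ac Bc by (simp add: sq_assoc[of _ n])
  also have "\<dots> = mat_adjoint U * (A * B) * U" using u Ac Bc by (simp add: sq_assoc[of _ n])
  also have "\<dots> = mat_adjoint U * B * (U * mat_adjoint U) * A * U"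
    unfolding comm using u Ac Bc by (simp add: sq_assoc[of _ n])
  also have "\<dots> = B1 * dg n a"
    unfolding A1[symmetric] B1_def using u(1) Ac Bc by (simp add: sq_assoc[of _ n])
  finally have c1: "dg n a * B1 = B1 * dg n a" .
  have "B1 $$ (i, j) = 0" if "i < n" "j < n" "a i \<noteq> a j" for i j
  proof -
    have "complex_of_real (a i) * B1 $$ (i, j) = B1 $$ (i, j) * complex_of_real (a j)"
      using arg_cong[OF c1, of "\<lambda>M. M $$ (i, j)"] that B1c
      by (simp add: dg_left_idx[of _ n] dg_right_idx[of _ n] del: index_mult_mat)
    then show ?thesis using that by (auto simp: mult.commute)
  qed
  from simultaneous_diag_dg[OF B1 this] obtain V a' b where
    V: "unitary_mat n V" "dg n a = ud n V a'" "B1 = ud n V b" "\<forall>k<n. a' k \<in> a ` {..<n}" by blast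
  have "A = ud n (U * V) a'" using ud_unconj[OF U unitaryD(1)[OF V(1)] Ac] A1 V by simp
  moreover have "B = ud n (U * V) b" using ud_unconj[OF U unitaryD(1)[OF V(1)] Bc] B1_def V by simp
  ultimately show ?thesis using unitary_mult[OF U V(1)] V(4) by blast
qed

subsection \<open>Pinching\<close>

text \<open>The pinching by the eigenspaces of \<open>dg n a\<close>, that is, the sum of
  \<open>P * X * P\<close> over its spectral projections \<open>P\<close>.\<close>

definition pinch :: "nat \<Rightarrow> (nat \<Rightarrow> real) \<Rightarrow> complex mat \<Rightarrow> complex mat" where
  "pinch n a X = mat n n (\<lambda>(i, j). if a i = a j then X $$ (i, j) else 0)"

lemma pinch_carrier [simp]: "pinch n a X \<in> sq n" by (simp add: pinch_def)

lemma pinch_idx: "i < n \<Longrightarrow> j < n \<Longrightarrow> pinch n a X $$ (i, j) = (if a i = a j then X $$ (i, j) else 0)"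
  by (simp add: pinch_def)

text \<open>Orthogonality of the characters of the cyclic group of order \<open>N\<close>: a
  geometric sum whose ratio is an N-th root of unity, different from 1 for distinct \<open>x\<close>
  and \<open>y\<close> because their distance is less than \<open>N\<close>.\<close>

lemma sum_cis_orth:
  fixes x y N :: nat
  assumes "x < N" "y < N"
  shows "(\<Sum>t<N. cis (2 * pi * real t * real x / real N) * cnj (cis (2 * pi * real t * real y / real N)))
    = (if x = y then of_nat N else 0)"
proof -
  define z where "z = cis (2 * pi * (real x - real y) / real N)"
  have N: "real N > 0" using assms by simp
  have "cis (2 * pi * real t * real x / real N) * cnj (cis (2 * pi * real t * real y / real N)) = z ^ t" for t
    by (simp add: z_def cis_cnj cis_mult Complex.DeMoivre field_simps diff_divide_distrib)
  then have s: "(\<Sum>t<N. cis (2 * pi * real t * real x / real N) * cnj (cis (2 * pi * real t * real y / real N))) = (\<Sum>t<N. z ^ t)"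
    by simp
  show ?thesis
  proof (cases "x = y")
    case True
    then show ?thesis unfolding s by (simp add: z_def)
  next
    case False
    have "z \<noteq> 1"
    proof
      assume "z = 1"
      then have "cos (2 * pi * (real x - real y) / real N) = 1" by (simp add: z_def complex_eq_iff)
      then obtain m :: int where "2 * pi * (real x - real y) / real N = real_of_int m * 2 * pi"
        using cos_one_2pi_int by blast
      then have "(2 * pi) * (real x - real y) = (2 * pi) * (real_of_int m * real N)" using N by (simp add: field_simps)
      then have "real x - real y = real_of_int m * real N" by (simp only: mult_cancel_left) simp
      then have eq: "int x - int y = m * int N" 
        by (metis of_int_diff of_int_eq_iff of_int_mult of_int_of_nat_eq)
      have "m \<noteq> 0" using eq False by auto
      then have "1 * int N \<le> \<bar>m\<bar> * \<bar>int N\<bar>" by (intro mult_mono) auto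
      then have "\<bar>m * int N\<bar> \<ge> int N" by (simp add: abs_mult)
      then show False using eq assms by linarith
    qed
    moreover have "z ^ N = 1"
    proof -
      have "z ^ N = cis (2 * pi * (real_of_int (int x - int y)))" using N by (simp add: z_def Complex.DeMoivre)
      then show ?thesis using cis_multiple_2pi[of "real_of_int (int x - int y)"] by simp
    qed
    ultimately show ?thesis unfolding s using False geometric_sum[of z N] by simp
  qed
qed

text \<open>With the distinct eigenvalues numbered by \<open>g\<close>, the unitary
  \<open>W t\<close> multiplies the eigenspace of number x by the phase of angle
  \<open>2 * pi * t * x / N\<close>. Averaging over t erases exactly the entries between different
  eigenspaces. That \<open>W 0\<close> is the identity is recorded for the pinching
  inequality.\<close>

lemma pinch_avg:
  assumes n: "1 \<le> n"
  obtains N W where "N = card (a ` {..<n})" "1 \<le> N" "\<And>t. unitary_mat n (W t)" "W 0 = 1\<^sub>m n"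
    "\<And>t d. W t * dg n d * mat_adjoint (W t) = dg n d"
    "\<And>X. X \<in> sq n \<Longrightarrow> pinch n a X = avg n N (\<lambda>t. W t * X * mat_adjoint (W t))"
proof -
  let ?N = "card (a ` {..<n})"
  have fin: "finite (a ` {..<n})" by simp
  have "0 \<in> {..<n}" using n by simp
  then have ne: "{..<n} \<noteq> {}" by blast
  have N: "1 \<le> ?N" using ne by (simp add: Suc_le_eq card_gt_0_iff)
  obtain g where g: "bij_betw g (a ` {..<n}) {..<?N}"
    using ex_bij_betw_finite_nat[OF fin] by (auto simp: lessThan_atLeast0)
  define th where "th t i = cis (2 * pi * real t * real (g (a i)) / real ?N)" for t i
  define W where "W t = mat_diag n (th t)" for t
  have Wc: "W t \<in> sq n" for t by (simp add: W_def)
  have Wi: "W t $$ (i, j) = (if i = j then th t i else 0)" if "i < n" "j < n" for t i j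
    using that by (simp add: W_def mat_diag_def)
  have thn: "th t i * cnj (th t i) = 1" for t i
    by (simp add: th_def complex_norm_square[symmetric])
  have adjW: "mat_adjoint (W t) = mat_diag n (\<lambda>i. cnj (th t i))" for t
    by (rule sq_eqI[of _ n]) (auto simp: adj_idx[OF Wc] Wi mat_diag_def Wc)
  have WX: "(W t * X * mat_adjoint (W t)) $$ (i, j) = th t i * X $$ (i, j) * cnj (th t j)" 
    if "X \<in> sq n" "i < n" "j < n" for t X i j
    using that unfolding adjW by (simp add: W_def mat_diag_mult_left[of _ n n] mat_diag_mult_right[of _ n n])
  have "unitary_mat n (W t)" for t
  proof (rule unitaryI[OF Wc])
    have "mat_adjoint (W t) * W t = mat_diag n (\<lambda>i. th t i * cnj (th t i))"
      unfolding adjW unfolding W_def by (simp add: mult.commute)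
    then show "mat_adjoint (W t) * W t = 1\<^sub>m n" by (simp only: thn mat_diag_one)
  qed
  moreover have "W 0 = 1\<^sub>m n" by (rule sq_eqI[of _ n]) (auto simp: Wc Wi th_def)
  moreover have "W t * dg n d * mat_adjoint (W t) = dg n d" for t d
  proof (rule sq_eqI[of _ n])
    fix i j assume ij: "i < n" "j < n"
    have "th t i * complex_of_real (d i) * cnj (th t i) = complex_of_real (d i)"
    proof -
      have "th t i * complex_of_real (d i) * cnj (th t i) = complex_of_real (d i) * (th t i * cnj (th t i))"
        by (simp only: mult_ac)
      then show ?thesis by (simp only: thn mult_1_right)
    qed
    then show "(W t * dg n d * mat_adjoint (W t)) $$ (i, j) = dg n d $$ (i, j)"
      using ij by (auto simp add: WX dg_idx simp del: index_mult_mat mult_eq_0_iff mult_cancel_right1 mult_cancel_left1)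
  qed (intro sq_mult adj_carrier dg_carrier Wc)+
  moreover have "pinch n a X = avg n ?N (\<lambda>t. W t * X * mat_adjoint (W t))" if X: "X \<in> sq n" for X
  proof (rule sq_eqI[of _ n])
    fix i j assume ij: "i < n" "j < n"
    have gl: "g (a i) < ?N" "g (a j) < ?N" using g ij by (auto simp: bij_betw_def)
    have gi: "g (a i) = g (a j) \<longleftrightarrow> a i = a j" using g ij by (auto simp: bij_betw_def inj_on_def)
    have "(\<Sum>t<?N. th t i * X $$ (i, j) * cnj (th t j)) = X $$ (i, j) * (\<Sum>t<?N. th t i * cnj (th t j))"
      by (simp add: sum_distrib_left algebra_simps)
    also have "(\<Sum>t<?N. th t i * cnj (th t j)) = (if a i = a j then of_nat ?N else 0)"
      using sum_cis_orth[OF gl] by (simp only: th_def gi)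
    finally have s: "(\<Sum>t<?N. th t i * X $$ (i, j) * cnj (th t j)) = X $$ (i, j) * (if a i = a j then of_nat ?N else 0)" .
    have N0: "complex_of_nat ?N \<noteq> 0" using N by (metis of_nat_eq_0_iff not_one_le_zero)
    have "avg n ?N (\<lambda>t. W t * X * mat_adjoint (W t)) $$ (i, j) = X $$ (i, j) * (if a i = a j then of_nat ?N else 0) / of_nat ?N"
      by (simp only: avg_idx[OF ij] WX[OF X ij] s)
    also have "\<dots> = pinch n a X $$ (i, j)"
      unfolding pinch_idx[OF ij] using N0 by (cases "a i = a j") (simp_all del: card_eq_0_iff)
    finally show "pinch n a X $$ (i, j) = avg n ?N (\<lambda>t. W t * X * mat_adjoint (W t)) $$ (i, j)" by (rule sym)
  qed (rule pinch_carrier avg_carrier)+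
  ultimately show ?thesis by (intro that[of ?N W, OF refl N])
qed

lemma qf_avg: "(\<And>t. t < N \<Longrightarrow> F t \<in> sq n) \<Longrightarrow> qf n (avg n N F) v = (\<Sum>t<N. qf n (F t) v) / real N"
proof -
  assume F: "\<And>t. t < N \<Longrightarrow> F t \<in> sq n"
  have "(\<Sum>i<n. \<Sum>j<n. cnj (v i) * avg n N F $$ (i, j) * v j) =
    (\<Sum>i<n. \<Sum>j<n. \<Sum>t<N. cnj (v i) * F t $$ (i, j) * v j / of_nat N)"
    by (simp add: avg_idx sum_distrib_left sum_distrib_right sum_divide_distrib algebra_simps)
  also have "\<dots> = (\<Sum>t<N. \<Sum>i<n. \<Sum>j<n. cnj (v i) * F t $$ (i, j) * v j / of_nat N)"
    by (rule sum_swap3)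
  also have "\<dots> = (\<Sum>t<N. \<Sum>i<n. \<Sum>j<n. cnj (v i) * F t $$ (i, j) * v j) / of_nat N"
    by (simp only: sum_divide_distrib)
  finally show ?thesis by (simp add: qf_def)
qed

text \<open>The second claim is the pinching inequality: among the \<open>N\<close> positive terms
  of the average, the one for t = 0 is \<open>X\<close> itself.\<close>

lemma pinch_psd:
  assumes n: "1 \<le> n" and X: "psd_mat n X"
  shows "psd_mat n (pinch n a X)" "qf n X v \<le> real (card (a ` {..<n})) * qf n (pinch n a X) v"
proof -
  obtain N W where N: "N = card (a ` {..<n})" "1 \<le> N" and W: "\<And>t. unitary_mat n (W t)" and W0: "W 0 = 1\<^sub>m n"
    and "\<And>t d. W t * dg n d * mat_adjoint (W t) = dg n d"
    and P: "\<And>X. X \<in> sq n \<Longrightarrow> pinch n a X = avg n N (\<lambda>t. W t * X * mat_adjoint (W t))"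
    by (rule pinch_avg[OF n, of a]) (rule that)
  have p: "psd_mat n (W t * X * mat_adjoint (W t))" for t
    using psd_conj[OF X unitaryD(1)[OF W]] .
  have q: "qf n (pinch n a X) v = (\<Sum>t<N. qf n (W t * X * mat_adjoint (W t)) v) / real N" for v
    unfolding P[OF psd_sq[OF X]] using p by (intro qf_avg) auto
  have q0: "qf n (pinch n a X) v \<ge> 0" for v
    unfolding q using p by (auto simp: psd_iff intro!: divide_nonneg_nonneg sum_nonneg)
  have "hermitian_mat n (pinch n a X)"
    unfolding hermitian_mat_def
    using herm_idx[OF psd_herm[OF X]] by (auto intro!: sq_eqI[of _ n] simp: adj_idx[of _ n] pinch_idx)
  then show "psd_mat n (pinch n a X)" using q0 by (simp add: psd_iff)
  have "qf n X v = qf n (W 0 * X * mat_adjoint (W 0)) v" using W0 X by simp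
  also have "\<dots> \<le> (\<Sum>t<N. qf n (W t * X * mat_adjoint (W t)) v)"
    using N p by (intro member_le_sum) (auto simp: psd_iff)
  finally show "qf n X v \<le> real (card (a ` {..<n})) * qf n (pinch n a X) v"
    unfolding q N(1)[symmetric] using N(2) by simp
qed

text \<open>For \<open>Y = X^(1/2) * P\<close> the two Gram matrices are \<open>P * X * P\<close>
  and \<open>X^(1/2) * P * X^(1/2)\<close>. Their powers have equal traces, and the second is at
  most \<open>X\<close>.\<close>

lemma tr_powr_compress:
  assumes X: "psd_mat n X" and P: "hermitian_mat n P" "P * P = P" and r: "0 < r"
  shows "tr (mat_powr (P * X * P) r) \<le> tr (mat_powr X r)"
proof -
  let ?h = "mat_powr X (1/2)"
  have h: "psd_mat n ?h" using mat_powr_psd[OF X] .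
  have hh: "?h * ?h = X" using mat_powr_add[OF X, of "1/2" "1/2"] mat_powr_one[OF X] by simp
  have hc: "?h \<in> sq n" "mat_adjoint ?h = ?h" using h psd_herm[OF h] hermD(2) by auto
  have Pc: "P \<in> sq n" "mat_adjoint P = P" using P hermD by auto
  define Y where "Y = ?h * P"
  have Y: "Y \<in> sq n" using hc Pc by (simp add: Y_def)
  have Ya: "mat_adjoint Y = P * ?h" using hc Pc by (simp add: Y_def adj_mult[of _ n])
  have "mat_adjoint Y * Y = P * (?h * ?h) * P" unfolding Ya unfolding Y_def using hc Pc by (simp add: sq_assoc[of _ n])
  then have 1: "mat_adjoint Y * Y = P * X * P" by (simp add: hh)
  have "Y * mat_adjoint Y = ?h * (P * P) * ?h" unfolding Ya unfolding Y_def using hc Pc by (simp add: sq_assoc[of _ n])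
  then have 2: "Y * mat_adjoint Y = ?h * P * ?h" by (simp add: P)
  obtain U d where U: "unitary_mat n U" and Pd: "P = ud n U d" using spectral_theorem[OF P(1)] by blast
  have "d i \<le> 1" if i: "i < n" for i
  proof -
    have "ud n U (\<lambda>i. d i * d i) = ud n U d" using P(2) by (simp add: Pd ud_mult[OF U])
    then have "d i * d i = d i" using qf_ud_col[OF U i, of "\<lambda>i. d i * d i"] qf_ud_col[OF U i, of d] by simp
    then show ?thesis by (auto simp: mult_cancel_left2)
  qed
  then have P1: "qf n P w \<le> qf n (1\<^sub>m n) w" for w
    using qf_ud_le_one[OF U, of d 1 w] by (simp add: Pd qf_one)
  have "qf n (Y * mat_adjoint Y) v \<le> qf n X v" for v
  proof -
    have "qf n (?h * P * ?h) v \<le> qf n (?h * 1\<^sub>m n * ?h) v"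
      using qf_conj[of P n ?h v] qf_conj[of "1\<^sub>m n" n ?h v] P1 hc Pc by simp
    then show ?thesis using hc hh 2 by simp
  qed
  then have "tr (mat_powr (Y * mat_adjoint Y) r) \<le> tr (mat_powr X r)"
    using psd_gram(1)[OF Y] X r by (intro tr_powr_mono) auto
  then show ?thesis using tr_powr_gram[OF Y, of r] by (simp add: 1)
qed

text \<open>The pinched matrix is the direct sum of the compressions \<open>P x * X * P x\<close>,
  one for each distinct eigenvalue, and \<open>tr_powr_compress\<close> bounds each of them. The
  argument covers every positive exponent, on either side of 1.\<close>

lemma tr_powr_pinch:
  assumes n: "1 \<le> n" and X: "psd_mat n X" and r: "0 < r"
  shows "tr (mat_powr (pinch n a X) r) \<le> real (card (a ` {..<n})) * tr (mat_powr X r)"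
proof -
  note pp = pinch_psd(1)[OF n X, of a]
  obtain V a' d where V: "unitary_mat n V" and Va: "dg n a = ud n V a'" and Vd: "pinch n a X = ud n V d"
    and a': "\<And>k. k < n \<Longrightarrow> a' k \<in> a ` {..<n}"
    using simultaneous_diag_dg[OF psd_herm[OF pp], of a] by (auto simp: pinch_idx)
  define P where "P x = dg n (\<lambda>i. if a i = x then 1 else 0)" for x
  \<comment> \<open>\<open>P x\<close> is a function of \<open>dg n a\<close>, so it is diagonal in
    the common eigenbasis \<open>V\<close> as well.\<close>
  have P: "P x = ud n V (\<lambda>i. if a' i = x then 1 else 0)" for x
  proof -
    have "mat_fun (\<lambda>y. if y = x then 1 else 0) (dg n a) = P x"
      by (simp add: dg_as_ud mat_fun_ud P_def comp_def)
    then show ?thesis unfolding Va by (simp add: mat_fun_ud[OF V] comp_def)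
  qed
  have PXP: "P x * X * P x = ud n V (\<lambda>i. if a' i = x then d i else 0)" for x
  proof -
    have "P x * X * P x = P x * pinch n a X * P x"
      using X by (intro sq_eqI[of _ n])
       (auto simp: P_def dg_left_idx[of _ n] dg_right_idx[of _ n] pinch_idx simp del: index_mult_mat)
    also have "\<dots> = ud n V (\<lambda>i. if a' i = x then d i else 0)"
      unfolding P Vd by (simp add: ud_mult[OF V] if_distrib[where f = "\<lambda>x. x * _"] if_distrib[where f = "\<lambda>x. _ * x"] cong: if_cong)
    finally show ?thesis .
  qed
  have "tr (mat_powr (pinch n a X) r) = (\<Sum>i<n. d i powr r)"
    by (simp add: Vd mat_powr_ud[OF V] tr_ud[OF V])
  also have "\<dots> = (\<Sum>i<n. \<Sum>x\<in>a ` {..<n}. if a' i = x then d i powr r else 0)"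
    using a' by (intro sum.cong) auto
  also have "\<dots> = (\<Sum>x\<in>a ` {..<n}. \<Sum>i<n. if a' i = x then d i powr r else 0)" by (rule sum.swap)
  also have "\<dots> = (\<Sum>x\<in>a ` {..<n}. tr (mat_powr (P x * X * P x) r))"
    unfolding PXP by (simp add: mat_powr_ud[OF V] tr_ud[OF V] if_distrib[where f = "\<lambda>x. x powr _"] cong: if_cong)
  also have "\<dots> \<le> (\<Sum>x\<in>a ` {..<n}. tr (mat_powr X r))"
  proof (rule sum_mono)
    fix x
    have "hermitian_mat n (P x)" "P x * P x = P x" by (auto simp: P_def dg_as_ud ud_mult if_distrib cong: if_cong)
    then show "tr (mat_powr (P x * X * P x) r) \<le> tr (mat_powr X r)" by (rule tr_powr_compress[OF X _ _ r])
  qed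
  finally show ?thesis by simp
qed

lemma smult_powr: 
  assumes X: "psd_mat n X" and c: "0 \<le> c"
  shows "mat_powr (complex_of_real c \<cdot>\<^sub>m X) r = complex_of_real (c powr r) \<cdot>\<^sub>m mat_powr X r"
proof -
  obtain U d where U: "unitary_mat n U" "\<And>i. 0 \<le> d i" "X = ud n U d" using psd_spectral[OF X] by blast
  then show ?thesis using c by (simp add: ud_smult[OF unitaryD(1)[OF U(1)]] mat_powr_ud[OF U(1)] powr_mult)
qed

lemma tr_smult: "X \<in> sq n \<Longrightarrow> tr (complex_of_real c \<cdot>\<^sub>m X) = c * tr X"
  by (simp add: tr_idx[of _ n] sum_distrib_left)

text \<open>The opposite estimate, for the convex case. It applies monotonicity of the trace of
  powers to the pinching inequality, so the factor is raised to the power \<open>r\<close>.\<close>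

lemma tr_powr_le_pinch:
  assumes n: "1 \<le> n" and X: "psd_mat n X" and r: "0 < r"
  shows "tr (mat_powr X r) \<le> real (card (a ` {..<n})) powr r * tr (mat_powr (pinch n a X) r)"
proof -
  let ?N = "real (card (a ` {..<n}))"
  note p = pinch_psd[OF n X, where a = a]
  have "tr (mat_powr X r) \<le> tr (mat_powr (complex_of_real ?N \<cdot>\<^sub>m pinch n a X) r)"
    using p(2) qf_smult[OF psd_sq[OF p(1)], of ?N] by (intro tr_powr_mono[OF X psd_smult[OF p(1)] r]) simp_all
  also have "\<dots> = ?N powr r * tr (mat_powr (pinch n a X) r)"
    using smult_powr[OF p(1), of ?N r] tr_smult[OF psd_sq[OF mat_powr_psd[OF p(1)]]] by simp
  finally show ?thesis .
qed

subsection \<open>Comparison with the minimal quantity: single copy\<close>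

text \<open>At this exponent \<open>B\<close> enters with the power 1. The expression under the
  outer power is linear in \<open>B\<close>, which is why a pinching of \<open>B\<close> can be
  moved outside.\<close>

lemma R_mean_eq:
  assumes A: "psd_mat n A" and B: "psd_mat n B" and a: "0 < \<alpha>"
  shows "qmean R \<alpha> (1 / \<alpha>) A B = mat_powr (mat_powr A ((1 - \<alpha>) / (2 * \<alpha>)) * B * mat_powr A ((1 - \<alpha>) / (2 * \<alpha>))) \<alpha>"
  using a mat_powr_one[OF B] by (simp add: R_mean_def)

lemma compare_R_dg:
  assumes jc: "jconc \<sigma> k \<alpha> p" and s: "\<sigma> = 1 \<or> \<sigma> = -1" and n: "1 \<le> n" and p: "0 < p" and al: "0 < \<alpha>"
    and a: "\<And>i. 0 < a i" and B: "pd n B"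
  defines "v \<equiv> real (card (a ` {..<n}))"
  shows "(\<sigma> = 1 \<longrightarrow> tr_qmean k \<alpha> p (dg n a) B \<le> v * tr_qmean R \<alpha> (1 / \<alpha>) (dg n a) B) \<and>
    (\<sigma> = -1 \<longrightarrow> tr_qmean R \<alpha> (1 / \<alpha>) (dg n a) B \<le> v powr \<alpha> * tr_qmean k \<alpha> p (dg n a) B)"
proof -
  let ?A = "dg n a"
  have A: "pd n ?A" using a by (simp add: dg_as_ud pdI)
  obtain N W where N: "N = card (a ` {..<n})" "1 \<le> N" and W: "\<And>t. unitary_mat n (W t)" and "W 0 = 1\<^sub>m n"
    and WA: "\<And>t d. W t * dg n d * mat_adjoint (W t) = dg n d"
    and P: "\<And>X. X \<in> sq n \<Longrightarrow> pinch n a X = avg n N (\<lambda>t. W t * X * mat_adjoint (W t))"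
    by (rule pinch_avg[OF n, of a]) (rule that)
  let ?B' = "pinch n a B"
  have B': "psd_mat n ?B'" using pinch_psd(1)[OF n pd_psd[OF B]] .
  \<comment> \<open>The unitaries fix \<open>A\<close>, so by unitary invariance all
    \<open>N\<close> pairs have the same trace, while their average is \<open>A\<close> paired with
    the pinched \<open>B\<close>.\<close>
  have "(\<Sum>i<N. tr_qmean k \<alpha> p ?A (W i * B * mat_adjoint (W i))) / real N = tr_qmean k \<alpha> p ?A B"
  proof -
    have "tr_qmean k \<alpha> p ?A (W i * B * mat_adjoint (W i)) = tr_qmean k \<alpha> p ?A B" for i
      using tr_qmean_conj[OF W[of i] A B, of k \<alpha> p] by (simp only: WA)
    then show ?thesis using N(2) by simp
  qed
  moreover have "avg n N (\<lambda>_. ?A) = ?A" 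
    using N(2) by (intro sq_eqI[of _ n]) (auto simp: avg_idx)
  moreover have "(?A, W i * B * mat_adjoint (W i)) \<in> qmean_dom k \<alpha> n" for i
    using pd_psd[OF pd_unitary_conj[OF W B]] by (intro dom_pd A)
  ultimately have 1: "\<sigma> * tr_qmean k \<alpha> p ?A B \<le> \<sigma> * tr_qmean k \<alpha> p ?A ?B'"
    using jensen[OF jc n N(2), of "\<lambda>_. ?A" "\<lambda>t. W t * B * mat_adjoint (W t)"] P[OF pd_sq[OF B]] by simp
  obtain V a' b where V: "unitary_mat n V" and Va: "?A = ud n V a'" and Vb: "?B' = ud n V b"
    and a': "\<And>k. k < n \<Longrightarrow> a' k \<in> a ` {..<n}"
    using simultaneous_diag_dg[OF psd_herm[OF B'], of a] by (auto simp: pinch_idx)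
  have b0: "b i \<ge> 0" if "i < n" for i
    using B' qf_ud_col[OF V that, of b] unfolding Vb psd_iff by metis
  have a0: "a' i > 0" if "i < n" for i using a'[OF that] a by auto
  \<comment> \<open>The pinched pair commutes, so its trace depends neither on the kind nor on the
    exponent.\<close>
  have "tr_qmean k' \<alpha> p' ?A ?B' = (\<Sum>i<n. max 0 (a' i) powr (1 - \<alpha>) * max 0 (b i) powr \<alpha>)"
    if "0 < p'" for k' p'
  proof -
    have eA: "?A = ud n V (\<lambda>i. max 0 (a' i))" unfolding Va using a0 by (intro ud_cong) (simp add: less_imp_le)
    have eB: "?B' = ud n V (\<lambda>i. max 0 (b i))" unfolding Vb using b0 by (intro ud_cong) simp
    have nz: "max 0 (a' i) \<noteq> 0" if "i < n" for i using a0[OF that] by simp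
    show ?thesis unfolding eA eB using nz that by (intro tr_qmean_ud[OF V]) auto
  qed
  then have 2: "tr_qmean k \<alpha> p ?A ?B' = tr_qmean R \<alpha> (1 / \<alpha>) ?A ?B'" using p al by simp
  let ?h = "dg n (\<lambda>i. a i powr ((1 - \<alpha>) / (2 * \<alpha>)))"
  define X where "X = ?h * B * ?h"
  have h: "mat_powr ?A ((1 - \<alpha>) / (2 * \<alpha>)) = ?h" by (simp add: dg_as_ud mat_powr_ud)
  have X: "psd_mat n X" using psd_conj[OF pd_psd[OF B], of ?h] by (simp add: X_def)
  \<comment> \<open>A diagonal factor rescales the entries one by one and so commutes with erasing
    some of them.\<close>
  have "?h * ?B' * ?h = pinch n a X"
    unfolding X_def using B
    by (intro sq_eqI[of _ n]) (auto simp: dg_left_idx[of _ n] dg_right_idx[of _ n] pinch_idx simp del: index_mult_mat)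
  then have 3: "tr_qmean R \<alpha> (1 / \<alpha>) ?A ?B' = tr (mat_powr (pinch n a X) \<alpha>)"
    unfolding tr_qmean_def R_mean_eq[OF pd_psd[OF A] B' al] h by simp
  have 4: "tr_qmean R \<alpha> (1 / \<alpha>) ?A B = tr (mat_powr X \<alpha>)"
    unfolding tr_qmean_def R_mean_eq[OF pd_psd[OF A] pd_psd[OF B] al] h X_def ..
  show ?thesis
  proof (intro conjI impI)
    assume "\<sigma> = 1"
    then show "tr_qmean k \<alpha> p ?A B \<le> v * tr_qmean R \<alpha> (1 / \<alpha>) ?A B"
      using 1 2 3 4 tr_powr_pinch[OF n X al, of a] by (simp add: v_def)
  next
    assume "\<sigma> = -1"
    then have "tr (mat_powr (pinch n a X) \<alpha>) \<le> tr_qmean k \<alpha> p ?A B" using 1 2 3 by simp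
    then have "v powr \<alpha> * tr (mat_powr (pinch n a X) \<alpha>) \<le> v powr \<alpha> * tr_qmean k \<alpha> p ?A B"
      by (intro mult_left_mono) auto
    then show "tr_qmean R \<alpha> (1 / \<alpha>) ?A B \<le> v powr \<alpha> * tr_qmean k \<alpha> p ?A B"
      using 4 tr_powr_le_pinch[OF n X al, of a] by (simp add: v_def)
  qed
qed

subsection \<open>Tensor powers\<close>

primrec kpow :: "complex mat \<Rightarrow> nat \<Rightarrow> complex mat" where
  "kpow A 0 = 1\<^sub>m 1"
| "kpow A (Suc m) = kron A (kpow A m)"

lemma pd_one: "pd n (1\<^sub>m n)"
  using pdI[OF unitary_one, of n "\<lambda>_. 1"] by (simp add: ud_one)

lemma kpow_pd: "pd n A \<Longrightarrow> pd (n ^ m) (kpow A m)"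
  by (induction m) (auto intro!: kron_pd pd_one)

lemma tr_qmean_kpow:
  assumes "pd n A" "pd n B" "0 < p"
  shows "tr_qmean k \<alpha> p (kpow A m) (kpow B m) = tr_qmean k \<alpha> p A B ^ m"
proof (induction m)
  case 0
  show ?case using tr_qmean_ud[OF unitary_one[of 1], of "\<lambda>_. 1" "\<lambda>_. 1" p k \<alpha>] assms(3)
    by (simp add: ud_one)
next
  case (Suc m)
  then show ?case using tr_qmean_kron[OF assms(1) kpow_pd[OF assms(1)] assms(2) kpow_pd[OF assms(2)]] by simp
qed

text \<open>The eigenvalues of the m-th tensor power of \<open>dg n a\<close>: read \<open>k\<close>
  in base \<open>n\<close> and multiply the values of \<open>a\<close> at its \<open>m\<close>
  digits.\<close>

primrec dpow :: "(nat \<Rightarrow> real) \<Rightarrow> nat \<Rightarrow> nat \<Rightarrow> nat \<Rightarrow> real" where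
  "dpow a n 0 = (\<lambda>_. 1)"
| "dpow a n (Suc m) = (\<lambda>k. a (k div n ^ m) * dpow a n m (k mod n ^ m))"

lemma kpow_dg: "kpow (dg n a) m = dg (n ^ m) (dpow a n m)"
  by (induction m) (simp_all add: kron_dg)

lemma dpow_pos: "(\<And>i. 0 < a i) \<Longrightarrow> 0 < dpow a n m k"
  by (induction m arbitrary: k) simp_all

text \<open>Only the multiplicities of the digits matter: \<open>e i\<close> counts how often the
  digit \<open>i\<close> occurs in \<open>k\<close>.\<close>

lemma dpow_monomial:
  "k < n ^ m \<Longrightarrow> \<exists>e. (\<forall>i<n. e i \<le> m) \<and> dpow a n m k = (\<Prod>i<n. a i ^ e i)"
proof (induction m arbitrary: k)
  case 0
  show ?case by (rule exI[of _ "\<lambda>_. 0"]) simp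
next
  case (Suc m)
  let ?l = "k div n ^ m"
  have l: "?l < n" "k mod n ^ m < n ^ m" using div_mod_less[of k n "n ^ m"] Suc.prems by auto
  from Suc.IH[OF l(2)] obtain e where e: "\<forall>i<n. e i \<le> m" "dpow a n m (k mod n ^ m) = (\<Prod>i<n. a i ^ e i)" by blast
  have "(\<Prod>i<n. a i ^ (e(?l := Suc (e ?l))) i) = a ?l * (\<Prod>i<n. a i ^ e i)"
    using l(1) by (simp add: prod.remove[of "{..<n}" ?l])
  then show ?case using e l by (intro exI[of _ "e(?l := Suc (e ?l))"]) (auto simp: le_SucI)
qed

text \<open>Each of the \<open>n\<close> multiplicities lies between 0 and \<open>m\<close>, so the
  \<open>n ^ m\<close> eigenvalues take only polynomially many values in \<open>m\<close>.\<close>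

lemma card_dpow: "card (dpow a n m ` {..<n ^ m}) \<le> (m + 1) ^ n"
proof -
  let ?E = "PiE {..<n} (\<lambda>_. {..m})"
  have "dpow a n m ` {..<n ^ m} \<subseteq> (\<lambda>e. \<Prod>i<n. a i ^ e i) ` ?E"
  proof
    fix y assume "y \<in> dpow a n m ` {..<n ^ m}"
    then obtain k where k: "k < n ^ m" "y = dpow a n m k" by blast
    then obtain e where e: "\<forall>i<n. e i \<le> m" "dpow a n m k = (\<Prod>i<n. a i ^ e i)"
      using dpow_monomial[of k n m a] by auto
    have "dpow a n m k = (\<Prod>i<n. a i ^ restrict e {..<n} i)" unfolding e(2) by (intro prod.cong) auto
    moreover have "restrict e {..<n} \<in> ?E" using e(1) by auto
    ultimately show "y \<in> (\<lambda>e. \<Prod>i<n. a i ^ e i) ` ?E" unfolding k(2) by blast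
  qed
  moreover have fin: "finite ?E" by (intro finite_PiE) auto
  ultimately have "card (dpow a n m ` {..<n ^ m}) \<le> card ?E"
    using surj_card_le[of ?E] by blast
  also have "card ?E = (m + 1) ^ n" by (simp add: card_PiE)
  finally show ?thesis .
qed

lemma root_limit:
  fixes x y :: real
  assumes x: "0 \<le> x" and y: "0 \<le> y" and N: "1 \<le> N" and le: "\<And>m. 1 \<le> m \<Longrightarrow> x ^ m \<le> real (m + 1) ^ N * y ^ m"
  shows "x \<le> y"
proof (rule ccontr)
  assume "\<not> x \<le> y"
  then have xy: "y < x" by simp
  have y0: "y > 0"
  proof (rule ccontr)
    assume "\<not> y > 0"
    then have "x \<le> 0" using le[of 1] y by simp
    then show False using xy y by simp
  qed
  \<comment> \<open>With this root, \<open>(m + 1) ^ N * (y / x) ^ m\<close> is the N-th power of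
    \<open>(m + 1) * z ^ m\<close>, so it is enough that \<open>m * z ^ m\<close> tends to
    0.\<close>
  define z where "z = root N (y / x)"
  have z: "0 < z" "z < 1" using xy y0 N by (auto simp: z_def)
  have zN: "z ^ N = y / x" using xy y0 N by (simp add: z_def)
  have "(\<lambda>m. of_nat m * z ^ m) \<longlonglongrightarrow> 0" using z by (intro powser_times_n_limit_0) simp
  \<comment> \<open>The bound 1/2 leaves room for \<open>m + 1 \<le> 2 * m\<close>.\<close>
  then have "eventually (\<lambda>m. of_nat m * z ^ m < 1 / 2) sequentially"
    by (rule order_tendstoD) simp
  then obtain m0 where m0: "\<And>m. m \<ge> m0 \<Longrightarrow> of_nat m * z ^ m < 1 / 2"
    by (auto simp: eventually_sequentially)
  define m where "m = max m0 1"
  have m: "1 \<le> m" "of_nat m * z ^ m < 1 / 2" using m0 by (auto simp: m_def)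
  have "real (m + 1) * z ^ m \<le> 2 * real m * z ^ m" using m z by (intro mult_right_mono) auto
  also have "\<dots> < 1" using m by simp
  finally have "(real (m + 1) * z ^ m) ^ N < 1" using z N by (intro power_less_one_iff[THEN iffD2]) auto
  then have "real (m + 1) ^ N * (y / x) ^ m < 1" by (simp add: power_mult_distrib zN[symmetric] mult.commute flip: power_mult)
  then have "real (m + 1) ^ N * y ^ m < x ^ m" using xy y0 by (simp add: power_divide field_simps)
  then show False using le[OF m(1)] by simp
qed

lemma tr_qmean_nonneg: "pd n A \<Longrightarrow> pd n B \<Longrightarrow> 0 \<le> tr_qmean k \<alpha> p A B"
  unfolding tr_qmean_def by (intro tr_psd_nonneg pd_psd qmean_pd)

text \<open>The loss in the single copy comparison grows only polynomially with the number of
  tensor factors, while both sides are multiplicative.\<close>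

lemma compare_R_pd_dg:
  assumes jc: "jconc \<sigma> k \<alpha> p" and s: "\<sigma> = 1 \<or> \<sigma> = -1" and n: "1 \<le> n" and p: "0 < p" and al: "0 < \<alpha>"
    and a: "\<And>i. 0 < a i" and B: "pd n B"
  shows "\<sigma> * tr_qmean k \<alpha> p (dg n a) B \<le> \<sigma> * tr_qmean R \<alpha> (1 / \<alpha>) (dg n a) B"
proof -
  let ?A = "dg n a"
  let ?x = "tr_qmean k \<alpha> p ?A B" and ?y = "tr_qmean R \<alpha> (1 / \<alpha>) ?A B"
  have A: "pd n ?A" using a by (simp add: dg_as_ud pdI)
  have x0: "?x \<ge> 0" and y0: "?y \<ge> 0" using A B by (auto intro: tr_qmean_nonneg)
  let ?v = "\<lambda>m. real (card (dpow a n m ` {..<n ^ m}))"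
  have v: "?v m \<le> real (m + 1) ^ n" for m
    using card_dpow[of a n m] by (metis of_nat_le_iff of_nat_power)
  have "0 < 1 / \<alpha>" using al by simp
  note k = tr_qmean_kpow[OF A B p, of k \<alpha>] tr_qmean_kpow[OF A B \<open>0 < 1 / \<alpha>\<close>, of R \<alpha>]
  have nm: "1 \<le> n ^ m" for m using n by simp
  have c: "(\<sigma> = 1 \<longrightarrow> ?x ^ m \<le> ?v m * ?y ^ m) \<and> (\<sigma> = -1 \<longrightarrow> ?y ^ m \<le> ?v m powr \<alpha> * ?x ^ m)" for m
    using compare_R_dg[where a = "dpow a n m", OF jc s nm[of m] p al dpow_pos[OF a] kpow_pd[OF B, of m]]
    unfolding kpow_dg[symmetric] k .
  from s show ?thesis
  proof
    assume s1: "\<sigma> = 1"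
    have "?x \<le> ?y"
    proof (rule root_limit[OF x0 y0 n])
      fix m :: nat
      have "?x ^ m \<le> ?v m * ?y ^ m" using c[of m] s1 by simp
      also have "\<dots> \<le> real (m + 1) ^ n * ?y ^ m" using v y0 by (intro mult_right_mono) auto
      finally show "?x ^ m \<le> real (m + 1) ^ n * ?y ^ m" .
    qed
    then show ?thesis using s1 by simp
  next
    assume s1: "\<sigma> = -1"
    \<comment> \<open>The factor \<open>v powr \<alpha>\<close> is at most \<open>(m + 1)\<close> to
      the power \<open>n * \<alpha>\<close>; rounding \<alpha> up gives the natural exponent
      required by \<open>root_limit\<close>.\<close>
    let ?N = "n * nat \<lceil>\<alpha>\<rceil>"
    have "?y \<le> ?x"
    proof (rule root_limit[OF y0 x0])
      show "1 \<le> ?N" using n al by (simp add: Suc_le_eq)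
      fix m :: nat
      have "?y ^ m \<le> ?v m powr \<alpha> * ?x ^ m" using c[of m] s1 by simp
      also have "?v m powr \<alpha> \<le> (real (m + 1) ^ n) powr \<alpha>" using v al by (intro powr_mono2) auto
      also have "\<dots> \<le> (real (m + 1) ^ n) powr real (nat \<lceil>\<alpha>\<rceil>)" 
        using n by (intro powr_mono) (auto simp: of_nat_ceiling intro!: one_le_power)
      also have "\<dots> = real (m + 1) ^ ?N" by (simp add: powr_realpow power_mult)
      finally show "?y ^ m \<le> real (m + 1) ^ ?N * ?x ^ m" using x0 by (simp add: mult_right_mono)
    qed
    then show ?thesis using s1 by simp
  qed
qed

lemma compare_R_pd:
  assumes jc: "jconc \<sigma> k \<alpha> p" and s: "\<sigma> = 1 \<or> \<sigma> = -1" and n: "1 \<le> n" and p: "0 < p" and al: "0 < \<alpha>"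
    and A: "pd n A" and B: "pd n B"
  shows "\<sigma> * tr_qmean k \<alpha> p A B \<le> \<sigma> * tr_qmean R \<alpha> (1 / \<alpha>) A B"
proof -
  obtain U a where U: "unitary_mat n U" and a: "\<And>i. 0 < a i" and Ae: "A = ud n U a" using pdE[OF A] by blast
  note u = unitaryD[OF U]
  have AU: "mat_adjoint U * A * U = dg n a" unfolding Ae by (rule ud_diag[OF U])
  have "pd n (mat_adjoint U * B * U)"
    using pd_unitary_conj[OF unitary_adj[OF U] B] u by (simp add: adj_adj[of _ n])
  from compare_R_pd_dg[where a = a, OF jc s n p al a this]
  show ?thesis
    using tr_qmean_conj[OF unitary_adj[OF U] A B] u by (simp add: adj_adj[of _ n] AU)
qed

subsection \<open>Limits of matrices\<close>

definition mlim :: "nat \<Rightarrow> (real \<Rightarrow> complex mat) \<Rightarrow> complex mat \<Rightarrow> bool" where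
  "mlim n F L \<longleftrightarrow> (\<forall>i<n. \<forall>j<n. ((\<lambda>t. F t $$ (i, j)) \<longlongrightarrow> L $$ (i, j)) (at_right 0))"

lemma mlim_ud:
  assumes "U \<in> sq n" "\<And>k. k < n \<Longrightarrow> ((\<lambda>t. d t k) \<longlongrightarrow> l k) (at_right 0)"
  shows "mlim n (\<lambda>t. ud n U (d t)) (ud n U l)"
  unfolding mlim_def
proof clarify
  fix i j assume "i < n" "j < n"
  then show "((\<lambda>t. ud n U (d t) $$ (i, j)) \<longlongrightarrow> ud n U l $$ (i, j)) (at_right 0)"
    unfolding ud_idx[OF assms(1) \<open>i < n\<close> \<open>j < n\<close>] using assms(2)
    by (intro tendsto_sum tendsto_mult tendsto_const tendsto_of_real) auto
qed

lemma mlim_mult: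
  assumes F: "\<And>t. F t \<in> sq n" "K \<in> sq n" "mlim n F K" and H: "\<And>t. H t \<in> sq n" "L \<in> sq n" "mlim n H L"
  shows "mlim n (\<lambda>t. F t * H t) (K * L)"
  unfolding mlim_def
proof clarify
  fix i j assume ij: "i < n" "j < n"
  show "((\<lambda>t. (F t * H t) $$ (i, j)) \<longlongrightarrow> (K * L) $$ (i, j)) (at_right 0)"
    unfolding mult_idx[OF F(1) H(1) ij] mult_idx[OF F(2) H(2) ij]
    using F(3) H(3) ij by (intro tendsto_sum tendsto_mult) (auto simp: mlim_def)
qed

lemma mlim_const: "mlim n (\<lambda>_. A) A"
  by (simp add: mlim_def)

lemma mlim_add:
  assumes "\<And>t. F t \<in> sq n" "K \<in> sq n" "mlim n F K" "\<And>t. H t \<in> sq n" "L \<in> sq n" "mlim n H L"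
  shows "mlim n (\<lambda>t. F t + H t) (K + L)"
  unfolding mlim_def
proof clarify
  fix i j assume ij: "i < n" "j < n"
  have e: "(X + Y) $$ (i, j) = X $$ (i, j) + Y $$ (i, j)" if "X \<in> sq n" "Y \<in> sq n" for X Y :: "complex mat"
    using that ij by auto
  show "((\<lambda>t. (F t + H t) $$ (i, j)) \<longlongrightarrow> (K + L) $$ (i, j)) (at_right 0)"
    unfolding e[OF assms(1,4)] e[OF assms(2,5)] using assms(3,6) ij by (intro tendsto_add) (auto simp: mlim_def)
qed

lemma mlim_smult:
  assumes "\<And>t. F t \<in> sq n" "K \<in> sq n" "mlim n F K" "(c \<longlongrightarrow> d) (at_right 0)"
  shows "mlim n (\<lambda>t. complex_of_real (c t) \<cdot>\<^sub>m F t) (complex_of_real d \<cdot>\<^sub>m K)"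
  unfolding mlim_def
proof clarify
  fix i j assume ij: "i < n" "j < n"
  have e: "(x \<cdot>\<^sub>m X) $$ (i, j) = x * X $$ (i, j)" if "X \<in> sq n" for X and x :: complex
    using that ij by auto
  show "((\<lambda>t. (complex_of_real (c t) \<cdot>\<^sub>m F t) $$ (i, j)) \<longlongrightarrow> (complex_of_real d \<cdot>\<^sub>m K) $$ (i, j)) (at_right 0)"
    unfolding e[OF assms(1)] e[OF assms(2)] using assms(3,4) ij
    by (intro tendsto_mult tendsto_of_real) (auto simp: mlim_def)
qed

lemma qf_tendsto:
  assumes "mlim n F L" shows "((\<lambda>t. qf n (F t) v) \<longlongrightarrow> qf n L v) (at_right 0)"
  unfolding qf_def using assms
  by (intro tendsto_Re tendsto_sum tendsto_mult tendsto_const) (auto simp: mlim_def)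

text \<open>A crude operator bound by the moduli of the entries; it converts entrywise convergence
  into an inequality of forms.\<close>

lemma qf_bound:
  "\<bar>qf n E v\<bar> \<le> (\<Sum>i<n. \<Sum>j<n. cmod (E $$ (i, j))) * (\<Sum>i<n. (cmod (v i))\<^sup>2)"
proof -
  let ?N = "\<Sum>i<n. (cmod (v i))\<^sup>2"
  have b: "cmod (v i) * cmod (v j) \<le> ?N" if "i < n" "j < n" for i j
  proof -
    have "(cmod (v i))\<^sup>2 \<le> ?N" "(cmod (v j))\<^sup>2 \<le> ?N"
      using that by (auto intro!: member_le_sum)
    moreover have "2 * (cmod (v i) * cmod (v j)) \<le> (cmod (v i))\<^sup>2 + (cmod (v j))\<^sup>2"
      using sum_squares_bound[of "cmod (v i)" "cmod (v j)"] by (simp add: mult.assoc)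
    ultimately show ?thesis by linarith
  qed
  have "\<bar>qf n E v\<bar> \<le> cmod (\<Sum>i<n. \<Sum>j<n. cnj (v i) * E $$ (i, j) * v j)"
    unfolding qf_def by (rule abs_Re_le_cmod)
  also have "\<dots> \<le> (\<Sum>i<n. \<Sum>j<n. cmod (E $$ (i, j)) * (cmod (v i) * cmod (v j)))"
    by (intro order_trans[OF norm_sum] sum_mono) (simp add: norm_mult mult_ac)
  also have "\<dots> \<le> (\<Sum>i<n. \<Sum>j<n. cmod (E $$ (i, j)) * ?N)"
    using b by (intro sum_mono mult_left_mono) auto
  also have "\<dots> = (\<Sum>i<n. \<Sum>j<n. cmod (E $$ (i, j))) * ?N"
    by (simp only: sum_distrib_right)
  finally show ?thesis .
qed

lemma qf_ud_shift:
  assumes U: "unitary_mat n U"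
  shows "qf n (ud n U (\<lambda>i. d i + e)) v = qf n (ud n U d) v + e * (\<Sum>i<n. (cmod (v i))\<^sup>2)"
  unfolding qf_ud[OF unitaryD(1)[OF U]] qf_unitary_norm[OF U, of v, symmetric]
  by (simp add: algebra_simps sum.distrib sum_distrib_left)

lemma ev_at_right: "eventually (\<lambda>t. 0 < t \<and> t < (1::real)) (at_right 0)"
  using eventually_at_right_real[of 0 1] by simp

text \<open>With \<open>e t\<close> the sum of the entrywise distances, the form of
  \<open>X t\<close> is at most that of \<open>L\<close> plus \<open>e t\<close> times the identity,
  so monotonicity of the trace of powers applies. This one-sided estimate works for every positive
  exponent.\<close>

lemma trace_powr_usc:
  assumes X: "\<And>t. 0 < t \<Longrightarrow> t < 1 \<Longrightarrow> psd_mat n (X t)" and L: "psd_mat n L" and lim: "mlim n X L" 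
    and r: "0 < r" and c: "\<And>t. 0 < t \<Longrightarrow> t < 1 \<Longrightarrow> c t \<le> tr (mat_powr (X t) r)" and cl: "(c \<longlongrightarrow> d) (at_right 0)"
  shows "d \<le> tr (mat_powr L r)"
proof -
  obtain U x where U: "unitary_mat n U" and x: "\<And>i. 0 \<le> x i" and Le: "L = ud n U x"
    using psd_spectral[OF L] by blast
  define e where "e t = (\<Sum>i<n. \<Sum>j<n. cmod (X t $$ (i, j) - L $$ (i, j)))" for t
  have e0: "e t \<ge> 0" for t unfolding e_def by (intro sum_nonneg) auto
  have el: "(e \<longlongrightarrow> (\<Sum>i<n. \<Sum>j<n. 0)) (at_right 0)"
    unfolding e_def using lim
    by (intro tendsto_sum tendsto_norm_zero) (auto simp: mlim_def LIM_zero_iff)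
  have le: "tr (mat_powr (X t) r) \<le> (\<Sum>i<n. (x i + e t) powr r)" if t: "0 < t" "t < 1" for t
  proof -
    have Xt: "psd_mat n (X t)" using X t by auto
    have "psd_mat n (ud n U (\<lambda>i. x i + e t))" using x e0 unitaryD(1)[OF U] by (intro psd_ud) auto
    moreover have "qf n (X t) v \<le> qf n (ud n U (\<lambda>i. x i + e t)) v" for v
    proof -
      have "qf n (X t - L) v \<le> (\<Sum>i<n. \<Sum>j<n. cmod ((X t - L) $$ (i, j))) * (\<Sum>i<n. (cmod (v i))\<^sup>2)"
        using qf_bound[of n "X t - L" v] by simp
      also have "(\<Sum>i<n. \<Sum>j<n. cmod ((X t - L) $$ (i, j))) = e t"
        unfolding e_def using psd_sq[OF L] by (intro sum.cong) auto
      finally show ?thesis unfolding qf_ud_shift[OF U] Le[symmetric]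
        using qf_minus[OF psd_sq[OF Xt] psd_sq[OF L], of v] by simp
    qed
    ultimately have "tr (mat_powr (X t) r) \<le> tr (mat_powr (ud n U (\<lambda>i. x i + e t)) r)"
      by (intro tr_powr_mono[OF Xt _ r])
    then show ?thesis by (simp add: mat_powr_ud[OF U] tr_ud[OF U])
  qed
  have "((\<lambda>t. \<Sum>i<n. (x i + e t) powr r) \<longlongrightarrow> (\<Sum>i<n. (x i + 0) powr r)) (at_right 0)"
  proof (rule tendsto_sum)
    fix i
    have "((\<lambda>t. x i + e t) \<longlongrightarrow> x i + 0) (at_right 0)" using el by (intro tendsto_add tendsto_const) simp
    then show "((\<lambda>t. (x i + e t) powr r) \<longlongrightarrow> (x i + 0) powr r) (at_right 0)"
      by (rule tendsto_powr'[OF _ tendsto_const]) (use r x e0 in \<open>auto intro!: always_eventually\<close>)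
  qed
  moreover have "eventually (\<lambda>t. c t \<le> (\<Sum>i<n. (x i + e t) powr r)) (at_right 0)"
    using ev_at_right
  proof eventually_elim
    case (elim t)
    then show ?case using order_trans[OF c le, of t] by blast
  qed
  ultimately have "d \<le> (\<Sum>i<n. (x i + 0) powr r)"
    using cl by (intro tendsto_le[of "at_right 0"]) (auto simp: trivial_limit_at_right_real)
  then show ?thesis by (simp add: Le mat_powr_ud[OF U] tr_ud[OF U])
qed

text \<open>Peierls' inequality in the eigenbasis of the limit: the diagonal entries of
  \<open>X t\<close> there converge to the eigenvalues of \<open>L\<close>. Convexity of the power
  is the reason for \<open>1 \<le> r\<close>.\<close>

lemma trace_powr_lsc:
  assumes X: "\<And>t. 0 < t \<Longrightarrow> t < 1 \<Longrightarrow> psd_mat n (X t)" and L: "psd_mat n L" and lim: "mlim n X L" 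
    and r: "1 \<le> r" and c: "\<And>t. 0 < t \<Longrightarrow> t < 1 \<Longrightarrow> tr (mat_powr (X t) r) \<le> c t" and cl: "(c \<longlongrightarrow> d) (at_right 0)"
  shows "tr (mat_powr L r) \<le> d"
proof -
  obtain U x where U: "unitary_mat n U" and x: "\<And>i. 0 \<le> x i" and Le: "L = ud n U x"
    using psd_spectral[OF L] by blast
  let ?q = "\<lambda>t i. qf n (X t) (\<lambda>l. U $$ (l, i))"
  have le: "(\<Sum>i<n. (?q t i) powr r) \<le> tr (mat_powr (X t) r)" if t: "0 < t" "t < 1" for t
  proof -
    obtain V y where V: "unitary_mat n V" and y: "\<And>i. 0 \<le> y i" and Xe: "X t = ud n V y"
      using psd_spectral[OF X[OF t]] by blast
    show ?thesis unfolding Xe mat_powr_ud[OF V] tr_ud[OF V]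
      using y by (intro peierls[OF U V powr_convex_on[OF r]]) auto
  qed
  have "((\<lambda>t. ?q t i) \<longlongrightarrow> x i) (at_right 0)" if "i < n" for i
    using qf_tendsto[OF lim, of "\<lambda>l. U $$ (l, i)"] qf_ud_col[OF U that, of x] by (simp add: Le)
  moreover have "eventually (\<lambda>t. 0 \<le> ?q t i) (at_right 0)" for i
    using ev_at_right by eventually_elim (use X in \<open>auto simp: psd_iff\<close>)
  ultimately have "((\<lambda>t. \<Sum>i<n. (?q t i) powr r) \<longlongrightarrow> (\<Sum>i<n. x i powr r)) (at_right 0)"
    using r by (intro tendsto_sum tendsto_powr' tendsto_const) auto
  moreover have "eventually (\<lambda>t. (\<Sum>i<n. (?q t i) powr r) \<le> c t) (at_right 0)"
    using ev_at_right
  proof eventually_elim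
    case (elim t)
    then show ?case using order_trans[OF le c, of t] by blast
  qed
  ultimately have "(\<Sum>i<n. x i powr r) \<le> d"
    using cl by (intro tendsto_le[of "at_right 0"]) (auto simp: trivial_limit_at_right_real)
  then show ?thesis by (simp add: Le mat_powr_ud[OF U] tr_ud[OF U])
qed

subsection \<open>Comparison with the minimal quantity: semidefinite pairs\<close>

lemma mix_one_ud:
  assumes "unitary_mat n U"
  shows "mat_mix t (ud n U a) (1\<^sub>m n) = ud n U (\<lambda>i. (1 - t) * a i + t)"
  using mix_ud[OF unitaryD(1)[OF assms], of t a "\<lambda>_. 1"] by (simp add: ud_one[OF assms])

lemma mix_one_pd: "psd_mat n A \<Longrightarrow> 0 < t \<Longrightarrow> t < 1 \<Longrightarrow> pd n (mat_mix t A (1\<^sub>m n))"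
proof (erule psd_spectral)
  fix U d assume U: "unitary_mat n U" and d: "\<And>i. 0 \<le> d i" and A: "A = ud n U d" and t: "0 < t" "t < 1"
  have "0 < (1 - t) * d i + t" for i using d[of i] t by (intro add_nonneg_pos mult_nonneg_nonneg) auto
  then show "pd n (mat_mix t A (1\<^sub>m n))" unfolding A mix_one_ud[OF U] using U by (intro pdI)
qed

text \<open>The pair (1, 1) has trace \<open>n\<close> for every kind. Since the assumed concavity
  or convexity passes the mixture through \<open>Tr M\<close>, no continuity of \<open>Tr M\<close>
  is involved, and letting t tend to 0 concerns only the side of \<open>R\<close>.\<close>

lemma compare_R_mix:
  assumes jc: "jconc \<sigma> k \<alpha> p" and s: "\<sigma> = 1 \<or> \<sigma> = -1" and n: "1 \<le> n" and p: "0 < p" and al: "0 < \<alpha>"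
    and dom: "(A, B) \<in> qmean_dom k \<alpha> n" and t: "0 < t" "t < 1"
  defines "At \<equiv> mat_mix t A (1\<^sub>m n)" and "Bt \<equiv> mat_mix t B (1\<^sub>m n)"
  shows "\<sigma> * ((1 - t) * tr_qmean k \<alpha> p A B + t * real n) \<le>
    \<sigma> * tr (mat_powr (mat_powr At ((1 - \<alpha>) / (2 * \<alpha>)) * Bt * mat_powr At ((1 - \<alpha>) / (2 * \<alpha>))) \<alpha>)"
proof -
  have A: "psd_mat n A" and B: "psd_mat n B" using dom by (auto simp: dom_iff)
  have pd: "pd n At" "pd n Bt" unfolding At_def Bt_def using A B t by (auto intro: mix_one_pd)
  have one: "tr_qmean k \<alpha> p (1\<^sub>m n) (1\<^sub>m n) = real n"
    using tr_qmean_ud[OF unitary_one[of n], of "\<lambda>_. 1" "\<lambda>_. 1" p k \<alpha>] p by (simp add: ud_one)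
  have "\<sigma> * ((1 - t) * tr_qmean k \<alpha> p A B + t * tr_qmean k \<alpha> p (1\<^sub>m n) (1\<^sub>m n)) \<le> \<sigma> * tr_qmean k \<alpha> p At Bt"
    unfolding At_def Bt_def using t
    by (intro jconcD[OF jc n dom] dom_pd pd_one pd_psd) auto
  also have "\<dots> \<le> \<sigma> * tr_qmean R \<alpha> (1 / \<alpha>) At Bt" by (rule compare_R_pd[OF jc s n p al pd])
  finally show ?thesis
    unfolding one unfolding tr_qmean_def R_mean_eq[OF pd_psd[OF pd(1)] pd_psd[OF pd(2)] al] .
qed

lemma ur_tendsto: "((\<lambda>t. (1 - t) * a + t) \<longlongrightarrow> (a::real)) (at_right 0)"
proof -
  have "((\<lambda>t. (1 - t) * a + t) \<longlongrightarrow> (1 - 0) * a + 0) (at_right 0)" by (intro tendsto_intros)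
  then show ?thesis by simp
qed

lemma compare_R_concave:
  assumes jc: "jconc 1 k \<alpha> p" and n: "1 \<le> n" and p: "0 < p" and al: "0 < \<alpha>" "\<alpha> < 1"
    and dom: "(A, B) \<in> qmean_dom k \<alpha> n"
  shows "tr_qmean k \<alpha> p A B \<le> tr_qmean R \<alpha> (1 / \<alpha>) A B"
proof -
  have A: "psd_mat n A" and B: "psd_mat n B" using dom by (auto simp: dom_iff)
  obtain U a where U: "unitary_mat n U" and a: "\<And>i. 0 \<le> a i" and Ae: "A = ud n U a"
    using psd_spectral[OF A] by blast
  obtain V b where V: "unitary_mat n V" and b: "\<And>i. 0 \<le> b i" and Be: "B = ud n V b"
    using psd_spectral[OF B] by blast
  note u = unitaryD(1)[OF U] and v = unitaryD(1)[OF V]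
  let ?s = "(1 - \<alpha>) / (2 * \<alpha>)"
  let ?At = "\<lambda>t. ud n U (\<lambda>i. ((1 - t) * a i + t) powr ?s)"
  let ?Bt = "\<lambda>t. ud n V (\<lambda>i. (1 - t) * b i + t)"
  have At: "mat_powr (mat_mix t A (1\<^sub>m n)) ?s = ?At t" for t
    unfolding Ae mix_one_ud[OF U] mat_powr_ud[OF U] ..
  have Bt: "mat_mix t B (1\<^sub>m n) = ?Bt t" for t unfolding Be mix_one_ud[OF V] ..
  \<comment> \<open>A positive exponent makes the regularised powers converge even on the kernel of
    \<open>A\<close>.\<close>
  have s: "?s > 0" using al by simp
  have mA: "mlim n ?At (mat_powr A ?s)"
    unfolding Ae mat_powr_ud[OF U]
  proof (intro mlim_ud u tendsto_powr' ur_tendsto tendsto_const disjI2 conjI s)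
    fix k
    show "eventually (\<lambda>t. 0 \<le> (1 - t) * a k + t) (at_right 0)"
      using ev_at_right by eventually_elim (use a in auto)
  qed
  have mB: "mlim n ?Bt B" unfolding Be by (intro mlim_ud v ur_tendsto)
  have "mlim n (\<lambda>t. ?At t * ?Bt t * ?At t) (mat_powr A ?s * B * mat_powr A ?s)"
    using u v mat_powr_psd[OF A, of ?s] B mA mB by (intro mlim_mult) auto
  moreover have "((\<lambda>t. (1 - t) * tr_qmean k \<alpha> p A B + t * real n) \<longlongrightarrow> (1 - 0) * tr_qmean k \<alpha> p A B + 0 * real n) (at_right 0)"
    by (intro tendsto_intros)
  moreover have "(1 - t) * tr_qmean k \<alpha> p A B + t * real n \<le> tr (mat_powr (?At t * ?Bt t * ?At t) \<alpha>)"
    if t: "0 < t" "t < 1" for t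
    using compare_R_mix[OF jc _ n p al(1) dom t] by (simp only: At Bt) simp
  moreover have "psd_mat n (?At t * ?Bt t * ?At t)" if t: "0 < t" "t < 1" for t
    unfolding At[symmetric] Bt[symmetric] using t A B by (intro psd_conj_powr pd_psd[OF mix_one_pd])
  ultimately have "(1 - 0) * tr_qmean k \<alpha> p A B + 0 * real n \<le> tr (mat_powr (mat_powr A ?s * B * mat_powr A ?s) \<alpha>)"
    by (intro trace_powr_usc[OF _ psd_conj_powr[OF A B] _ al(1)])
  then show ?thesis unfolding tr_qmean_def[of R] R_mean_eq[OF A B al(1)] by simp
qed

text \<open>The exponent \<open>?s\<close> is negative here, so the regularised power of
  \<open>A\<close> blows up on the kernel of \<open>A\<close>. By the support condition
  \<open>B\<close> does not see that kernel, and the identity in the mixture contributes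
  \<open>t powr (1 + 2 * ?s) = t powr (1 / \<alpha>)\<close> there, which tends to 0.\<close>

lemma compare_R_convex:
  assumes jc: "jconc (-1) k \<alpha> p" and n: "1 \<le> n" and p: "0 < p" and al: "1 < \<alpha>"
    and dom: "(A, B) \<in> qmean_dom k \<alpha> n"
  shows "tr_qmean R \<alpha> (1 / \<alpha>) A B \<le> tr_qmean k \<alpha> p A B"
proof -
  have A: "psd_mat n A" and B: "psd_mat n B" and ker: "\<And>v. qf n A v = 0 \<Longrightarrow> qf n B v = 0"
    using dom al by (auto simp: dom_iff)
  have al0: "0 < \<alpha>" using al by simp
  obtain U a where U: "unitary_mat n U" and a: "\<And>i. 0 \<le> a i" and Ae: "A = ud n U a"
    using psd_spectral[OF A] by blast
  note u = unitaryD(1)[OF U]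
  let ?s = "(1 - \<alpha>) / (2 * \<alpha>)"
  let ?x = "\<lambda>t i. (1 - t) * a i + t"
  let ?At = "\<lambda>t. ud n U (\<lambda>i. ?x t i powr ?s)"
  let ?Ct = "\<lambda>t. ud n U (\<lambda>i. if a i = 0 then 0 else ?x t i powr ?s)"
  let ?Dt = "\<lambda>t. ud n U (\<lambda>i. t * (?x t i powr ?s * ?x t i powr ?s))"
  let ?P = "supp_proj A"
  have At: "mat_powr (mat_mix t A (1\<^sub>m n)) ?s = ?At t" for t
    unfolding Ae mix_one_ud[OF U] mat_powr_ud[OF U] ..
  have CP: "?At t * ?P = ?Ct t" "?P * ?At t = ?Ct t" for t
    unfolding Ae supp_ud[OF U] ud_mult[OF U] by (auto intro!: ud_cong)
  have AP: "?P \<in> sq n" "B * ?P = B" "?P * B = B" using supp_psd[OF A] mult_supp[OF A B ker] by auto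
  \<comment> \<open>Next to \<open>B\<close> the power may be cut down to the support of
    \<open>A\<close>, which gives the convergent \<open>?Ct\<close>; \<open>?Dt\<close> collects
    what comes from the identity.\<close>
  have split: "?At t * mat_mix t B (1\<^sub>m n) * ?At t = complex_of_real (1 - t) \<cdot>\<^sub>m (?Ct t * B * ?Ct t) + ?Dt t" for t
  proof -
    have "?At t * B * ?At t = ?At t * (?P * B * ?P) * ?At t" using AP by simp
    also have "\<dots> = (?At t * ?P) * B * (?P * ?At t)" using u AP(1) B by (simp add: sq_assoc[of _ n])
    finally have 1: "?At t * B * ?At t = ?Ct t * B * ?Ct t" unfolding CP .
    have 2: "complex_of_real t \<cdot>\<^sub>m (?At t * ?At t) = ?Dt t" unfolding ud_mult[OF U] ud_smult[OF u] ..
    have Atc: "?At t \<in> sq n" using u by simp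
    show ?thesis
      unfolding mat_mix_def conj_linear[OF Atc psd_sq[OF B] one_carrier_mat Atc] sq_one(2)[OF Atc] 1 2 ..
  qed
  have mC: "mlim n ?Ct (mat_powr A ?s)"
    unfolding Ae mat_powr_ud[OF U]
  proof (intro mlim_ud u)
    fix k
    show "((\<lambda>t. if a k = 0 then 0 else ?x t k powr ?s) \<longlongrightarrow> a k powr ?s) (at_right 0)"
      using tendsto_powr[OF ur_tendsto tendsto_const, of "a k"] by (cases "a k = 0") auto
  qed
  have mD: "mlim n ?Dt (ud n U (\<lambda>_. 0))"
  proof (intro mlim_ud u)
    fix k
    show "((\<lambda>t. t * (?x t k powr ?s * ?x t k powr ?s)) \<longlongrightarrow> 0) (at_right 0)"
    proof (cases "a k = 0")
      case True
      have e: "1 + (?s + ?s) = 1 / \<alpha>" using al by (simp add: field_simps)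
      have "((\<lambda>t::real. t powr (1 / \<alpha>)) \<longlongrightarrow> 0 powr (1 / \<alpha>)) (at_right 0)"
        using al0 by (intro tendsto_powr' tendsto_const tendsto_ident_at disjI2 conjI)
          (auto simp: eventually_at_right_less intro: eventually_mono[OF ev_at_right])
      moreover have "eventually (\<lambda>t. t powr (1 / \<alpha>) = t * (?x t k powr ?s * ?x t k powr ?s)) (at_right 0)"
        using ev_at_right
      proof eventually_elim
        case (elim t)
        have "t powr (1 / \<alpha>) = t powr 1 * (t powr ?s * t powr ?s)"
          unfolding e[symmetric] by (simp only: powr_add)
        then show ?case using True elim by simp
      qed
      ultimately show ?thesis using Lim_transform_eventually by fastforce
    next
      case False
      have "((\<lambda>t. t * (?x t k powr ?s * ?x t k powr ?s)) \<longlongrightarrow> 0 * (a k powr ?s * a k powr ?s)) (at_right 0)"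
        using False by (intro tendsto_mult tendsto_ident_at tendsto_powr ur_tendsto tendsto_const)
      then show ?thesis by simp
    qed
  qed
  have s: "mat_powr A ?s \<in> sq n" using mat_powr_psd[OF A, of ?s] by auto
  have "mlim n (\<lambda>t. complex_of_real (1 - t) \<cdot>\<^sub>m (?Ct t * B * ?Ct t) + ?Dt t)
     (complex_of_real (1 - 0) \<cdot>\<^sub>m (mat_powr A ?s * B * mat_powr A ?s) + ud n U (\<lambda>_. 0))"
    using u s B mC mD
    by (intro mlim_add mlim_smult mlim_mult mlim_const tendsto_intros) auto
  moreover have "complex_of_real (1 - 0) \<cdot>\<^sub>m (mat_powr A ?s * B * mat_powr A ?s) + ud n U (\<lambda>_. 0) = mat_powr A ?s * B * mat_powr A ?s"
  proof -
    have c: "mat_powr A ?s * B * mat_powr A ?s \<in> sq n" using s B by auto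
    have z: "ud n U (\<lambda>_. 0) $$ (i, j) = 0" if "i < n" "j < n" for i j using that by (simp add: ud_idx[OF u])
    show ?thesis using carrier_matD[OF c] carrier_matD[OF ud_carrier[OF u]]
      by (intro eq_matI) (simp_all add: z del: index_mult_mat)
  qed
  ultimately have m: "mlim n (\<lambda>t. ?At t * mat_mix t B (1\<^sub>m n) * ?At t) (mat_powr A ?s * B * mat_powr A ?s)"
    unfolding split by simp
  have c: "((\<lambda>t. (1 - t) * tr_qmean k \<alpha> p A B + t * real n) \<longlongrightarrow> (1 - 0) * tr_qmean k \<alpha> p A B + 0 * real n) (at_right 0)"
    by (intro tendsto_intros)
  have "tr (mat_powr (?At t * mat_mix t B (1\<^sub>m n) * ?At t) \<alpha>) \<le> (1 - t) * tr_qmean k \<alpha> p A B + t * real n"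
    if t: "0 < t" "t < 1" for t
    using compare_R_mix[OF jc _ n p al0 dom t] by (simp only: At) simp
  moreover have "psd_mat n (?At t * mat_mix t B (1\<^sub>m n) * ?At t)" if t: "0 < t" "t < 1" for t
    unfolding At[symmetric] using t A B by (intro psd_conj_powr pd_psd[OF mix_one_pd])
  ultimately have "tr (mat_powr (mat_powr A ?s * B * mat_powr A ?s) \<alpha>) \<le> (1 - 0) * tr_qmean k \<alpha> p A B + 0 * real n"
    using al by (intro trace_powr_lsc[OF _ psd_conj_powr[OF A B] m _ _ c]) auto
  then show ?thesis unfolding tr_qmean_def[of R] R_mean_eq[OF A B al0] by simp
qed

subsection \<open>The Loewner--Heinz inequality\<close>

lemma qf_adj: "X \<in> sq n \<Longrightarrow> qf n (mat_adjoint X) v = qf n X v"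
proof -
  assume X: "X \<in> sq n"
  have "(\<Sum>i<n. \<Sum>j<n. cnj (v i) * mat_adjoint X $$ (i, j) * v j) = (\<Sum>j<n. \<Sum>i<n. cnj (v i) * mat_adjoint X $$ (i, j) * v j)"
    by (rule sum.swap)
  also have "\<dots> = cnj (\<Sum>j<n. \<Sum>i<n. cnj (v j) * X $$ (j, i) * v i)"
    using X by (simp add: adj_idx[of _ n] mult_ac)
  finally have e: "(\<Sum>i<n. \<Sum>j<n. cnj (v i) * mat_adjoint X $$ (i, j) * v j) =
    cnj (\<Sum>j<n. \<Sum>i<n. cnj (v j) * X $$ (j, i) * v i)" .
  have "Re (cnj z) = Re z" for z by simp
  then show ?thesis unfolding qf_def e .
qed

lemma qf_conj_powr:
  assumes "psd_mat n A" "B \<in> sq n"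
  shows "qf n (mat_powr A r * B * mat_powr A r) v = qf n B (\<lambda>i. \<Sum>j<n. mat_powr A r $$ (i, j) * v j)"
  using qf_conj[OF assms(2), of "mat_powr A r" v] mat_powr_psd[OF assms(1), of r] hermD(2)[OF psd_herm] by auto

lemma qf_conj_powr_mono:
  assumes "psd_mat n A" "B \<in> sq n" "C \<in> sq n" "\<And>v. qf n B v \<le> qf n C v"
  shows "qf n (mat_powr A r * B * mat_powr A r) v \<le> qf n (mat_powr A r * C * mat_powr A r) v"
  using assms by (simp add: qf_conj_powr)

lemma pd_powr_mult: "pd n A \<Longrightarrow> mat_powr A r * mat_powr A s = mat_powr A (r + s)"
  using mat_powr_add pd_psd by blast

lemma pd_powr_mult_left: 
  "pd n A \<Longrightarrow> X \<in> sq n \<Longrightarrow> mat_powr A r * (mat_powr A s * X) = mat_powr A (r + s) * X"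
  using pd_powr_mult[of n A r s] sq_assoc[of "mat_powr A r" n "mat_powr A s" X] pd_powr by auto

text \<open>The inequality for the exponent r says that \<open>K r\<close> is a contraction. The
  product \<open>?Z\<close> of the contractions for s and t is similar to the positive matrix
  \<open>?Y = B^(-u/2) * A^u * B^(-u/2)\<close>. Hence the eigenvalues of \<open>?Y\<close> are at
  most 1, which is the inequality for u.\<close>

lemma loewner_heinz_mid:
  assumes A: "pd n A" and B: "pd n B"
    and s: "\<And>v. qf n (mat_powr A s) v \<le> qf n (mat_powr B s) v"
    and t: "\<And>v. qf n (mat_powr A t) v \<le> qf n (mat_powr B t) v"
  shows "qf n (mat_powr A ((s + t) / 2)) v \<le> qf n (mat_powr B ((s + t) / 2)) v"
proof -
  define u where "u = (s + t) / 2"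
  have c [simp]: "mat_powr A r \<in> sq n" "mat_powr B r \<in> sq n" for r using pd_powr[OF A] pd_powr[OF B] by auto
  have adj [simp]: "mat_adjoint (mat_powr A r) = mat_powr A r" "mat_adjoint (mat_powr B r) = mat_powr B r" for r
    using hermD(2)[OF psd_herm[OF pd_psd[OF pd_powr[OF A]]]] hermD(2)[OF psd_herm[OF pd_psd[OF pd_powr[OF B]]]] by auto
  note zA = pd_powr_zero[OF A] and zB = pd_powr_zero[OF B]
  define K where "K r = mat_powr A (r / 2) * mat_powr B (- (r / 2))" for r
  have Kc: "K r \<in> sq n" for r by (simp add: K_def)
  have Ka: "mat_adjoint (K r) = mat_powr B (- (r / 2)) * mat_powr A (r / 2)" for r
    by (simp add: K_def adj_mult[of _ n])
  have contr: "qf n (mat_adjoint (K r) * K r) w \<le> qf n (1\<^sub>m n) w"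
    if le: "\<And>v. qf n (mat_powr A r) v \<le> qf n (mat_powr B r) v" for r w
  proof -
    have "mat_adjoint (K r) * K r = mat_powr B (- (r / 2)) * mat_powr A r * mat_powr B (- (r / 2))"
      unfolding Ka unfolding K_def using pd_powr_mult_left[OF A, of _ "r / 2" "r / 2"]
      by (simp add: sq_assoc[of _ n])
    also have "qf n \<dots> w \<le> qf n (mat_powr B (- (r / 2)) * mat_powr B r * mat_powr B (- (r / 2))) w"
      using le by (intro qf_conj_powr_mono pd_psd[OF B]) auto
    also have "mat_powr B (- (r / 2)) * mat_powr B r * mat_powr B (- (r / 2)) = 1\<^sub>m n"
      using zB by (simp add: pd_powr_mult[OF B])
    finally show ?thesis .
  qed
  let ?Z = "mat_adjoint (K s) * K t"
  have Zc: "?Z \<in> sq n" using Kc by auto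
  \<comment> \<open>\<open>?Z\<close> need not be Hermitian, but \<open>qf\<close> reads the real
    part. The Gram matrix of \<open>K t - K s\<close> has a nonnegative form, which bounds twice
    this real part by the sum of the two contraction estimates.\<close>
  have Z: "qf n ?Z w \<le> qf n (1\<^sub>m n) w" for w
  proof -
    let ?D = "K t - K s"
    have Dc: "?D \<in> sq n" by (intro minus_carrier_mat Kc)
    have "mat_adjoint ?D = mat_adjoint (K t) - mat_adjoint (K s)"
    proof (rule sq_eqI[of _ n])
      fix i j assume ij: "i < n" "j < n"
      then show "mat_adjoint ?D $$ (i, j) = (mat_adjoint (K t) - mat_adjoint (K s)) $$ (i, j)"
        by (simp add: adj_idx[OF Dc] adj_idx[OF Kc] carrier_matD[OF Kc] carrier_matD[OF adj_carrier[OF Kc]])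
    qed (intro adj_carrier Dc minus_carrier_mat Kc)+
    then have "mat_adjoint ?D * ?D = (mat_adjoint (K t) - mat_adjoint (K s)) * (K t - K s)" by simp
    also have "\<dots> = (mat_adjoint (K t) * K t - mat_adjoint (K t) * K s) - (mat_adjoint (K s) * K t - mat_adjoint (K s) * K s)"
      unfolding minus_mult_distrib_mat[OF adj_carrier[OF Kc] adj_carrier[OF Kc] Dc]
        mult_minus_distrib_mat[OF adj_carrier[OF Kc] Kc Kc] ..
    finally have e: "mat_adjoint ?D * ?D = (mat_adjoint (K t) * K t - mat_adjoint (K t) * K s) - (mat_adjoint (K s) * K t - mat_adjoint (K s) * K s)" .
    have "0 \<le> qf n (mat_adjoint ?D * ?D) w" using psd_gram(2)[OF Dc] by (simp add: psd_iff)
    also have "\<dots> = qf n (mat_adjoint (K t) * K t) w - qf n (mat_adjoint (K t) * K s) w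
        - (qf n ?Z w - qf n (mat_adjoint (K s) * K s) w)"
      unfolding e using Kc by (simp add: qf_minus minus_carrier_mat)
    also have "qf n (mat_adjoint (K t) * K s) w = qf n ?Z w"
      using qf_adj[OF Zc, of w] Kc by (simp add: adj_mult[of _ n] adj_adj[of _ n])
    finally show ?thesis using contr[OF s, of w] contr[OF t, of w] by linarith
  qed
  let ?Y = "mat_powr B (- (u / 2)) * mat_powr A u * mat_powr B (- (u / 2))"
  let ?C = "mat_powr B ((t - s) / 4)"
  have Y: "pd n ?Y" using pd_conj_powr[OF B pd_powr[OF A]] .
  obtain V y where V: "unitary_mat n V" and Ye: "?Y = ud n V y" using pdE[OF Y] by blast
  \<comment> \<open>The exponent of \<open>?C\<close> is chosen so that
    \<open>?Z * ?C = ?C * ?Y\<close>. One more \<open>?C\<close> on the left makes the left side a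
    congruence, to which the bound on the form of \<open>?Z\<close> transfers.\<close>
  have CZC: "?C * ?Z * ?C = ?C * ?C * ?Y"
  proof -
    have e1: "s / 2 + t / 2 = u" "- (t / 2) + (t - s) / 4 = - (u / 2)" "(t - s) / 4 + - (u / 2) = - (s / 2)" 
      by (simp_all add: u_def field_simps)
    have "?Z * ?C = mat_powr B (- (s / 2)) * (mat_powr A (s / 2) * (mat_powr A (t / 2) * (mat_powr B (- (t / 2)) * ?C)))"
      unfolding Ka unfolding K_def by (simp add: sq_assoc[of _ n])
    also have "\<dots> = mat_powr B (- (s / 2)) * (mat_powr A u * mat_powr B (- (u / 2)))"
      by (simp only: pd_powr_mult[OF B] pd_powr_mult_left[OF A c(2)] e1)
    also have "\<dots> = ?C * (mat_powr B (- (u / 2)) * (mat_powr A u * mat_powr B (- (u / 2))))"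
      by (simp only: pd_powr_mult_left[OF B sq_mult[OF c(1) c(2)]] e1)
    finally have "?Z * ?C = ?C * ?Y" by (simp add: sq_assoc[of _ n])
    then show ?thesis using Zc by (simp add: sq_assoc[of _ n])
  qed
  \<comment> \<open>At an eigenvector of \<open>?Y\<close>, the form of \<open>?C * ?C * ?Y\<close>
    is \<open>y k\<close> times the form of \<open>?C * ?C\<close>, which is positive and also
    bounds it from above.\<close>
  have y: "y k \<le> 1" if k: "k < n" for k
  proof -
    let ?v = "\<lambda>l. V $$ (l, k)"
    have CC: "?C * ?C \<in> sq n" by simp
    have "qf n (?C * ?C * ?Y) ?v = y k * qf n (?C * ?C) ?v"
    proof -
      have "(\<Sum>j<n. (?C * ?C * ?Y) $$ (i, j) * ?v j) = complex_of_real (y k) * (\<Sum>l<n. (?C * ?C) $$ (i, l) * ?v l)" 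
        if i: "i < n" for i
      proof -
        have "(\<Sum>j<n. (?C * ?C * ?Y) $$ (i, j) * ?v j) = (\<Sum>j<n. \<Sum>l<n. (?C * ?C) $$ (i, l) * (ud n V y $$ (l, j) * ?v j))"
          using i unitaryD(1)[OF V] by (simp add: Ye mult_idx[OF CC] sum_distrib_left sum_distrib_right mult_ac del: index_mult_mat)
        also have "\<dots> = (\<Sum>l<n. \<Sum>j<n. (?C * ?C) $$ (i, l) * (ud n V y $$ (l, j) * ?v j))" by (rule sum.swap)
        also have "\<dots> = (\<Sum>l<n. (?C * ?C) $$ (i, l) * (\<Sum>j<n. ud n V y $$ (l, j) * ?v j))"
          by (simp only: sum_distrib_left)
        also have "\<dots> = (\<Sum>l<n. (?C * ?C) $$ (i, l) * (complex_of_real (y k) * ?v l))"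
          using ud_col_eq[OF V _ k, of _ y] by (intro sum.cong) auto
        also have "\<dots> = complex_of_real (y k) * (\<Sum>l<n. (?C * ?C) $$ (i, l) * ?v l)"
          unfolding sum_distrib_left by (intro sum.cong refl) (simp only: mult_ac)
        finally show ?thesis .
      qed
      note row = this
      have pull: "(\<Sum>i\<in>I. f i * (c * g i)) = c * (\<Sum>i\<in>I. f i * g i)" for I :: "nat set" and f g and c :: complex
        by (simp add: sum_distrib_left mult_ac)
      have q: "qf n M v = Re (\<Sum>i<n. cnj (v i) * (\<Sum>j<n. M $$ (i, j) * v j))" for M v
        unfolding qf_def by (simp only: sum_distrib_left mult.assoc)
      have "(\<Sum>i<n. cnj (?v i) * (\<Sum>j<n. (?C * ?C * ?Y) $$ (i, j) * ?v j)) =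
         (\<Sum>i<n. cnj (?v i) * (complex_of_real (y k) * (\<Sum>l<n. (?C * ?C) $$ (i, l) * ?v l)))"
        by (rule sum.cong[OF refl]) (simp only: lessThan_iff row)
      also have "\<dots> = complex_of_real (y k) * (\<Sum>i<n. cnj (?v i) * (\<Sum>l<n. (?C * ?C) $$ (i, l) * ?v l))"
        by (rule pull)
      finally show ?thesis unfolding q by (simp del: index_mult_mat)
    qed
    moreover have "qf n (?C * ?Z * ?C) ?v \<le> qf n (?C * 1\<^sub>m n * ?C) ?v"
      using Z Zc by (intro qf_conj_powr_mono pd_psd[OF B]) auto
    moreover have "qf n (?C * ?C) ?v > 0"
    proof -
      have CCpd: "pd n (?C * ?C)" unfolding pd_powr_mult[OF B] using pd_powr[OF B] .
      have "qf n (?C * ?C) ?v \<noteq> 0"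
      proof
        assume z: "qf n (?C * ?C) ?v = 0"
        have "(\<Sum>l<n. (cmod (V $$ (l, k)))\<^sup>2) = 0" using qf_pd_zero[OF CCpd z] by (intro sum.neutral) auto
        then show False using unitary_stoch(1)[OF V k] by simp
      qed
      moreover have "qf n (?C * ?C) ?v \<ge> 0" using pd_psd[OF CCpd] by (simp add: psd_iff)
      ultimately show ?thesis by simp
    qed
    ultimately show ?thesis unfolding CZC by simp
  qed
  have "mat_powr A u = mat_powr B (u / 2) * ?Y * mat_powr B (u / 2)"
  proof -
    have "mat_powr B (u / 2) * ?Y * mat_powr B (u / 2) = 
      (mat_powr B (u / 2) * mat_powr B (- (u / 2))) * mat_powr A u * (mat_powr B (- (u / 2)) * mat_powr B (u / 2))"
      by (simp add: sq_assoc[of _ n])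
    then show ?thesis using zB by (simp add: pd_powr_mult[OF B])
  qed
  then have "qf n (mat_powr A u) v = qf n (mat_powr B (u / 2) * ?Y * mat_powr B (u / 2)) v" by simp
  also have "\<dots> \<le> qf n (mat_powr B (u / 2) * 1\<^sub>m n * mat_powr B (u / 2)) v"
  proof (rule qf_conj_powr_mono[OF pd_psd[OF B]])
    show "qf n ?Y w \<le> qf n (1\<^sub>m n) w" for w
      using qf_ud_le_one[OF V, of y 1 w] y by (simp add: Ye qf_one)
  qed (use Y in auto)
  also have "mat_powr B (u / 2) * 1\<^sub>m n * mat_powr B (u / 2) = mat_powr B u"
    by (simp add: pd_powr_mult[OF B])
  finally show ?thesis unfolding u_def .
qed

text \<open>An odd numerator is the midpoint of its two even neighbours, and these belong to the
  coarser level.\<close>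

lemma dyadic_closure:
  fixes E :: "real set"
  assumes 0: "0 \<in> E" and 1: "1 \<in> E" and mid: "\<And>s t. s \<in> E \<Longrightarrow> t \<in> E \<Longrightarrow> (s + t) / 2 \<in> E"
  shows "j \<le> 2 ^ k \<Longrightarrow> real j / 2 ^ k \<in> E"
proof (induction k arbitrary: j)
  case 0
  then show ?case using assms by (cases j) auto
next
  case (Suc k)
  let ?i = "j div 2"
  show ?case
  proof (cases "even j")
    case True
    then have j: "j = 2 * ?i" by simp
    then have "real ?i / 2 ^ k \<in> E" using Suc by auto
    moreover have "real j = 2 * real ?i" using j by (metis of_nat_mult of_nat_numeral)
    ultimately show ?thesis by simp
  next
    case False
    then have j: "j = 2 * ?i + 1" by simp
    have "?i + 1 \<le> 2 ^ k" using Suc.prems False by simp presburger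
    then have "real ?i / 2 ^ k \<in> E" "real (?i + 1) / 2 ^ k \<in> E" using Suc.IH[of ?i] Suc.IH[of "?i + 1"] by auto
    from mid[OF this] have "(real ?i / 2 ^ k + real (?i + 1) / 2 ^ k) / 2 \<in> E" .
    moreover have "real j = 2 * real ?i + 1" using j by (metis of_nat_1 of_nat_add of_nat_mult of_nat_numeral)
    ultimately show ?thesis by (simp add: add_divide_distrib mult.commute)
  qed
qed

text \<open>The admissible exponents contain 0 and 1 and are closed under midpoints, so they contain
  the dyadic ones. Rounding \<open>2 ^ k * r\<close> down reaches the rest, since powers of positive
  eigenvalues are continuous in the exponent.\<close>

lemma loewner_heinz:
  assumes A: "pd n A" and B: "pd n B" and le: "\<And>v. qf n A v \<le> qf n B v" and r: "0 \<le> r" "r \<le> 1"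
  shows "qf n (mat_powr A r) v \<le> qf n (mat_powr B r) v"
proof -
  define E where "E = {r. \<forall>v. qf n (mat_powr A r) v \<le> qf n (mat_powr B r) v}"
  have E: "0 \<in> E" "1 \<in> E" "\<And>s t. s \<in> E \<Longrightarrow> t \<in> E \<Longrightarrow> (s + t) / 2 \<in> E"
    using le loewner_heinz_mid[OF A B] mat_powr_one[OF pd_psd[OF A]] mat_powr_one[OF pd_psd[OF B]]
    by (auto simp: E_def pd_powr_zero[OF A] pd_powr_zero[OF B])
  define j where "j k = nat \<lfloor>2 ^ k * r\<rfloor>" for k
  have fl: "real (j k) = of_int \<lfloor>2 ^ k * r\<rfloor>" for k using r by (simp add: j_def)
  have jk: "j k \<le> 2 ^ k" for k
  proof -
    have "2 ^ k * r \<le> 2 ^ k" using r by (simp add: mult_left_le)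
    then have "real (j k) \<le> 2 ^ k" unfolding fl using of_int_floor_le[of "2 ^ k * r"] by linarith
    then have "real (j k) \<le> real (2 ^ k)" by simp
    then show ?thesis by (simp only: of_nat_le_iff)
  qed
  have "real (j k) / 2 ^ k \<in> E" for k using dyadic_closure[OF E jk] .
  then have le_k: "qf n (mat_powr A (real (j k) / 2 ^ k)) v \<le> qf n (mat_powr B (real (j k) / 2 ^ k)) v" for k
    by (auto simp: E_def)
  have lim: "(\<lambda>k. real (j k) / 2 ^ k) \<longlonglongrightarrow> r"
  proof (rule tendsto_sandwich)
    show "eventually (\<lambda>k. r - (1 / 2) ^ k \<le> real (j k) / 2 ^ k) sequentially"
    proof (intro always_eventually allI)
      fix k
      have "(2 ^ k * r - 1) / 2 ^ k \<le> real (j k) / 2 ^ k" unfolding fl by (intro divide_right_mono) (linarith, simp)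
      then show "r - (1 / 2) ^ k \<le> real (j k) / 2 ^ k" by (simp add: diff_divide_distrib power_one_over)
    qed
    show "eventually (\<lambda>k. real (j k) / 2 ^ k \<le> r) sequentially"
    proof (intro always_eventually allI)
      fix k
      have "real (j k) \<le> 2 ^ k * r" unfolding fl by linarith
      then show "real (j k) / 2 ^ k \<le> r" by (simp add: field_simps)
    qed
    have "(\<lambda>k. r - (1 / 2) ^ k) \<longlonglongrightarrow> r - 0" by (intro tendsto_diff tendsto_const LIMSEQ_power_zero) simp
    then show "(\<lambda>k. r - (1 / 2) ^ k) \<longlonglongrightarrow> r" by simp
  qed simp
  have conv: "(\<lambda>k. qf n (mat_powr X (real (j k) / 2 ^ k)) v) \<longlonglongrightarrow> qf n (mat_powr X r) v" if X: "pd n X" for X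
  proof -
    obtain U d where U: "unitary_mat n U" and d: "\<And>i. 0 < d i" and Xe: "X = ud n U d" using pdE[OF X] by blast
    have "d i \<noteq> 0" for i using d[of i] by simp
    then show ?thesis unfolding Xe mat_powr_ud[OF U] qf_ud[OF unitaryD(1)[OF U]]
      by (intro tendsto_sum tendsto_mult tendsto_const tendsto_powr lim) auto
  qed
  show ?thesis by (rule LIMSEQ_le[OF conv[OF A] conv[OF B]]) (use le_k in auto)
qed

subsection \<open>Geometric means of definite matrices\<close>

text \<open>\<open>?X\<close> intertwines \<open>?C\<close> with \<open>?D\<close>, hence their
  powers, and \<open>?E\<close> is the inverse of \<open>?D\<close>. After the outer factors are
  rewritten with powers of \<open>B\<close>, the middle becomes \<open>?D\<close> to the power
  \<open>\<alpha> - 1\<close>, which is \<open>?E\<close> to the power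
  \<open>1 - \<alpha>\<close>.\<close>

lemma geo_mean_commute:
  assumes A: "pd n A" and B: "pd n B"
  shows "geo_mean \<alpha> A B = geo_mean (1 - \<alpha>) B A"
proof -
  have c [simp]: "mat_powr A r \<in> sq n" "mat_powr B r \<in> sq n" for r using pd_powr[OF A] pd_powr[OF B] by auto
  have adj [simp]: "mat_adjoint (mat_powr A r) = mat_powr A r" "mat_adjoint (mat_powr B r) = mat_powr B r" for r
    using hermD(2)[OF psd_herm[OF pd_psd[OF pd_powr[OF A]]]] hermD(2)[OF psd_herm[OF pd_psd[OF pd_powr[OF B]]]] by auto
  note A1 = mat_powr_one[OF pd_psd[OF A]] and B1 = mat_powr_one[OF pd_psd[OF B]]
  note zA = pd_powr_zero[OF A] and zB = pd_powr_zero[OF B]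
  note mA = pd_powr_mult[OF A] pd_powr_mult_left[OF A] and mB = pd_powr_mult[OF B] pd_powr_mult_left[OF B]
  let ?X = "mat_powr B (1/2) * mat_powr A (-1/2)" and ?Y = "mat_powr A (1/2) * mat_powr B (-1/2)"
  let ?C = "mat_powr A (-1/2) * B * mat_powr A (-1/2)" and ?D = "mat_powr B (1/2) * mat_powr A (-1) * mat_powr B (1/2)"
  let ?E = "mat_powr B (-1/2) * A * mat_powr B (-1/2)"
  have C: "pd n ?C" using pd_conj_powr[OF A B] .
  have D: "pd n ?D" using pd_conj_powr[OF B pd_powr[OF A]] .
  have E: "pd n ?E" using pd_conj_powr[OF B A] .
  have Cc: "mat_powr ?C r \<in> sq n" for r using pd_powr[OF C] by auto
  have Dc: "mat_powr ?D r \<in> sq n" for r using pd_powr[OF D] by auto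
  have h: "A = mat_powr A (1/2) * mat_powr A (1/2)" "B = mat_powr B (1/2) * mat_powr B (1/2)"
    using mA(1)[of "1/2" "1/2"] mB(1)[of "1/2" "1/2"] A1 B1 by auto
  have XC: "?X * ?C = ?D * ?X"
  proof -
    have "?X * ?C = mat_powr B (1/2) * (mat_powr A (-1/2) * (mat_powr A (-1/2) * (B * mat_powr A (-1/2))))"
      using B by (simp add: sq_assoc[of _ n])
    also have "\<dots> = mat_powr B (1/2) * (mat_powr A (-1) * (B * mat_powr A (-1/2)))"
      using B mA(2)[of "B * mat_powr A (-1/2)" "-1/2" "-1/2"] by simp
    also have "B * mat_powr A (-1/2) = mat_powr B (1/2) * (mat_powr B (1/2) * mat_powr A (-1/2))"
      using mB(2)[of "mat_powr A (-1/2)" "1/2" "1/2"] B1 by simp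
    finally show ?thesis using B by (simp add: sq_assoc[of _ n])
  qed
  have XCr: "?X * mat_powr ?C \<alpha> = mat_powr ?D \<alpha> * ?X"
    using mat_powr_intertwine[OF psd_herm[OF pd_psd[OF C]] psd_herm[OF pd_psd[OF D]] _ XC, of \<alpha>] by simp
  have XY: "?X * ?Y = 1\<^sub>m n" 
    using mA(2)[of "mat_powr B (-1/2)" "-1/2" "1/2"] mB(1)[of "1/2" "-1/2"] zA zB by (simp add: sq_assoc[of _ n])
  have ED: "?E * ?D = 1\<^sub>m n"
  proof -
    have "?E * ?D = mat_powr B (-1/2) * (A * (mat_powr B (-1/2) * (mat_powr B (1/2) * (mat_powr A (-1) * mat_powr B (1/2)))))"
      using A by (simp add: sq_assoc[of _ n])
    also have "mat_powr B (-1/2) * (mat_powr B (1/2) * (mat_powr A (-1) * mat_powr B (1/2))) = mat_powr A (-1) * mat_powr B (1/2)"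
      using mB(2)[of "mat_powr A (-1) * mat_powr B (1/2)" "-1/2" "1/2"] zB by simp
    also have "A * (mat_powr A (-1) * mat_powr B (1/2)) = mat_powr B (1/2)"
      using mA(2)[of "mat_powr B (1/2)" 1 "-1"] A1 zA by simp
    also have "mat_powr B (-1/2) * mat_powr B (1/2) = 1\<^sub>m n" using mB(1)[of "-1/2" "1/2"] zB by simp
    finally show ?thesis .
  qed
  have E_eq: "?E = mat_powr ?D (-1)"
  proof -
    have "mat_powr ?D 1 * mat_powr ?D (-1) = 1\<^sub>m n" using pd_powr_mult[OF D, of 1 "-1"] pd_powr_zero[OF D] by simp
    then have DD: "?D * mat_powr ?D (-1) = 1\<^sub>m n" using mat_powr_one[OF pd_psd[OF D]] by simp
    have "?E = ?E * (?D * mat_powr ?D (-1))" unfolding DD using E pd_sq by simp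
    also have "\<dots> = (?E * ?D) * mat_powr ?D (-1)" using pd_sq[OF E] pd_sq[OF D] Dc by (simp only: sq_assoc[of ?E n])
    finally show ?thesis unfolding ED using Dc by simp
  qed
  have key: "mat_powr B (-1/2) * mat_powr A (1/2) * mat_powr ?C \<alpha> * ?Y = mat_powr ?E (1 - \<alpha>)"
  proof -
    have "mat_powr B (-1/2) * mat_powr A (1/2) = ?E * ?X"
    proof -
      have "?E * ?X = mat_powr B (-1/2) * (A * (mat_powr B (-1/2) * (mat_powr B (1/2) * mat_powr A (-1/2))))"
        using A by (simp add: sq_assoc[of _ n])
      also have "mat_powr B (-1/2) * (mat_powr B (1/2) * mat_powr A (-1/2)) = mat_powr A (-1/2)"
        using mB(2)[of "mat_powr A (-1/2)" "-1/2" "1/2"] zB by simp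
      also have "A * mat_powr A (-1/2) = mat_powr A (1/2)"
        using mA(1)[of 1 "-1/2"] A1 by simp
      finally show ?thesis ..
    qed
    then have "mat_powr B (-1/2) * mat_powr A (1/2) * mat_powr ?C \<alpha> * ?Y = ?E * (?X * mat_powr ?C \<alpha>) * ?Y"
      using pd_sq[OF E] Cc by (simp only: sq_assoc[of ?E n] sq_mult c)
    also have "\<dots> = ?E * (mat_powr ?D \<alpha> * (?X * ?Y))"
      unfolding XCr using pd_sq[OF E] Dc by (simp only: sq_assoc[of _ n] sq_mult c)
    also have "\<dots> = mat_powr ?D (-1) * mat_powr ?D \<alpha>" unfolding XY E_eq using Dc by simp
    also have "\<dots> = mat_powr ?D (\<alpha> - 1)" using pd_powr_mult[OF D, of "-1" \<alpha>] by simp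
    also have "\<dots> = mat_powr ?E (1 - \<alpha>)" unfolding E_eq using mat_powr_powr[OF pd_psd[OF D], of "-1" "1 - \<alpha>"] by simp
    finally show ?thesis .
  qed
  have l: "mat_powr A (1/2) = mat_powr B (1/2) * (mat_powr B (-1/2) * mat_powr A (1/2))"
    using mB(2)[of "mat_powr A (1/2)" "1/2" "-1/2"] zB by simp
  have r: "mat_powr A (1/2) = ?Y * mat_powr B (1/2)"
    using mB(1)[of "-1/2" "1/2"] zB by (simp add: sq_assoc[of _ n])
  have "geo_mean_formula \<alpha> A B = (mat_powr B (1/2) * (mat_powr B (-1/2) * mat_powr A (1/2))) * mat_powr ?C \<alpha> * (?Y * mat_powr B (1/2))"
    unfolding geo_mean_formula_def using l r by simp
  also have "\<dots> = mat_powr B (1/2) * (mat_powr B (-1/2) * mat_powr A (1/2) * mat_powr ?C \<alpha> * ?Y) * mat_powr B (1/2)"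
    using Cc by (simp add: sq_assoc[of _ n])
  also have "\<dots> = geo_mean_formula (1 - \<alpha>) B A" unfolding key geo_mean_formula_def ..
  finally show ?thesis using geo_mean_pd[OF A pd_psd[OF B]] geo_mean_pd[OF B pd_psd[OF A]] by simp
qed

lemma geo_mean_mono_right:
  assumes A: "pd n A" and B: "pd n B" and C: "pd n C" and a: "0 < \<alpha>" "\<alpha> < 1" and le: "\<And>v. qf n B v \<le> qf n C v"
  shows "qf n (geo_mean \<alpha> A B) v \<le> qf n (geo_mean \<alpha> A C) v"
proof -
  have pd: "pd n (mat_powr A (-1/2) * B * mat_powr A (-1/2))" "pd n (mat_powr A (-1/2) * C * mat_powr A (-1/2))"
    using A B C by (auto intro: pd_conj_powr)
  have "qf n (mat_powr A (-1/2) * B * mat_powr A (-1/2)) w \<le> qf n (mat_powr A (-1/2) * C * mat_powr A (-1/2)) w" for w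
    using B C le by (intro qf_conj_powr_mono pd_psd[OF A]) auto
  from loewner_heinz[OF pd this] a show ?thesis
    unfolding geo_mean_pd[OF A pd_psd[OF B]] geo_mean_pd[OF A pd_psd[OF C]] geo_mean_formula_def
    using pd_powr[OF pd(1)] pd_powr[OF pd(2)] by (intro qf_conj_powr_mono pd_psd[OF A]) auto
qed

text \<open>Loewner-Heinz gives monotonicity in the second argument; exchanging the arguments gives
  it in the first. Hence regularised means decrease together with the shift.\<close>

lemma geo_mean_mono:
  assumes "pd n A" "pd n B" "pd n C" "pd n D" and a: "0 < \<alpha>" "\<alpha> < 1"
    and le: "\<And>v. qf n A v \<le> qf n C v" "\<And>v. qf n B v \<le> qf n D v"
  shows "qf n (geo_mean \<alpha> A B) v \<le> qf n (geo_mean \<alpha> C D) v"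
proof -
  have "qf n (geo_mean \<alpha> A B) v \<le> qf n (geo_mean \<alpha> A D) v"
    using assms by (intro geo_mean_mono_right)
  also have "\<dots> = qf n (geo_mean (1 - \<alpha>) D A) v" using assms geo_mean_commute by metis
  also have "\<dots> \<le> qf n (geo_mean (1 - \<alpha>) D C) v" using assms by (intro geo_mean_mono_right) auto
  also have "\<dots> = qf n (geo_mean \<alpha> C D) v" using assms geo_mean_commute by metis
  finally show ?thesis .
qed

subsection \<open>Monotone limits\<close>

text \<open>Polarisation: \<open>c = 1\<close> recovers the real part of an entry from values of the
  form, and \<open>c = - \<i>\<close> the imaginary part.\<close>

lemma qf_polar:
  assumes F: "hermitian_mat n F" and ij: "i < n" "j < n"
  shows "2 * Re (c * F $$ (i, j)) = qf n F (\<lambda>a. (if a = i then 1 else 0) + c * (if a = j then 1 else 0))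
     - qf n F (\<lambda>a. if a = i then 1 else 0) - (cmod c)\<^sup>2 * qf n F (\<lambda>a. if a = j then 1 else 0)"
proof -
  have d: "(\<Sum>a<n. \<Sum>b<n. cnj (if a = k then x else 0) * F $$ (a, b) * (if b = l then y else 0)) = cnj x * F $$ (k, l) * y"
    if "k < n" "l < n" for k l x y
  proof -
    have "(\<Sum>a<n. \<Sum>b<n. cnj (if a = k then x else 0) * F $$ (a, b) * (if b = l then y else 0)) =
      (\<Sum>a<n. if a = k then cnj x * F $$ (a, l) * y else 0)"
      using that by (intro sum.cong refl) (simp add: if_distrib[where f = "\<lambda>z. _ * z"] cong: if_cong)
    then show ?thesis using that by simp
  qed
  have q1: "qf n F (\<lambda>a. if a = k then 1 else 0) = Re (F $$ (k, k))" if "k < n" for k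
    unfolding qf_def using d[OF that that, of 1 1] by simp
  let ?e = "\<lambda>k (x::complex) a. if a = k then x else 0"
  have "(\<Sum>a<n. \<Sum>b<n. cnj (?e i 1 a + ?e j c a) * F $$ (a, b) * (?e i 1 b + ?e j c b)) =
    (\<Sum>a<n. \<Sum>b<n. cnj (?e i 1 a) * F $$ (a, b) * ?e i 1 b) + (\<Sum>a<n. \<Sum>b<n. cnj (?e i 1 a) * F $$ (a, b) * ?e j c b)
    + (\<Sum>a<n. \<Sum>b<n. cnj (?e j c a) * F $$ (a, b) * ?e i 1 b) + (\<Sum>a<n. \<Sum>b<n. cnj (?e j c a) * F $$ (a, b) * ?e j c b)"
    unfolding sum.distrib[symmetric] by (intro sum.cong refl) (simp only: complex_cnj_add distrib_left distrib_right add_ac)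
  also have "\<dots> = F $$ (i, i) + F $$ (i, j) * c + cnj c * F $$ (j, i) + cnj c * F $$ (j, j) * c"
    using ij by (simp only: d) simp
  finally have "qf n F (\<lambda>a. ?e i 1 a + ?e j c a) = Re (F $$ (i, i) + F $$ (i, j) * c + cnj c * F $$ (j, i) + cnj c * F $$ (j, j) * c)"
    unfolding qf_def by simp
  also have "F $$ (j, i) = cnj (F $$ (i, j))" using herm_idx[OF F ij] by simp
  also have "cnj c * F $$ (j, j) * c = complex_of_real ((cmod c)\<^sup>2) * F $$ (j, j)"
    by (simp only: complex_norm_square mult_ac)
  finally have "qf n F (\<lambda>a. ?e i 1 a + ?e j c a) = Re (F $$ (i, i)) + 2 * Re (c * F $$ (i, j)) + (cmod c)\<^sup>2 * Re (F $$ (j, j))"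
    by (simp add: algebra_simps)
  moreover have "(\<lambda>a. (if a = i then 1 else 0) + c * (if a = j then 1 else 0)) = (\<lambda>a. ?e i 1 a + ?e j c a)" by auto
  ultimately show ?thesis using q1 ij by simp
qed

lemma tendsto_mono_at_right:
  fixes q :: "real \<Rightarrow> real"
  assumes mono: "\<And>s t. 0 < s \<Longrightarrow> s \<le> t \<Longrightarrow> q s \<le> q t" and nn: "\<And>t. 0 < t \<Longrightarrow> 0 \<le> q t"
  shows "\<exists>l. (q \<longlongrightarrow> l) (at_right 0) \<and> (\<forall>t>0. l \<le> q t)"
proof -
  let ?l = "INF t\<in>{0<..}. q t"
  have bdd: "bdd_below (q ` {0<..})" using nn by (auto intro!: bdd_belowI[of _ 0])
  have low: "?l \<le> q t" if "t > 0" for t using that by (intro cINF_lower[OF bdd]) auto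
  have "(q \<longlongrightarrow> ?l) (at_right 0)"
  proof (rule order_tendstoI)
    fix a assume "a < ?l"
    then show "eventually (\<lambda>t. a < q t) (at_right 0)"
      using low by (intro eventually_mono[OF eventually_at_right_less[of 0]]) (metis less_le_trans)
  next
    fix a assume "?l < a"
    then obtain t where t: "t > 0" "q t < a" by (subst (asm) cINF_less_iff[OF _ bdd]) auto
    have "eventually (\<lambda>s. 0 < s \<and> s < t) (at_right 0)" using eventually_at_right_real[OF t(1)] by simp
    then show "eventually (\<lambda>s. q s < a) (at_right 0)"
      by eventually_elim (use mono t in \<open>metis le_less_trans less_imp_le\<close>)
  qed
  then show ?thesis using low by blast
qed

text \<open>As t decreases, each form decreases and stays nonnegative, so it converges; polarisation
  passes from forms to entries.\<close>

lemma monotone_limit: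
  assumes F: "\<And>t. 0 < t \<Longrightarrow> psd_mat n (F t)" and mono: "\<And>s t v. 0 < s \<Longrightarrow> s \<le> t \<Longrightarrow> qf n (F s) v \<le> qf n (F t) v"
  shows "\<exists>L. psd_mat n L \<and> mlim n F L \<and> (\<forall>t>0. \<forall>v. qf n L v \<le> qf n (F t) v)"
proof -
  have "\<exists>l. ((\<lambda>t. qf n (F t) v) \<longlongrightarrow> l) (at_right 0) \<and> (\<forall>t>0. l \<le> qf n (F t) v)" for v
    by (rule tendsto_mono_at_right) (use F mono in \<open>simp_all add: psd_iff\<close>)
  then obtain l where l: "\<And>v. ((\<lambda>t. qf n (F t) v) \<longlongrightarrow> l v) (at_right 0)" and low: "\<And>v t. 0 < t \<Longrightarrow> l v \<le> qf n (F t) v"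
    by metis
  have re: "\<exists>x. ((\<lambda>t. Re (c * F t $$ (i, j))) \<longlongrightarrow> x) (at_right 0)" if ij: "i < n" "j < n" for i j c
  proof -
    let ?w = "\<lambda>a. (if a = i then 1 else 0) + c * (if a = j then 1 else 0)"
    let ?u = "\<lambda>k a. if a = k then 1 else (0 :: complex)"
    have "((\<lambda>t. (qf n (F t) ?w - qf n (F t) (?u i) - (cmod c)\<^sup>2 * qf n (F t) (?u j)) / 2) \<longlongrightarrow>
      (l ?w - l (?u i) - (cmod c)\<^sup>2 * l (?u j)) / 2) (at_right 0)"
      by (rule tendsto_divide[OF tendsto_diff[OF tendsto_diff[OF l l] tendsto_mult[OF tendsto_const l]] tendsto_const]) simp
    moreover have "eventually (\<lambda>t. (qf n (F t) ?w - qf n (F t) (?u i) - (cmod c)\<^sup>2 * qf n (F t) (?u j)) / 2 = Re (c * F t $$ (i, j))) (at_right 0)"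
    proof (rule eventually_mono[OF eventually_at_right_less[of 0]])
      fix t :: real assume "0 < t"
      then show "(qf n (F t) ?w - qf n (F t) (?u i) - (cmod c)\<^sup>2 * qf n (F t) (?u j)) / 2 = Re (c * F t $$ (i, j))"
        using qf_polar[OF psd_herm[OF F] ij, of t c] by simp
    qed
    ultimately have "((\<lambda>t. Re (c * F t $$ (i, j))) \<longlongrightarrow> (l ?w - l (?u i) - (cmod c)\<^sup>2 * l (?u j)) / 2) (at_right 0)"
      by (rule Lim_transform_eventually)
    then show ?thesis by (rule exI)
  qed
  have ex: "\<exists>z. ((\<lambda>t. F t $$ (i, j)) \<longlongrightarrow> z) (at_right 0)" if ij: "i < n" "j < n" for i j
  proof -
    obtain x y where x: "((\<lambda>t. Re (1 * F t $$ (i, j))) \<longlongrightarrow> x) (at_right 0)" 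
      and y: "((\<lambda>t. Re (- \<i> * F t $$ (i, j))) \<longlongrightarrow> y) (at_right 0)" using re[OF ij, of 1] re[OF ij, of "- \<i>"] by blast
    have "((\<lambda>t. Complex (Re (F t $$ (i, j))) (Im (F t $$ (i, j)))) \<longlongrightarrow> Complex x y) (at_right 0)"
      using x y by (intro tendsto_Complex) simp_all
    then show ?thesis by auto
  qed
  define z where "z i j = Lim (at_right 0) (\<lambda>t. F t $$ (i, j))" for i j
  have z: "((\<lambda>t. F t $$ (i, j)) \<longlongrightarrow> z i j) (at_right 0)" if ij: "i < n" "j < n" for i j
  proof -
    obtain w where w: "((\<lambda>t. F t $$ (i, j)) \<longlongrightarrow> w) (at_right 0)" using ex[OF ij] by blast
    then show ?thesis unfolding z_def using tendsto_Lim[OF trivial_limit_at_right_real w] by simp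
  qed
  define L where "L = mat n n (\<lambda>(i, j). z i j)"
  have Lc: "L \<in> sq n" by (simp add: L_def)
  have m: "mlim n F L" using z by (simp add: mlim_def L_def)
  have "hermitian_mat n L"
    unfolding hermitian_mat_def
  proof (intro conjI Lc)
    have "cnj (L $$ (j, i)) = L $$ (i, j)" if ij: "i < n" "j < n" for i j
    proof -
      have 1: "((\<lambda>t. cnj (F t $$ (j, i))) \<longlongrightarrow> cnj (L $$ (j, i))) (at_right 0)"
        using m ij by (intro tendsto_cnj) (auto simp: mlim_def)
      have "eventually (\<lambda>t. cnj (F t $$ (j, i)) = F t $$ (i, j)) (at_right 0)"
        by (rule eventually_mono[OF eventually_at_right_less[of 0]]) (use herm_idx[OF psd_herm[OF F]] ij in auto)
      then have "((\<lambda>t. F t $$ (i, j)) \<longlongrightarrow> cnj (L $$ (j, i))) (at_right 0)"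
        by (rule Lim_transform_eventually[OF 1])
      moreover have "((\<lambda>t. F t $$ (i, j)) \<longlongrightarrow> L $$ (i, j)) (at_right 0)" using m ij by (simp add: mlim_def)
      ultimately show ?thesis by (rule tendsto_unique[OF trivial_limit_at_right_real])
    qed
    then show "mat_adjoint L = L" using Lc by (intro sq_eqI[of _ n]) (auto simp: adj_idx[OF Lc])
  qed
  moreover have ql: "qf n L v = l v" for v
    by (rule tendsto_unique[OF trivial_limit_at_right_real qf_tendsto[OF m] l])
  moreover have "0 \<le> l v" for v
  proof (rule tendsto_lowerbound[OF l _ trivial_limit_at_right_real])
    show "eventually (\<lambda>t. 0 \<le> qf n (F t) v) (at_right 0)"
      by (rule eventually_mono[OF eventually_at_right_less[of 0]]) (use F in \<open>simp add: psd_iff\<close>)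
  qed
  ultimately have "psd_mat n L" by (simp add: psd_iff)
  then show ?thesis using m low ql by auto
qed

subsection \<open>Regularised pairs\<close>

abbreviation nrm :: "nat \<Rightarrow> (nat \<Rightarrow> complex) \<Rightarrow> real" where
  "nrm n v \<equiv> \<Sum>i<n. (cmod (v i))\<^sup>2"

definition shift :: "nat \<Rightarrow> complex mat \<Rightarrow> real \<Rightarrow> complex mat" where
  "shift n A t = A + complex_of_real t \<cdot>\<^sub>m 1\<^sub>m n"

lemma shift_ud:
  assumes "unitary_mat n U" shows "shift n (ud n U a) t = ud n U (\<lambda>i. a i + t)"
proof -
  note u = unitaryD(1)[OF assms]
  have "shift n (ud n U a) t = ud n U a + complex_of_real t \<cdot>\<^sub>m ud n U (\<lambda>_. 1)"
    by (simp add: shift_def ud_one[OF assms])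
  then show ?thesis by (simp add: ud_smult[OF u] ud_add[OF u])
qed

lemma shift_pd: "psd_mat n A \<Longrightarrow> 0 < t \<Longrightarrow> pd n (shift n A t)"
  by (erule psd_spectral) (auto simp: shift_ud add_nonneg_pos intro!: pdI)

lemma qf_shift: "A \<in> sq n \<Longrightarrow> qf n (shift n A t) v = qf n A v + t * nrm n v"
  by (simp add: shift_def qf_add qf_smult qf_one)

lemma nrm_nonneg: "0 \<le> nrm n v"
  by (intro sum_nonneg) auto

text \<open>The regularised means decrease with the shift, so the entrywise \<open>Lim\<close> in
  \<open>geo_mean\<close> is a true limit and lies below all of them.\<close>

lemma geo_mean_limit:
  assumes A: "psd_mat n A" and B: "psd_mat n B" and al: "0 < \<alpha>" "\<alpha> < 1" and nd: "\<not> supp_proj B \<preceq>\<^sub>L supp_proj A"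
  shows "psd_mat n (geo_mean \<alpha> A B)"
    "mlim n (\<lambda>t. geo_mean_formula \<alpha> (shift n A t) (shift n B t)) (geo_mean \<alpha> A B)"
    "0 < t \<Longrightarrow> qf n (geo_mean \<alpha> A B) v \<le> qf n (geo_mean \<alpha> (shift n A t) (shift n B t)) v"
proof -
  let ?F = "\<lambda>t. geo_mean_formula \<alpha> (shift n A t) (shift n B t)"
  have F: "?F t = geo_mean \<alpha> (shift n A t) (shift n B t)" if "0 < t" for t
    using geo_mean_pd[OF shift_pd[OF A that] pd_psd[OF shift_pd[OF B that]]] by simp
  have "\<exists>L. psd_mat n L \<and> mlim n ?F L \<and> (\<forall>t>0. \<forall>v. qf n L v \<le> qf n (?F t) v)"
  proof (rule monotone_limit)
    show "psd_mat n (?F t)" if "0 < t" for t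
      using that A B by (intro geo_mean_formula_psd pd_psd[OF shift_pd])
    show "qf n (?F s) v \<le> qf n (?F t) v" if "0 < s" "s \<le> t" for s t v
    proof -
      have t: "0 < t" using that by simp
      show ?thesis unfolding F[OF that(1)] F[OF t]
        using that t A B al
        by (intro geo_mean_mono shift_pd) (auto simp: qf_shift intro!: mult_right_mono nrm_nonneg)
    qed
  qed
  then obtain L where L: "psd_mat n L" "mlim n ?F L" "\<And>t v. 0 < t \<Longrightarrow> qf n L v \<le> qf n (?F t) v" by blast
  have dim: "dim_row A = n" using carrier_matD[OF psd_sq[OF A]] by simp
  have "geo_mean \<alpha> A B = mat n n (\<lambda>(i, j). Lim (at_right 0) (\<lambda>t. ?F t $$ (i, j)))"
    using nd by (simp add: geo_mean_def dim shift_def)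
  also have "\<dots> = L"
  proof (rule sq_eqI[of _ n])
    fix i j assume ij: "i < n" "j < n"
    have "((\<lambda>t. ?F t $$ (i, j)) \<longlongrightarrow> L $$ (i, j)) (at_right 0)" using L(2) ij by (simp add: mlim_def)
    then have "Lim (at_right 0) (\<lambda>t. ?F t $$ (i, j)) = L $$ (i, j)"
      by (rule tendsto_Lim[OF trivial_limit_at_right_real])
    then show "mat n n (\<lambda>(i, j). Lim (at_right 0) (\<lambda>t. ?F t $$ (i, j))) $$ (i, j) = L $$ (i, j)" using ij by simp
  qed (use L in auto)
  finally have e: "geo_mean \<alpha> A B = L" .
  show "psd_mat n (geo_mean \<alpha> A B)" "mlim n ?F (geo_mean \<alpha> A B)"
    "0 < t \<Longrightarrow> qf n (geo_mean \<alpha> A B) v \<le> qf n (geo_mean \<alpha> (shift n A t) (shift n B t)) v"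
    using L F unfolding e by auto
qed

lemma tr_mono: "psd_mat n A \<Longrightarrow> psd_mat n B \<Longrightarrow> (\<And>v. qf n A v \<le> qf n B v) \<Longrightarrow> tr A \<le> tr B"
  using tr_powr_mono[of n A B 1] by (simp add: mat_powr_one)

subsection \<open>The log-Euclidean mean at singular pairs\<close>

lemma qf_ud_mono:
  assumes "U \<in> sq n" "\<And>i. i < n \<Longrightarrow> d i \<le> e i" shows "qf n (ud n U d) v \<le> qf n (ud n U e) v"
  unfolding qf_ud[OF assms(1)] using assms(2) by (intro sum_mono mult_right_mono) auto

text \<open>On the support a small shift raises the logarithm by at most \<eta>. On the kernel the
  shifted eigenvalue is \<open>t\<close> itself, while \<open>mat_log A\<close> contributes 0. The
  factor of \<open>ln t\<close> is the form of the complementary projection.\<close>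

lemma log_shift_bound:
  assumes A: "psd_mat n A" and e: "0 < \<eta>"
  shows "eventually (\<lambda>t. \<forall>v. qf n (mat_log (shift n A t)) v
     \<le> qf n (mat_log A) v + \<eta> * nrm n v + ln t * (nrm n v - qf n (supp_proj A) v)) (at_right 0)"
proof -
  obtain U a where U: "unitary_mat n U" and a: "\<And>i. 0 \<le> a i" and Ae: "A = ud n U a"
    using psd_spectral[OF A] by blast
  note u = unitaryD(1)[OF U]
  let ?g = "\<lambda>t i. (if a i = 0 then 0 else ln (a i)) + \<eta> + ln t * (1 - (if a i = 0 then 0 else 1))"
  have "eventually (\<lambda>t. ln (a i + t) \<le> ?g t i) (at_right 0)" for i
  proof (cases "a i = 0")
    case True then show ?thesis using e by simp
  next
    case False
    then have ai: "a i > 0" using a[of i] by simp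
    have "((\<lambda>t. ln (a i + t)) \<longlongrightarrow> ln (a i + 0)) (at_right 0)"
      using ai by (intro tendsto_ln tendsto_add tendsto_const tendsto_ident_at) auto
    then have "eventually (\<lambda>t. ln (a i + t) < ln (a i) + \<eta>) (at_right 0)"
      using e by (intro order_tendstoD(2)) auto
    then show ?thesis using False by (auto elim: eventually_mono)
  qed
  then have "eventually (\<lambda>t. \<forall>i\<in>{..<n}. ln (a i + t) \<le> ?g t i) (at_right 0)"
    by (intro eventually_ball_finite) auto
  then show ?thesis using eventually_at_right_less[of 0]
  proof eventually_elim
    case (elim t)
    have nz: "a i + t \<noteq> 0" for i using a[of i] elim by simp
    have "qf n (mat_log (shift n A t)) v \<le> qf n (ud n U (?g t)) v" for v
      unfolding Ae shift_ud[OF U] log_ud[OF U] using elim nz by (intro qf_ud_mono u) auto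
    moreover have "qf n (ud n U (?g t)) v = qf n (mat_log A) v + \<eta> * nrm n v + ln t * (nrm n v - qf n (supp_proj A) v)" for v
      unfolding Ae log_ud[OF U] supp_ud[OF U] qf_ud[OF u] qf_unitary_norm[OF U, of v, symmetric]
      by (simp add: algebra_simps sum.distrib sum_distrib_left sum_subtractf)
    ultimately show ?case by simp
  qed
qed

text \<open>Young's inequality for the form, from its nonnegativity at
  \<open>\<theta> * x - y\<close>.\<close>

lemma qf_split:
  assumes A: "psd_mat n A" and th: "0 < \<theta>"
  shows "qf n A (\<lambda>i. x i + y i) \<le> (1 + \<theta>) * qf n A x + (1 + 1 / \<theta>) * qf n A y"
proof -
  let ?t = "complex_of_real \<theta>"
  have "(\<Sum>i<n. \<Sum>j<n. cnj (?t * x i - y i) * A $$ (i, j) * (?t * x j - y j))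
      + ?t * (\<Sum>i<n. \<Sum>j<n. cnj (x i + y i) * A $$ (i, j) * (x j + y j))
    = (?t * ?t + ?t) * (\<Sum>i<n. \<Sum>j<n. cnj (x i) * A $$ (i, j) * x j)
      + (1 + ?t) * (\<Sum>i<n. \<Sum>j<n. cnj (y i) * A $$ (i, j) * y j)"
    unfolding sum_distrib_left sum.distrib[symmetric]
    by (intro sum.cong refl) (simp add: algebra_simps)
  from arg_cong[OF this, of Re]
  have "qf n A (\<lambda>i. ?t * x i - y i) + \<theta> * qf n A (\<lambda>i. x i + y i) = (\<theta> * \<theta> + \<theta>) * qf n A x + (1 + \<theta>) * qf n A y"
    unfolding qf_def by simp
  moreover have "0 \<le> qf n A (\<lambda>i. ?t * x i - y i)" using A by (simp add: psd_iff)
  ultimately have "\<theta> * qf n A (\<lambda>i. x i + y i) \<le> \<theta> * ((1 + \<theta>) * qf n A x + (1 + 1 / \<theta>) * qf n A y)"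
    using th by (simp add: algebra_simps)
  then show ?thesis using th by simp
qed

lemma herm_bound:
  assumes "hermitian_mat n H"
  obtains h where "0 \<le> h" "\<And>v. qf n H v \<le> h * nrm n v" "psd_mat n (shift n H h)"
proof -
  obtain U d where U: "unitary_mat n U" and He: "H = ud n U d" using spectral_theorem[OF assms] by blast
  define h where "h = (\<Sum>i<n. \<bar>d i\<bar>)"
  have d: "\<bar>d i\<bar> \<le> h" if "i < n" for i unfolding h_def using that by (intro member_le_sum) auto
  have d2: "d i \<le> h" "0 \<le> d i + h" if "i < n" for i using d[OF that] by auto
  have "0 \<le> h" unfolding h_def by (intro sum_nonneg) auto
  moreover have "qf n H v \<le> h * nrm n v" for v unfolding He using d2 by (intro qf_ud_le_one[OF U])
  moreover have "psd_mat n (shift n H h)" unfolding He shift_ud[OF U] using d2 unitaryD(1)[OF U] by (intro psd_ud)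
  ultimately show ?thesis by (rule that)
qed

text \<open>The large constant \<open>C\<close> is harmless in the application: on the complement of the range of the
  projection, the regularised logarithms contribute \<open>ln t\<close>, which tends to \<open>-\<infinity>\<close>.\<close>

lemma compress_bound:
  assumes H: "hermitian_mat n H" and S: "unitary_mat n S" and e: "0 < \<eta>"
    and p: "\<And>i. p i = 0 \<or> p i = (1::real)"
  shows "\<exists>C. \<forall>v. qf n H v \<le> qf n (ud n S p * H * ud n S p) v + \<eta> * nrm n v + C * (nrm n v - qf n (ud n S p) v)"
proof -
  note s = unitaryD(1)[OF S] and Hc = hermD(1)[OF H]
  let ?P = "ud n S p" and ?Q = "ud n S (\<lambda>i. 1 - p i)"
  obtain h where h: "0 \<le> h" "\<And>v. qf n H v \<le> h * nrm n v" "psd_mat n (shift n H h)" using herm_bound[OF H] by blast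
  \<comment> \<open>Small enough that \<open>2 * h * \<theta> \<le> \<eta>\<close>; the summand 1
    keeps the denominator positive when \<open>h = 0\<close>.\<close>
  define \<theta> where "\<theta> = \<eta> / (2 * h + 1)"
  have th: "0 < \<theta>" "2 * h * \<theta> \<le> \<eta>" using e h(1) by (auto simp: \<theta>_def field_simps)
  have "qf n H v \<le> qf n (?P * H * ?P) v + \<eta> * nrm n v + (1 + 1 / \<theta>) * (2 * h) * (nrm n v - qf n ?P v)" for v
  proof -
    let ?x = "\<lambda>i. \<Sum>j<n. ?P $$ (i, j) * v j" and ?y = "\<lambda>i. \<Sum>j<n. ?Q $$ (i, j) * v j"
    have PQ: "?P + ?Q = 1\<^sub>m n" by (simp add: ud_add[OF s] ud_one[OF S])
    have v: "v i = ?x i + ?y i" if i: "i < n" for i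
    proof -
      have "?x i + ?y i = (\<Sum>j<n. (?P + ?Q) $$ (i, j) * v j)"
        using i by (simp add: carrier_matD[OF ud_carrier[OF s]] algebra_simps sum.distrib)
      also have "\<dots> = v i" unfolding PQ using i by (simp add: if_distrib[where f = "\<lambda>x. x * _"] cong: if_cong)
      finally show ?thesis ..
    qed
    have pp: "p i * p i = p i" "(1 - p i) * (1 - p i) = 1 - p i" for i using p[of i] by auto
    have nx: "nrm n ?x = qf n ?P v"
      using qf_conj[of "1\<^sub>m n" n ?P v] s by (simp add: qf_one ud_adj[OF s] ud_mult[OF S] pp)
    have ny: "nrm n ?y = nrm n v - qf n ?P v"
    proof -
      have "nrm n ?y = qf n ?Q v"
        using qf_conj[of "1\<^sub>m n" n ?Q v] s by (simp add: qf_one ud_adj[OF s] ud_mult[OF S] pp)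
      then show ?thesis unfolding qf_ud[OF s] qf_unitary_norm[OF S, of v, symmetric]
        by (simp add: algebra_simps sum_subtractf)
    qed
    have Hx: "qf n H ?x = qf n (?P * H * ?P) v" using qf_conj[OF Hc, of ?P v] s by (simp add: ud_adj[OF s])
    have nxv: "nrm n ?x \<le> nrm n v" using ny nx nrm_nonneg[where n = n and v = ?y] by linarith
    \<comment> \<open>Shifting by \<open>h\<close> makes \<open>H\<close> positive, so that
      \<open>qf_split\<close> can separate the parts inside and outside the range of the
      projection.\<close>
    have "qf n H v + h * nrm n v = qf n (shift n H h) (\<lambda>i. ?x i + ?y i)"
      unfolding qf_shift[OF Hc, symmetric] using v by (intro qf_cong)
    also have "\<dots> \<le> (1 + \<theta>) * (qf n H ?x + h * nrm n ?x) + (1 + 1 / \<theta>) * (qf n H ?y + h * nrm n ?y)"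
      using qf_split[OF h(3) th(1), of ?x ?y] by (simp only: qf_shift[OF Hc])
    also have "\<dots> \<le> qf n H ?x + h * nrm n ?x + \<theta> * (2 * h * nrm n ?x) + (1 + 1 / \<theta>) * (2 * h * nrm n ?y)"
    proof -
      have "\<theta> * (qf n H ?x + h * nrm n ?x) \<le> \<theta> * (2 * h * nrm n ?x)"
        using th(1) h(2)[of ?x] by (intro mult_left_mono) auto
      moreover have "(1 + 1 / \<theta>) * (qf n H ?y + h * nrm n ?y) \<le> (1 + 1 / \<theta>) * (2 * h * nrm n ?y)"
        using th(1) h(2)[of ?y] by (intro mult_left_mono) auto
      ultimately show ?thesis by (simp add: distrib_right)
    qed
    also have "\<theta> * (2 * h * nrm n ?x) \<le> \<eta> * nrm n v"
      using mult_mono[OF th(2) nxv] e nrm_nonneg[where n = n and v = ?x] by (simp add: mult_ac)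
    finally have "qf n H v + h * nrm n v \<le> qf n H ?x + h * nrm n ?x + \<eta> * nrm n v + (1 + 1 / \<theta>) * (2 * h * nrm n ?y)" by simp
    moreover have "h * nrm n ?x \<le> h * nrm n v" using nxv h(1) by (rule mult_left_mono)
    ultimately show ?thesis unfolding Hx ny by (simp add: mult.assoc)
  qed
  then show ?thesis by blast
qed

text \<open>Lying in the range of a support becomes the vanishing of a nonnegative form, so two such
  conditions can be merged by adding forms, as in \<open>LE_usc\<close>.\<close>

lemma supp_fixed_iff:
  assumes A: "psd_mat n A" and v: "v \<in> carrier_vec n"
  shows "supp_proj A *\<^sub>v v = v \<longleftrightarrow> nrm n (\<lambda>i. v $ i) - qf n (supp_proj A) (\<lambda>i. v $ i) = 0"
    and "0 \<le> nrm n w - qf n (supp_proj A) w"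
proof -
  obtain U a where U: "unitary_mat n U" and a: "\<And>i. 0 \<le> a i" and Ae: "A = ud n U a"
    using psd_spectral[OF A] by blast
  note u = unitaryD(1)[OF U]
  have e: "nrm n w - qf n (supp_proj A) w = qf n (ud n U (\<lambda>i. 1 - (if a i = 0 then 0 else 1))) w" for w
    unfolding Ae supp_ud[OF U] qf_ud[OF u] qf_unitary_norm[OF U, of w, symmetric]
    by (simp add: algebra_simps sum_subtractf)
  show "0 \<le> nrm n w - qf n (supp_proj A) w"
    unfolding e qf_ud[OF u] by (intro sum_nonneg) auto
  show "supp_proj A *\<^sub>v v = v \<longleftrightarrow> nrm n (\<lambda>i. v $ i) - qf n (supp_proj A) (\<lambda>i. v $ i) = 0"
    unfolding e unfolding Ae supp_ud[OF U] ud_fixed_iff[OF U v] qf_ud[OF u]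
    by (subst sum_nonneg_eq_0_iff) auto
qed

text \<open>The logarithms of the shifted matrices are bounded by those of \<open>A\<close> and
  \<open>B\<close>, a small multiple of the identity, and \<open>ln t\<close> times the complements
  of the supports. Under the exponential, the last term gives weight tending to 0 to the directions
  outside the meet, so only the compression of \<open>H\<close> to the meet survives.\<close>

lemma LE_usc:
  assumes A: "psd_mat n A" and B: "psd_mat n B" and al: "0 < \<alpha>" "\<alpha> < 1"
    and c: "\<And>t. 0 < t \<Longrightarrow> c \<le> tr (LE_mean \<alpha> (shift n A t) (shift n B t))"
  shows "c \<le> tr (LE_mean \<alpha> A B)"
proof -
  have hA: "hermitian_mat n (mat_log A)" and hB: "hermitian_mat n (mat_log B)"
    using A B by (auto intro: log_herm psd_herm)
  note cA = hermD(1)[OF hA] and cB = hermD(1)[OF hB]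
  define H where "H = complex_of_real (1 - \<alpha>) \<cdot>\<^sub>m mat_log A + complex_of_real \<alpha> \<cdot>\<^sub>m mat_log B"
  have H: "hermitian_mat n H" unfolding H_def by (intro herm_add herm_smult hA hB)
  note Hc = hermD(1)[OF H]
  have qH: "qf n H v = (1 - \<alpha>) * qf n (mat_log A) v + \<alpha> * qf n (mat_log B) v" for v
    unfolding H_def using cA cB by (simp add: qf_add qf_smult del: of_real_diff)
  have sA: "supp_proj A \<in> sq n" and sB: "supp_proj B \<in> sq n" using supp_psd[OF A] supp_psd[OF B] by auto
  \<comment> \<open>Both weights are positive, so the kernel of this sum is the intersection of the
    ranges of the two supports.\<close>
  define N where "N = complex_of_real (1 - \<alpha>) \<cdot>\<^sub>m (1\<^sub>m n - supp_proj A) + complex_of_real \<alpha> \<cdot>\<^sub>m (1\<^sub>m n - supp_proj B)"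
  have one: "hermitian_mat n (1\<^sub>m n)" by (simp add: hermitian_mat_def)
  have "hermitian_mat n N"
    unfolding N_def using one supp_herm[OF psd_herm[OF A]] supp_herm[OF psd_herm[OF B]]
    by (intro herm_add herm_smult herm_minus)
  moreover have qN: "qf n N v = (1 - \<alpha>) * (nrm n v - qf n (supp_proj A) v) + \<alpha> * (nrm n v - qf n (supp_proj B) v)" for v
    unfolding N_def using sA sB by (simp add: qf_add qf_smult qf_minus qf_one minus_carrier_mat del: of_real_diff)
  ultimately have N: "psd_mat n N"
    using al supp_fixed_iff(2)[OF A zero_carrier_vec] supp_fixed_iff(2)[OF B zero_carrier_vec] by (simp add: psd_iff)
  obtain S nu where S: "unitary_mat n S" and nu: "\<And>i. 0 \<le> nu i" and Ne: "N = ud n S nu"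
    using psd_spectral[OF N] by blast
  note s = unitaryD(1)[OF S]
  define p where "p i = (if nu i = 0 then 1 else 0 :: real)" for i
  have p01: "p i = 0 \<or> p i = 1" for i by (simp add: p_def)
  let ?P = "ud n S p"
  have pp0: "p i * p i = p i" for i using p01[of i] by auto
  have pp: "?P * ?P = ?P" by (simp only: ud_mult[OF S] pp0)
  have meet: "proj_meet (supp_proj A) (supp_proj B) = ?P"
  proof (rule proj_meet_eqI)
    show "dim_row (supp_proj A) = n" using sA by auto
    show "orth_proj n ?P" using s pp by (simp add: orth_proj_def)
    fix v :: "complex vec" assume v: "v \<in> carrier_vec n"
    let ?v = "\<lambda>i. v $ i"
    have "?P *\<^sub>v v = v \<longleftrightarrow> qf n N ?v = 0"
      unfolding ud_fixed_iff[OF S v] Ne qf_ud[OF s] p_def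
      by (subst sum_nonneg_eq_0_iff) (use nu in auto)
    also have "\<dots> \<longleftrightarrow> supp_proj A *\<^sub>v v = v \<and> supp_proj B *\<^sub>v v = v"
      unfolding qN supp_fixed_iff(1)[OF A v] supp_fixed_iff(1)[OF B v]
      using al supp_fixed_iff(2)[OF A v, of ?v] supp_fixed_iff(2)[OF B v, of ?v]
      by (subst add_nonneg_eq_0_iff) (auto simp del: diff_ge_0_iff_ge)
    finally show "?P *\<^sub>v v = v \<longleftrightarrow> supp_proj A *\<^sub>v v = v \<and> supp_proj B *\<^sub>v v = v" .
  qed
  define E where "E = ?P * H * ?P"
  have E: "hermitian_mat n E" using herm_conj[OF H s[THEN ud_carrier], of p] by (simp add: E_def ud_adj[OF s])
  have PE: "?P * E = E" "E * ?P = E"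
  proof -
    have "?P * E = (?P * ?P) * H * ?P" unfolding E_def using s Hc by (simp add: sq_assoc[of _ n])
    then show "?P * E = E" unfolding pp E_def .
    have "E * ?P = ?P * H * (?P * ?P)" unfolding E_def using s Hc by (simp add: sq_assoc[of _ n])
    then show "E * ?P = E" unfolding pp E_def .
  qed
  \<comment> \<open>The projection onto the meet commutes with the compression \<open>E\<close>, so
    one basis diagonalises both; the eigenvalues \<open>q\<close> remain among the old ones, 0 and
    1.\<close>
  obtain W q h where W: "unitary_mat n W" and Pq: "?P = ud n W q" and Eh: "E = ud n W h"
    and q': "\<And>k. k < n \<Longrightarrow> q k \<in> p ` {..<n}"
    using simultaneous_diag[OF S refl E, of p] PE by auto
  note w = unitaryD(1)[OF W]
  have q01: "q k = 0 \<or> q k = 1" if "k < n" for k using q'[OF that] p01 by (metis imageE)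
  have hq: "q k * h k = h k" if k: "k < n" for k
    using PE(1) qf_ud_col[OF W k, of "\<lambda>k. q k * h k"] qf_ud_col[OF W k, of h] unfolding Pq Eh ud_mult[OF W] by simp
  have LE: "tr (LE_mean \<alpha> A B) = (\<Sum>k<n. q k * exp (h k))"
  proof -
    have "complex_of_real (1 - \<alpha>) \<cdot>\<^sub>m (?P * mat_log A * ?P) + complex_of_real \<alpha> \<cdot>\<^sub>m (?P * mat_log B * ?P) = E"
      unfolding E_def H_def conj_linear[OF ud_carrier[OF s] cA cB ud_carrier[OF s]] ..
    then have "LE_mean \<alpha> A B = ?P * mat_exp E" unfolding LE_mean_def Let_def meet by simp
    also have "\<dots> = ud n W (\<lambda>k. q k * exp (h k))" unfolding Pq Eh exp_ud[OF W] ud_mult[OF W] ..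
    finally show ?thesis by (simp add: tr_ud[OF W])
  qed
  have "\<exists>c0>0. \<forall>i<n. nu i = 0 \<or> c0 \<le> nu i"
  proof -
    \<comment> \<open>The constant will be the smallest nonzero eigenvalue of \<open>N\<close>,
      capped at 1; inserting 1 keeps the minimum defined when there is none.\<close>
    let ?M = "insert 1 (nu ` {i. i < n \<and> nu i \<noteq> 0})"
    have fin: "finite ?M" by simp
    have "Min ?M > 0" using fin nu by (subst Min_gr_iff) (auto simp: less_le)
    moreover have "Min ?M \<le> nu i" if "i < n" "nu i \<noteq> 0" for i using that fin by (intro Min_le) auto
    ultimately show ?thesis by blast
  qed
  then obtain c0 where c0: "0 < c0" "\<And>i. i < n \<Longrightarrow> nu i = 0 \<or> c0 \<le> nu i" by blast
  have Nlow: "c0 * (nrm n v - qf n ?P v) \<le> qf n N v" for v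
  proof -
    have "c0 * (nrm n v - qf n ?P v) = qf n (ud n S (\<lambda>i. c0 * (1 - p i))) v"
      unfolding qf_ud[OF s] qf_unitary_norm[OF S, of v, symmetric]
      by (simp add: algebra_simps sum_subtractf sum_distrib_left)
    also have "\<dots> \<le> qf n N v" unfolding Ne using c0 nu by (intro qf_ud_mono s) (fastforce simp: p_def)
    finally show ?thesis .
  qed
  have step: "c \<le> exp (2 * \<eta>) * tr (LE_mean \<alpha> A B)" if eta: "0 < \<eta>" for \<eta>
  proof -
    obtain C where C: "\<And>v. qf n H v \<le> qf n E v + \<eta> * nrm n v + C * (nrm n v - qf n ?P v)"
      using compress_bound[OF H S eta, of p] p01 unfolding E_def by blast
    let ?d = "\<lambda>t k. h k + 2 * \<eta> + (C + c0 * ln t) * (1 - q k)"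
    have "eventually (\<lambda>t. c \<le> (\<Sum>k<n. exp (?d t k))) (at_right 0)"
      using log_shift_bound[OF A eta] log_shift_bound[OF B eta] ev_at_right
    proof eventually_elim
      case (elim t)
      then have t: "0 < t" "t < 1" and lA: "\<And>v. qf n (mat_log (shift n A t)) v \<le> qf n (mat_log A) v + \<eta> * nrm n v + ln t * (nrm n v - qf n (supp_proj A) v)"
        and lB: "\<And>v. qf n (mat_log (shift n B t)) v \<le> qf n (mat_log B) v + \<eta> * nrm n v + ln t * (nrm n v - qf n (supp_proj B) v)"
        by auto
      note pA = shift_pd[OF A t(1)] and pB = shift_pd[OF B t(1)]
      define K where "K = complex_of_real (1 - \<alpha>) \<cdot>\<^sub>m mat_log (shift n A t) + complex_of_real \<alpha> \<cdot>\<^sub>m mat_log (shift n B t)"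
      have hl: "hermitian_mat n (mat_log (shift n A t))" "hermitian_mat n (mat_log (shift n B t))"
        using pA pB by (auto intro: log_herm psd_herm pd_psd)
      have K: "hermitian_mat n K" unfolding K_def using hl by (intro herm_add herm_smult)
      have "qf n K v \<le> qf n (ud n W (?d t)) v" for v
      proof -
        have "qf n K v = (1 - \<alpha>) * qf n (mat_log (shift n A t)) v + \<alpha> * qf n (mat_log (shift n B t)) v"
          unfolding K_def using hl[THEN hermD(1)] by (simp add: qf_add qf_smult del: of_real_diff)
        also have "\<dots> \<le> (1 - \<alpha>) * (qf n (mat_log A) v + \<eta> * nrm n v + ln t * (nrm n v - qf n (supp_proj A) v))
          + \<alpha> * (qf n (mat_log B) v + \<eta> * nrm n v + ln t * (nrm n v - qf n (supp_proj B) v))"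
          using lA[of v] lB[of v] al by (intro add_mono mult_left_mono) auto
        also have "\<dots> = qf n H v + \<eta> * nrm n v + ln t * qf n N v"
          unfolding qH qN by (simp add: algebra_simps)
        \<comment> \<open>\<open>ln t\<close> is negative, so the lower bound on \<open>N\<close>
          becomes an upper bound.\<close>
        also have "ln t * qf n N v \<le> ln t * (c0 * (nrm n v - qf n ?P v))"
          using Nlow[of v] t by (intro mult_left_mono_neg) auto
        also have "qf n H v + \<eta> * nrm n v + ln t * (c0 * (nrm n v - qf n ?P v)) \<le>
          qf n E v + \<eta> * nrm n v + C * (nrm n v - qf n ?P v) + \<eta> * nrm n v + ln t * (c0 * (nrm n v - qf n ?P v))"
          using C[of v] by simp
        also have "\<dots> = qf n E v + 2 * \<eta> * nrm n v + (C + c0 * ln t) * (nrm n v - qf n ?P v)"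
          by (simp add: algebra_simps)
        also have "\<dots> = qf n (ud n W (?d t)) v"
          unfolding Eh Pq qf_ud[OF w] qf_unitary_norm[OF W, of v, symmetric]
          by (simp add: algebra_simps sum.distrib sum_distrib_left sum_subtractf)
        finally show ?thesis by simp
      qed
      note Kle = this
      obtain V k where V: "unitary_mat n V" and Kk: "K = ud n V k" using spectral_theorem[OF K] by blast
      have exp_conv: "convex_on UNIV (exp :: real \<Rightarrow> real)"
        by (rule f''_ge0_imp_convex[where f' = exp and f'' = exp]) (auto intro!: derivative_eq_intros)
      have "c \<le> tr (mat_exp K)" using c[OF t(1)] unfolding LE_pd[OF pA pB] K_def .
      also have "\<dots> = (\<Sum>i<n. exp (k i))" unfolding Kk exp_ud[OF V] tr_ud[OF V] ..
      also have "\<dots> \<le> (\<Sum>k<n. exp (?d t k))"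
        using Kle unfolding Kk by (intro trace_mono_convex[OF V W exp_conv]) (auto simp: mono_on_def)
      finally show ?case .
    qed
    moreover have "((\<lambda>t. \<Sum>k<n. exp (?d t k)) \<longlongrightarrow> (\<Sum>k<n. exp (2 * \<eta>) * (q k * exp (h k)))) (at_right 0)"
    proof (rule tendsto_sum)
      fix k assume "k \<in> {..<n}"
      then have k: "k < n" by simp
      show "((\<lambda>t. exp (?d t k)) \<longlongrightarrow> exp (2 * \<eta>) * (q k * exp (h k))) (at_right 0)"
      proof (cases "q k = 0")
        case False
        then have "q k = 1" using q01[OF k] by simp
        then show ?thesis by (simp add: exp_add mult.commute)
      next
        case True
        \<comment> \<open>Outside the meet the exponential is a constant times
          \<open>t powr c0\<close>, however large \<open>C\<close> is.\<close>
        have "((\<lambda>t::real. t powr c0) \<longlongrightarrow> 0 powr c0) (at_right 0)"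
          using c0(1) by (intro tendsto_powr' tendsto_const tendsto_ident_at disjI2 conjI)
            (auto intro: eventually_mono[OF ev_at_right])
        then have "((\<lambda>t. exp (h k + 2 * \<eta> + C) * t powr c0) \<longlongrightarrow> exp (h k + 2 * \<eta> + C) * 0) (at_right 0)"
          by (intro tendsto_mult tendsto_const) simp
        moreover have "eventually (\<lambda>t. exp (h k + 2 * \<eta> + C) * t powr c0 = exp (?d t k)) (at_right 0)"
        proof (rule eventually_mono[OF eventually_at_right_less[of 0]])
          fix t :: real assume "0 < t"
          then show "exp (h k + 2 * \<eta> + C) * t powr c0 = exp (?d t k)"
            using True by (simp add: powr_def exp_add algebra_simps)
        qed
        ultimately have "((\<lambda>t. exp (?d t k)) \<longlongrightarrow> exp (h k + 2 * \<eta> + C) * 0) (at_right 0)"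
          by (rule Lim_transform_eventually)
        then show ?thesis using True by simp
      qed
    qed
    ultimately have "c \<le> (\<Sum>k<n. exp (2 * \<eta>) * (q k * exp (h k)))"
      by (intro tendsto_lowerbound[OF _ _ trivial_limit_at_right_real])
    then show ?thesis unfolding LE sum_distrib_left .
  qed
  have "((\<lambda>\<eta>. exp (2 * \<eta>) * tr (LE_mean \<alpha> A B)) \<longlongrightarrow> exp (2 * 0) * tr (LE_mean \<alpha> A B)) (at_right 0)"
    by (intro tendsto_intros)
  moreover have "eventually (\<lambda>\<eta>. c \<le> exp (2 * \<eta>) * tr (LE_mean \<alpha> A B)) (at_right 0)"
    by (rule eventually_mono[OF eventually_at_right_less[of 0]]) (rule step)
  ultimately have "c \<le> exp (2 * 0) * tr (LE_mean \<alpha> A B)"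
    by (intro tendsto_lowerbound[OF _ _ trivial_limit_at_right_real])
  then show ?thesis by simp
qed

subsection \<open>Comparison with the maximal quantity: arbitrary supports\<close>

lemma shift_powr_herm: "psd_mat n A \<Longrightarrow> mat_powr (shift n A t) r \<in> sq n"
  by (erule psd_spectral) (simp add: shift_ud mat_powr_ud unitaryD(1))

lemma mlim_shift_powr:
  assumes A: "psd_mat n A" and r: "0 < r"
  shows "mlim n (\<lambda>t. mat_powr (shift n A t) r) (mat_powr A r)"
proof -
  obtain U a where U: "unitary_mat n U" and a: "\<And>i. 0 \<le> a i" and Ae: "A = ud n U a"
    using psd_spectral[OF A] by blast
  show ?thesis unfolding Ae shift_ud[OF U] mat_powr_ud[OF U]
  proof (intro mlim_ud unitaryD(1)[OF U])
    fix k
    have "((\<lambda>t. a k + t) \<longlongrightarrow> a k + 0) (at_right 0)" by (intro tendsto_add tendsto_const tendsto_ident_at)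
    then have "((\<lambda>t. a k + t) \<longlongrightarrow> a k) (at_right 0)" by simp
    then show "((\<lambda>t. (a k + t) powr r) \<longlongrightarrow> a k powr r) (at_right 0)"
    proof (rule tendsto_powr'[OF _ tendsto_const], intro disjI2 conjI r)
      show "eventually (\<lambda>t. 0 \<le> a k + t) (at_right 0)"
        using ev_at_right by eventually_elim (use a[of k] in auto)
    qed
  qed
qed

lemma supp_powr: "psd_mat n A \<Longrightarrow> supp_proj (mat_powr A r) = supp_proj A"
  by (erule psd_spectral) (simp add: mat_powr_ud supp_ud)

text \<open>Each eigenvalue satisfies \<open>a < (a^p + t)^(1/p)\<close> strictly; \<open>e\<close>
  is the smallest of these finitely many gaps, capped at 1. This compares the regularisation inside
  \<open>G\<close> with a plain shift.\<close>

lemma shift_le_root: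
  assumes A: "psd_mat n A" and p: "0 < p" and t: "0 < t"
  shows "\<exists>e>0. \<forall>d v. d \<le> e \<longrightarrow> qf n (shift n A d) v \<le> qf n (mat_powr (shift n (mat_powr A p) t) (1 / p)) v"
proof -
  obtain U a where U: "unitary_mat n U" and a: "\<And>i. 0 \<le> a i" and Ae: "A = ud n U a"
    using psd_spectral[OF A] by blast
  let ?b = "\<lambda>i. (a i powr p + t) powr (1 / p)"
  have b: "a i < ?b i" for i
  proof -
    have "a i = (a i powr p) powr (1 / p)" using a[of i] p by (simp add: powr_powr)
    also have "\<dots> < ?b i" using t p by (intro powr_less_mono2) auto
    finally show ?thesis .
  qed
  define e where "e = Min (insert 1 ((\<lambda>i. ?b i - a i) ` {..<n}))"
  have "e > 0" unfolding e_def using b by (subst Min_gr_iff) auto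
  moreover have "e \<le> ?b i - a i" if "i < n" for i unfolding e_def using that by (intro Min_le) auto
  then have "qf n (shift n A d) v \<le> qf n (mat_powr (shift n (mat_powr A p) t) (1 / p)) v" if "d \<le> e" for d v
    unfolding Ae shift_ud[OF U] mat_powr_ud[OF U] using that
    by (intro qf_ud_mono unitaryD(1)[OF U]) fastforce
  ultimately show ?thesis by blast
qed

text \<open>The domains of \<open>SG\<close> and \<open>SGt\<close> exclude this case. Shifted pairs
  are definite, so \<open>compare_G\<close> applies to them, and their geometric means lie above the
  limit \<open>geo_mean\<close>. It remains to return to the singular pair in \<open>Tr M\<close>,
  for which upper semicontinuity is enough.\<close>

lemma compare_G_singular:
  assumes jc: "jconc 1 k \<alpha> p" and n: "1 \<le> n" and p: "0 < p" and al: "0 < \<alpha>" "\<alpha> < 1"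
    and dom: "(A, B) \<in> qmean_dom k \<alpha> n" and nd: "\<not> supp_proj B \<preceq>\<^sub>L supp_proj A"
  shows "tr_qmean G \<alpha> 1 A B \<le> tr_qmean k \<alpha> p A B"
proof -
  have A: "psd_mat n A" and B: "psd_mat n B" and k: "k \<noteq> SG" "k \<noteq> SGt"
    using dom nd by (auto simp: qmean_dom_def)
  note gl = geo_mean_limit[OF A B al nd]
  let ?c = "tr (geo_mean \<alpha> A B)"
  have Gc: "tr_qmean G \<alpha> 1 A B = ?c" using G_mean_one[OF A B gl(1)] by (simp add: tr_qmean_def)
  have gG: "tr (geo_mean \<alpha> A' B') \<le> tr_qmean k \<alpha> p A' B'" if pd: "pd n A'" "pd n B'" for A' B'
  proof -
    have "\<And>v. qf n A' v = 0 \<Longrightarrow> qf n B' v = 0"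
      using supp_le_pd[OF pd(1) pd_psd[OF pd(2)]] supp_le_iff[OF pd(1)[THEN pd_psd] pd(2)[THEN pd_psd]] by blast
    from compare_G[OF jc n p pd(1)[THEN pd_psd] pd(2)[THEN pd_psd] this]
    have "tr_qmean G \<alpha> 1 A' B' \<le> tr_qmean k \<alpha> p A' B'" by simp
    then show ?thesis
      using G_mean_one[OF pd(1)[THEN pd_psd] pd(2)[THEN pd_psd] pd_geo_mean[OF pd, THEN pd_psd]] by (simp add: tr_qmean_def)
  qed
  have cle: "?c \<le> tr (geo_mean \<alpha> (shift n A t) (shift n B t))" if "0 < t" for t
    using gl(1) gl(3)[OF that] shift_pd[OF A that] shift_pd[OF B that]
    by (intro tr_mono[OF gl(1)]) (auto intro: pd_psd pd_geo_mean)
  have base: "?c \<le> tr_qmean k \<alpha> p (shift n A t) (shift n B t)" if "0 < t" for t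
    using cle[OF that] gG[OF shift_pd[OF A that] shift_pd[OF B that]] by simp
  consider (R) "k = R" | (LE) "k = LE" | (G) "k = G" using k by (cases k) auto
  then have "?c \<le> tr_qmean k \<alpha> p A B"
  proof cases
    case R
    let ?r = "(1 - \<alpha>) / 2 * p"
    have r: "0 < ?r" "0 < \<alpha> * p" using al p by auto
    let ?X = "\<lambda>t. mat_powr (shift n A t) ?r * mat_powr (shift n B t) (\<alpha> * p) * mat_powr (shift n A t) ?r"
    let ?L = "mat_powr A ?r * mat_powr B (\<alpha> * p) * mat_powr A ?r"
    have m: "mlim n ?X ?L"
      using mat_powr_psd[OF A, of ?r] mat_powr_psd[OF B, of "\<alpha> * p"] r
      by (intro mlim_mult mlim_shift_powr sq_mult shift_powr_herm A B) auto
    have "?c \<le> tr (mat_powr ?L (1 / p))"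
    proof (rule trace_powr_usc[OF _ _ m _ _ tendsto_const])
      show "psd_mat n (?X t)" if "0 < t" for t
        using shift_pd[OF A that] shift_pd[OF B that] by (intro psd_conj_powr mat_powr_psd) (auto intro: pd_psd)
      show "psd_mat n ?L" using A B by (intro psd_conj_powr mat_powr_psd)
      show "?c \<le> tr (mat_powr (?X t) (1 / p))" if "0 < t" for t
        using base[OF that] by (simp add: R tr_qmean_def R_mean_def)
    qed (use p in auto)
    then show ?thesis by (simp add: R tr_qmean_def R_mean_def)
  next
    case LE
    have "?c \<le> tr (LE_mean \<alpha> A B)"
      using base by (intro LE_usc[OF A B al]) (simp add: LE tr_qmean_def)
    then show ?thesis by (simp add: LE tr_qmean_def)
  next
    case G
    have Ap: "psd_mat n (mat_powr A p)" and Bp: "psd_mat n (mat_powr B p)" using A B by (auto intro: mat_powr_psd)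
    have nd': "\<not> supp_proj (mat_powr B p) \<preceq>\<^sub>L supp_proj (mat_powr A p)" using nd by (simp add: supp_powr[OF A] supp_powr[OF B])
    note glp = geo_mean_limit[OF Ap Bp al nd']
    let ?F = "\<lambda>t. geo_mean_formula \<alpha> (shift n (mat_powr A p) t) (shift n (mat_powr B p) t)"
    have "?c \<le> tr (mat_powr (geo_mean \<alpha> (mat_powr A p) (mat_powr B p)) (1 / p))"
    proof (rule trace_powr_usc[OF _ glp(1) glp(2) _ _ tendsto_const])
      show "psd_mat n (?F t)" if "0 < t" for t
        using that Ap Bp by (intro geo_mean_formula_psd pd_psd[OF shift_pd])
      show "?c \<le> tr (mat_powr (?F t) (1 / p))" if t: "0 < t" for t
      proof -
        note pA = shift_pd[OF Ap t] and pB = shift_pd[OF Bp t]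
        \<comment> \<open>The regularisation adds t to \<open>A^p\<close>, not to \<open>A\<close>.
          The matrix \<open>?At\<close> is the definite one whose p-th power is
          \<open>A^p + t\<close>, so \<open>compare_G\<close> applies to it; it dominates a plain
          shift of \<open>A\<close>, for which the bound by \<open>?c\<close> is known.\<close>
        let ?At = "mat_powr (shift n (mat_powr A p) t) (1 / p)" and ?Bt = "mat_powr (shift n (mat_powr B p) t) (1 / p)"
        have pd: "pd n ?At" "pd n ?Bt" using pA pB by (auto intro: pd_powr)
        have pw: "mat_powr ?At p = shift n (mat_powr A p) t" "mat_powr ?Bt p = shift n (mat_powr B p) t"
          using mat_powr_powr[OF pd_psd[OF pA], of "1 / p" p] mat_powr_powr[OF pd_psd[OF pB], of "1 / p" p]
            mat_powr_one[OF pd_psd[OF pA]] mat_powr_one[OF pd_psd[OF pB]] p by auto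
        obtain e1 e2 where e: "0 < e1" "\<And>d v. d \<le> e1 \<Longrightarrow> qf n (shift n A d) v \<le> qf n ?At v"
          "0 < e2" "\<And>d v. d \<le> e2 \<Longrightarrow> qf n (shift n B d) v \<le> qf n ?Bt v"
          using shift_le_root[OF A p t] shift_le_root[OF B p t] by blast
        let ?d = "min e1 e2"
        have d: "0 < ?d" using e by simp
        have "?c \<le> tr (geo_mean \<alpha> (shift n A ?d) (shift n B ?d))" using cle[OF d] .
        also have "\<dots> \<le> tr (geo_mean \<alpha> ?At ?Bt)"
          using shift_pd[OF A d] shift_pd[OF B d] pd e al
          by (intro tr_mono geo_mean_mono pd_psd[OF pd_geo_mean]) auto
        also have "\<dots> \<le> tr_qmean k \<alpha> p ?At ?Bt" using gG[OF pd] .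
        also have "\<dots> = tr (mat_powr (?F t) (1 / p))"
          unfolding G tr_qmean_def qmean.simps G_mean_def pw geo_mean_pd[OF pA pd_psd[OF pB]] ..
        finally show ?thesis .
      qed
    qed (use p in auto)
    then show ?thesis by (simp add: G tr_qmean_def G_mean_def)
  qed
  then show ?thesis unfolding Gc .
qed

lemma compare_G_concave:
  assumes jc: "jconc 1 k \<alpha> p" and n: "1 \<le> n" and p: "0 < p" and al: "0 < \<alpha>" "\<alpha> < 1"
    and dom: "(A, B) \<in> qmean_dom k \<alpha> n"
  shows "tr_qmean G \<alpha> 1 A B \<le> tr_qmean k \<alpha> p A B"
proof (cases "supp_proj B \<preceq>\<^sub>L supp_proj A")
  case True
  have AB: "psd_mat n A" "psd_mat n B" using dom by (auto simp: dom_iff)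
  then have "\<And>v. qf n A v = 0 \<Longrightarrow> qf n B v = 0" using True supp_le_iff by blast
  from compare_G[OF jc n p AB this] show ?thesis by simp
next
  case False
  then show ?thesis using compare_G_singular[OF jc n p al dom] by blast
qed

lemma compare_G_convex:
  assumes jc: "jconc (-1) k \<alpha> p" and n: "1 \<le> n" and p: "0 < p" and al: "1 < \<alpha>"
    and dom: "(A, B) \<in> qmean_dom k \<alpha> n"
  shows "tr_qmean k \<alpha> p A B \<le> tr_qmean G \<alpha> 1 A B"
proof -
  have AB: "psd_mat n A" "psd_mat n B" and "\<And>v. qf n A v = 0 \<Longrightarrow> qf n B v = 0"
    using dom al by (auto simp: dom_iff)
  from compare_G[OF jc n p this] show ?thesis by simp
qed

lemma half_powr: "(1 / 2 :: real) \<le> (1 / 2) powr \<alpha> \<longleftrightarrow> \<alpha> \<le> 1" "(1 / 2 :: real) powr \<alpha> \<le> 1 / 2 \<longleftrightarrow> 1 \<le> \<alpha>"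
  using powr_less_cancel_iff[of 2 "-1" "- \<alpha>"] powr_less_cancel_iff[of 2 "- \<alpha>" "-1"]
  by (auto simp: powr_minus powr_divide divide_simps not_less[symmetric])

theorem theorem5p8:
  fixes \<alpha> p :: real and k :: mean_kind
  assumes "0 < \<alpha>" and "\<alpha> \<noteq> 1" and "0 < p"
  shows "(tr_jointly_concave k \<alpha> p \<longrightarrow>
            0 < \<alpha> \<and> \<alpha> < 1 \<and>
            (\<forall>n\<ge>1. \<forall>(A, B)\<in>qmean_dom k \<alpha> n.
               tr_qmean G \<alpha> 1 A B \<le> tr_qmean k \<alpha> p A B \<and>
               tr_qmean k \<alpha> p A B \<le> tr_qmean R \<alpha> (1/\<alpha>) A B)) \<and>
         (tr_jointly_convex k \<alpha> p \<longrightarrow>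
            1 < \<alpha> \<and>
            (\<forall>n\<ge>1. \<forall>(A, B)\<in>qmean_dom k \<alpha> n.
               tr_qmean R \<alpha> (1/\<alpha>) A B \<le> tr_qmean k \<alpha> p A B \<and>
               tr_qmean k \<alpha> p A B \<le> tr_qmean G \<alpha> 1 A B))"
proof (intro conjI impI)
  assume "tr_jointly_concave k \<alpha> p"
  then have jc: "jconc 1 k \<alpha> p" by (simp add: jconc_concave)
  show "0 < \<alpha>" by fact
  show al: "\<alpha> < 1" using jconc_alpha[OF jc assms(3)] half_powr(1)[of \<alpha>] assms(2) by simp
  show "\<forall>n\<ge>1. \<forall>(A, B)\<in>qmean_dom k \<alpha> n.
               tr_qmean G \<alpha> 1 A B \<le> tr_qmean k \<alpha> p A B \<and>
               tr_qmean k \<alpha> p A B \<le> tr_qmean R \<alpha> (1/\<alpha>) A B"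
    using compare_G_concave[OF jc _ assms(3,1) al] compare_R_concave[OF jc _ assms(3,1) al] by blast
next
  assume "tr_jointly_convex k \<alpha> p"
  then have jc: "jconc (-1) k \<alpha> p" by (simp add: jconc_convex)
  show al: "1 < \<alpha>" using jconc_alpha[OF jc assms(3)] half_powr(2)[of \<alpha>] assms(2) by simp
  show "\<forall>n\<ge>1. \<forall>(A, B)\<in>qmean_dom k \<alpha> n.
               tr_qmean R \<alpha> (1/\<alpha>) A B \<le> tr_qmean k \<alpha> p A B \<and>
               tr_qmean k \<alpha> p A B \<le> tr_qmean G \<alpha> 1 A B"
    using compare_G_convex[OF jc _ assms(3) al] compare_R_convex[OF jc _ assms(3) al] by blast
qed

end
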